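(* Assume $\beta\leq0$ and $\gamma\leq0$. (1) If $\alpha\delta>\beta\gamma$, then for every pair of nonnegative $\mathcal F_0$-measurable initial values there exists a pathwise unique strong O2BP (with values in $S$). (2) If $\alpha\delta\leq\beta\gamma$ and $1+\rho+|\alpha+\gamma|+|\beta+\delta|>0$, then no O2BP exists (for any initial values). (3) If $1+\rho=\alpha+\gamma=\beta+\delta=0$ and $(X_0,Y_0)\neq(0,0)$, then there exists a pathwise unique strong O2BP. (4) If $1+\rho=\alpha+\gamma=\beta+\delta=0$ and $(X_0,Y_0)=(0,0)$, then no O2BP exists.
   Context: On a complete filtered probability space with usual conditions, $(B,C)$ is an adapted planar Brownian motion started at $0$ with $\langle B\rangle_t=\langle C\rangle_t=t$, $\langle B,C\rangle_t=\rho t$, $\rho\in[-1,1]$. $S=[0,\infty)^2$. With $\alpha>0,\delta>0,\beta,\gamma\in\mathbb R$, an O2BP is an adapted continuous $S$-valued process $(X,Y)$ with $X_t=X_0+B_t+\alpha\int_0^t\frac{ds}{X_s}+\beta\int_0^t\frac{ds}{Y_s}$, $Y_t=Y_0+C_t+\gamma\int_0^t\frac{ds}{X_s}+\delta\int_0^t\frac{ds}{Y_s}$ for all $t\ge0$, nonnegative $\mathcal F_0$-measurable $X_0,Y_0$, $\int_0^t\mathbf 1_{\{X_s=0\}}ds=\int_0^t\mathbf 1_{\{Y_s=0\}}ds=0$ and $\int_0^t\mathbf 1_{\{X_s>0\}}\frac{ds}{X_s}<\infty$, $\int_0^t\mathbf 1_{\{Y_s>0\}}\frac{ds}{Y_s}<\infty$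 for all $t$. *)

theory Defs
  imports "HOL-Probability.Probability"
begin

definition usual_conditions :: "'a measure \<Rightarrow> (real \<Rightarrow> 'a measure) \<Rightarrow> bool" where
  "usual_conditions M F \<longleftrightarrow>
     prob_space M \<and>
     (\<forall>A N. N \<in> null_sets M \<and> A \<subseteq> N \<longrightarrow> A \<in> sets M) \<and>
     (\<forall>t. space (F t) = space M \<and> sets (F t) \<subseteq> sets M) \<and>
     (\<forall>s t. 0 \<le> s \<and> s \<le> t \<longrightarrow> sets (F s) \<subseteq> sets (F t)) \<and>
     null_sets M \<subseteq> sets (F 0) \<and>
     (\<forall>t\<ge>0. sets (F t) = (\<Inter>u\<in>{t<..}. sets (F u)))"

text \<open>(B,C) is an (F)-adapted planar Brownian motion started at 0 with
  <B>_t = <C>_t = t and <B,C>_t = \<rho> t.  The Gaussian-increment / independence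
  property is expressed via characteristic functions: for 0 \<le> s \<le> t, A \<in> F s,
  E[1_A exp(i(u \<Delta>B + v \<Delta>C))] = P(A) exp(-(t-s)(u^2+2\<rho>uv+v^2)/2).\<close>
definition planar_BM :: "'a measure \<Rightarrow> (real \<Rightarrow> 'a measure) \<Rightarrow> real \<Rightarrow>
    (real \<Rightarrow> 'a \<Rightarrow> real) \<Rightarrow> (real \<Rightarrow> 'a \<Rightarrow> real) \<Rightarrow> bool" where
  "planar_BM M F \<rho> B C \<longleftrightarrow>
     (\<forall>t\<ge>0. B t \<in> borel_measurable (F t) \<and> C t \<in> borel_measurable (F t)) \<and>
     (AE \<omega> in M. B 0 \<omega> = 0 \<and> C 0 \<omega> = 0 \<and>
        continuous_on {0..} (\<lambda>t. B t \<omega>) \<and> continuous_on {0..} (\<lambda>t. C t \<omega>)) \<and>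
     (\<forall>s t A u v. 0 \<le> s \<and> s \<le> t \<and> A \<in> sets (F s) \<longrightarrow>
        (\<integral>\<omega>. indicator A \<omega> *
            exp (\<i> * complex_of_real (u * (B t \<omega> - B s \<omega>) + v * (C t \<omega> - C s \<omega>))) \<partial>M)
        = complex_of_real (measure M A *
            exp (- (t - s) * (u\<^sup>2 + 2 * \<rho> * u * v + v\<^sup>2) / 2)))"

text \<open>O2BP: adapted continuous S-valued process solving the system.
  Note 1/0 = 0 in Isabelle, so ennreal (1 / X s \<omega>) = 1_{X_s>0}/X_s for X_s \<ge> 0.\<close>
definition O2BP :: "'a measure \<Rightarrow> (real \<Rightarrow> 'a measure) \<Rightarrow> real \<Rightarrow> real \<Rightarrow> real \<Rightarrow> real \<Rightarrow>
    (real \<Rightarrow> 'a \<Rightarrow> real) \<Rightarrow> (real \<Rightarrow> 'a \<Rightarrow> real) \<Rightarrow>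
    (real \<Rightarrow> 'a \<Rightarrow> real) \<Rightarrow> (real \<Rightarrow> 'a \<Rightarrow> real) \<Rightarrow> bool" where
  "O2BP M F \<alpha> \<beta> \<gamma> \<delta> B C X Y \<longleftrightarrow>
     (\<forall>t\<ge>0. X t \<in> borel_measurable (F t) \<and> Y t \<in> borel_measurable (F t)) \<and>
     (AE \<omega> in M.
        continuous_on {0..} (\<lambda>t. X t \<omega>) \<and> continuous_on {0..} (\<lambda>t. Y t \<omega>) \<and>
        (\<forall>t\<ge>0.
          X t \<omega> \<ge> 0 \<and> Y t \<omega> \<ge> 0 \<and>
          emeasure lborel {s\<in>{0..t}. X s \<omega> = 0} = 0 \<and>
          emeasure lborel {s\<in>{0..t}. Y s \<omega> = 0} = 0 \<and>
          set_nn_integral lborel {0..t} (\<lambda>s. ennreal (1 / X s \<omega>)) < \<infinity> \<and>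
          set_nn_integral lborel {0..t} (\<lambda>s. ennreal (1 / Y s \<omega>)) < \<infinity> \<and>
          X t \<omega> = X 0 \<omega> + B t \<omega> + \<alpha> * (\<integral>s\<in>{0..t}. 1 / X s \<omega> \<partial>lborel)
                              + \<beta> * (\<integral>s\<in>{0..t}. 1 / Y s \<omega> \<partial>lborel) \<and>
          Y t \<omega> = Y 0 \<omega> + C t \<omega> + \<gamma> * (\<integral>s\<in>{0..t}. 1 / X s \<omega> \<partial>lborel)
                              + \<delta> * (\<integral>s\<in>{0..t}. 1 / Y s \<omega> \<partial>lborel)))"

definition aug_nat_sets :: "'a measure \<Rightarrow> ('a \<Rightarrow> real) \<Rightarrow> ('a \<Rightarrow> real) \<Rightarrow>
    (real \<Rightarrow> 'a \<Rightarrow> real) \<Rightarrow> (real \<Rightarrow> 'a \<Rightarrow> real) \<Rightarrow> real \<Rightarrow> 'a set set" where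
  "aug_nat_sets M X0 Y0 B C t =
     sigma_sets (space M)
       ({f -` D \<inter> space M | f D. f \<in> {X0, Y0} \<union> {B s | s. s \<in> {0..t}} \<union> {C s | s. s \<in> {0..t}}
                                  \<and> D \<in> sets borel} \<union> null_sets M)"

definition strong_O2BP where
  "strong_O2BP M F \<alpha> \<beta> \<gamma> \<delta> B C X0 Y0 X Y \<longleftrightarrow>
     O2BP M F \<alpha> \<beta> \<gamma> \<delta> B C X Y \<and>
     (AE \<omega> in M. X 0 \<omega> = X0 \<omega> \<and> Y 0 \<omega> = Y0 \<omega>) \<and>
     (\<forall>t\<ge>0. \<forall>D\<in>sets borel.
        X t -` D \<inter> space M \<in> aug_nat_sets M X0 Y0 B C t \<and>
        Y t -` D \<inter> space M \<in> aug_nat_sets M X0 Y0 B C t)"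

definition pathwise_unique_O2BP where
  "pathwise_unique_O2BP M F \<alpha> \<beta> \<gamma> \<delta> B C X0 Y0 \<longleftrightarrow>
     (\<forall>X Y X' Y'.
        O2BP M F \<alpha> \<beta> \<gamma> \<delta> B C X Y \<and> O2BP M F \<alpha> \<beta> \<gamma> \<delta> B C X' Y' \<and>
        (AE \<omega> in M. X 0 \<omega> = X0 \<omega> \<and> Y 0 \<omega> = Y0 \<omega>) \<and>
        (AE \<omega> in M. X' 0 \<omega> = X0 \<omega> \<and> Y' 0 \<omega> = Y0 \<omega>) \<longrightarrow>
        (AE \<omega> in M. \<forall>t\<ge>0. X t \<omega> = X' t \<omega> \<and> Y t \<omega> = Y' t \<omega>))"

definition init_ok where
  "init_ok M F X0 Y0 \<longleftrightarrow> X0 \<in> borel_measurable (F 0) \<and> Y0 \<in> borel_measurable (F 0) \<and>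
     (AE \<omega> in M. X0 \<omega> \<ge> 0 \<and> Y0 \<omega> \<ge> 0)"

end

theory Submission
  imports Defs
begin

text \<open>The noise is additive, so all comparison arguments are pathwise. Choose weights \<open>v1, v2 > 0\<close> such that
  \<open>v1 * \<alpha> + v2 * \<gamma> \<ge> 0\<close> and \<open>v2 * \<delta> + v1 * \<beta> \<ge> 0\<close> (possible iff \<open>\<beta> * \<gamma> \<le> \<alpha> * \<delta>\<close>). Since \<open>1 / x\<close> is decreasing and
  \<open>\<beta>, \<gamma> \<le> 0\<close>, the weighted distance \<open>v1 * \<bar>X - X'\<bar> + v2 * \<bar>Y - Y'\<bar>\<close> of two solutions is nonincreasing: this is
  pathwise uniqueness. For existence, replace \<open>1 / x\<close> by Lipschitz functions \<open>phi a\<close> and solve by Picard iteration.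
  The same estimate bounds the distance of two approximations, and the \<open>L\<^sup>1\<close> distance of their drifts, by
  \<open>a powr \<epsilon>\<close> times the integral of \<open>phi(X) powr (1 + \<epsilon>) + phi(Y) powr (1 + \<epsilon>)\<close>. The expectation of that integral is
  bounded uniformly in \<open>a\<close> by Dynkin's formula for a function with derivative \<open>phi powr \<epsilon>\<close>; no stochastic
  integral is needed, a Taylor expansion along partitions suffices. In the degenerate case \<open>X + Y\<close> is constant and
  positive, so the two singularities are never active at the same time. For nonexistence, a nonnegative combination
  of \<open>X\<close> and \<open>Y\<close> is dominated by a one-dimensional Brownian motion, which cannot stay bounded from below.\<close>

section \<open>Chain rule for indefinite integrals\<close>

text \<open>A bound on the integral of \<open>1 / X\<close> alone would give convergence without a
  rate. Raising the exponent from 1 to \<open>1 + \<epsilon>\<close> buys the factor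
  \<open>a powr \<epsilon>\<close>, which is summable along \<open>a = (1/2) ^ k\<close>; this
  yields almost sure locally uniform convergence, and hence adaptedness to the augmented natural
  filtration. The growth bound of the test function must not depend on \<open>a\<close>;
  \<open>\<epsilon> \<le> 1 / 2\<close> ensures this, because \<open>phi powr \<epsilon>\<close> is
  then dominated by \<open>1 + 1 / sqrt x\<close>. Initial values need not be integrable, so only
  increments \<open>g (Z T) - g (Z 0)\<close> are averaged. The weights are
  \<open>v1 = \<delta> - \<gamma>\<close> and \<open>v2 = \<alpha> - \<beta>\<close>; both weighted
  column sums then equal the determinant \<open>\<alpha> * \<delta> - \<beta> * \<gamma>\<close>. If
  it is positive, the surplus controls the drifts in \<open>L1\<close>. If it vanishes in the
  degenerate case, the differences of two approximations are opposite in the two components, and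
  this turns the cross term into a dissipative one. The constants of that case depend on a lower
  bound for \<open>X0 + Y0\<close>, hence the localisation to sets in \<open>F 0\<close>.\<close>

lemma uniform_partition_mem:
  assumes "i < N" "0 \<le> t"
  shows "{t * real i / real N..t * real (Suc i) / real N} \<subseteq> {0..t}"
proof -
  have "t * real (Suc i) \<le> t * real N" using assms by (intro mult_left_mono) auto
  then have "t * real (Suc i) / real N \<le> t" using assms by (simp add: field_simps)
  moreover have "0 \<le> t * real i / real N" using assms by simp
  ultimately show ?thesis by auto
qed

lemma integral_uniform_partition:
  fixes f :: "real \<Rightarrow> real"
  assumes "f integrable_on {0..t}" "0 \<le> t" "0 < N"
  shows "integral {0..t} f = (\<Sum>i<N. integral {t * real i / real N..t * real (Suc i) / real N} f)"
proof -
  have "integral {0..t * real n / real N} f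
      = (\<Sum>i<n. integral {t * real i / real N..t * real (Suc i) / real N} f)" if "n \<le> N" for n
    using that
  proof (induction n)
    case 0
    then show ?case by simp
  next
    case (Suc n)
    let ?u = "t * real (Suc n) / real N"
    have sub: "{t * real n / real N..?u} \<subseteq> {0..t}"
      using uniform_partition_mem[of n N t] Suc assms by auto
    have le: "t * real n / real N \<le> ?u" using assms by (intro divide_right_mono mult_left_mono) auto
    have "f integrable_on {0..?u}"
      using sub le by (intro integrable_on_subinterval[OF assms(1)]) auto
    then have "integral {0..?u} f = integral {0..t * real n / real N} f + integral {t * real n / real N..?u} f"
      using Henstock_Kurzweil_Integration.integral_combine[of 0 "t * real n / real N" ?u f] le assms by simp
    then show ?case using Suc by simp
  qed
  from this[of N] show ?thesis using assms by simp
qed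

text \<open>Uniform continuity of \<open>p\<close> bounds the error on each cell by a small multiple
  of the integral of \<open>\<bar>q\<bar>\<close>, so \<open>q\<close> may be unbounded, as
  reciprocals of paths are. The tags are arbitrary because the chain rule below needs mean value
  points.\<close>

lemma riemann_stieltjes_sum_tendsto:
  fixes p q :: "real \<Rightarrow> real"
  assumes p: "continuous_on {0..t} p" and q: "q absolutely_integrable_on {0..t}" and t: "0 \<le> t"
    and tag: "\<And>N i. i < N \<Longrightarrow> \<xi> N i \<in> {t * real i / real N..t * real (Suc i) / real N}"
  shows "(\<lambda>s. p s * q s) absolutely_integrable_on {0..t}" (is ?A)
    and "(\<lambda>N. \<Sum>i<N. p (\<xi> N i) * integral {t * real i / real N..t * real (Suc i) / real N} q)
      \<longlonglongrightarrow> integral {0..t} (\<lambda>s. p s * q s)" (is ?B)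
proof -
  have "bounded (p ` {0..t})" using compact_continuous_image[OF p] compact_imp_bounded by auto
  moreover have "p \<in> borel_measurable (lebesgue_on {0..t})"
    by (rule continuous_imp_measurable_on_sets_lebesgue[OF p]) auto
  ultimately show A: ?A
    using absolutely_integrable_bounded_measurable_product_real[of p "{0..t}" q] q by auto
  have qi: "(\<lambda>s. \<bar>q s\<bar>) integrable_on {0..t}" "q integrable_on {0..t}"
    using q by (auto simp: absolutely_integrable_on_def)
  have pqi: "(\<lambda>s. p s * q s) integrable_on {0..t}" using A by (auto simp: absolutely_integrable_on_def)
  let ?Q = "integral {0..t} (\<lambda>s. \<bar>q s\<bar>)"
  have Q0: "0 \<le> ?Q" by (intro integral_nonneg qi) auto
  show ?B
  proof (rule LIMSEQ_I)
    fix r :: real assume r: "0 < r"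
    \<comment> \<open>The summand 1 covers the case \<open>?Q = 0\<close>.\<close>
    define e where "e = r / (?Q + 1)"
    have e: "0 < e" "e * ?Q < r" using r Q0 by (auto simp: e_def field_simps)
    have "uniformly_continuous_on {0..t} p" by (rule compact_uniformly_continuous[OF p]) auto
    then obtain d where d: "d > 0" "\<And>x y. x \<in> {0..t} \<Longrightarrow> y \<in> {0..t} \<Longrightarrow> dist y x < d \<Longrightarrow> dist (p y) (p x) < e"
      unfolding uniformly_continuous_on_def using e by meson
    obtain N0 :: nat where N0: "t / d < real N0" using reals_Archimedean2 by blast
    show "\<exists>no. \<forall>n\<ge>no. norm ((\<Sum>i<n. p (\<xi> n i) * integral {t * real i / real n..t * real (Suc i) / real n} q)
       - integral {0..t} (\<lambda>s. p s * q s)) < r"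
    proof (intro exI[of _ "Suc N0"] allI impI)
      fix N assume N: "Suc N0 \<le> N"
      have h: "t / real N < d"
      proof -
        have "t < d * real N0" using N0 d by (simp add: field_simps)
        also have "\<dots> \<le> d * real N" using d N by (intro mult_left_mono) auto
        finally show ?thesis using N by (simp add: field_simps)
      qed
      let ?I = "\<lambda>i. {t * real i / real N..t * real (Suc i) / real N}"
      have sub: "?I i \<subseteq> {0..t}" if "i < N" for i using uniform_partition_mem[OF that t] .
      have ii: "f integrable_on ?I i" if "i < N" "f integrable_on {0..t}" for i and f :: "real \<Rightarrow> real"
        using integrable_on_subinterval[OF that(2) sub[OF that(1)]] .
      have bd: "\<bar>p (\<xi> N i) * integral (?I i) q - integral (?I i) (\<lambda>s. p s * q s)\<bar> \<le> e * integral (?I i) (\<lambda>s. \<bar>q s\<bar>)"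
        if i: "i < N" for i
      proof -
        have "p (\<xi> N i) * integral (?I i) q - integral (?I i) (\<lambda>s. p s * q s)
            = integral (?I i) (\<lambda>s. (p (\<xi> N i) - p s) * q s)"
          using ii[OF i qi(2)] ii[OF i pqi]
          by (simp add: left_diff_distrib integral_diff integrable_on_mult_right)
        also have "norm \<dots> \<le> integral (?I i) (\<lambda>s. e * \<bar>q s\<bar>)"
        proof (rule integral_norm_bound_integral)
          show "(\<lambda>s. (p (\<xi> N i) - p s) * q s) integrable_on ?I i"
            using ii[OF i qi(2)] ii[OF i pqi] by (auto simp: left_diff_distrib intro!: integrable_diff integrable_on_mult_right)
          show "(\<lambda>s. e * \<bar>q s\<bar>) integrable_on ?I i" using ii[OF i qi(1)] by (intro integrable_on_mult_right)
          fix s assume s: "s \<in> ?I i"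
          have "dist (\<xi> N i) s < d"
          proof -
            have "\<bar>\<xi> N i - s\<bar> \<le> t * real (Suc i) / real N - t * real i / real N" using s tag[OF i] by auto
            also have "\<dots> = t / real N" by (simp add: diff_divide_distrib[symmetric] algebra_simps)
            finally show ?thesis using h by (simp add: dist_real_def)
          qed
          then have "dist (p (\<xi> N i)) (p s) < e" using d(2)[of s "\<xi> N i"] s tag[OF i] sub[OF i] by blast
          then show "norm ((p (\<xi> N i) - p s) * q s) \<le> e * \<bar>q s\<bar>"
            by (auto simp: dist_real_def abs_mult intro!: mult_right_mono)
        qed
        also have "\<dots> = e * integral (?I i) (\<lambda>s. \<bar>q s\<bar>)" by simp
        finally show ?thesis by simp
      qed
      have "\<bar>(\<Sum>i<N. p (\<xi> N i) * integral (?I i) q) - integral {0..t} (\<lambda>s. p s * q s)\<bar>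
         = \<bar>\<Sum>i<N. p (\<xi> N i) * integral (?I i) q - integral (?I i) (\<lambda>s. p s * q s)\<bar>"
        using integral_uniform_partition[OF pqi t, of N] N by (simp add: sum_subtractf)
      also have "\<dots> \<le> (\<Sum>i<N. e * integral (?I i) (\<lambda>s. \<bar>q s\<bar>))"
        by (rule order_trans[OF sum_abs sum_mono]) (use bd in auto)
      also have "\<dots> = e * ?Q"
        using integral_uniform_partition[OF qi(1) t, of N] N by (simp add: sum_distrib_left)
      finally show "norm ((\<Sum>i<N. p (\<xi> N i) * integral (?I i) q) - integral {0..t} (\<lambda>s. p s * q s)) < r"
        using e by simp
    qed
  qed
qed

text \<open>\<open>D\<close> is only absolutely continuous and need not be differentiable at a given
  time. On each cell the mean value theorem for \<open>f\<close>, combined with the intermediate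
  value theorem for \<open>D\<close>, yields a time \<open>x\<close> at which the increment of
  \<open>f (D s)\<close> is exactly \<open>f' (D x)\<close> times the integral of \<open>d\<close>.
  These exact identities telescope, and their sum is a Riemann-Stieltjes sum.\<close>

lemma integral_chain_rule:
  fixes d f f' :: "real \<Rightarrow> real"
  assumes d: "d absolutely_integrable_on {0..t}" and t: "0 \<le> t"
    and f: "\<And>x. (f has_real_derivative f' x) (at x)" and f': "continuous_on UNIV f'"
    and D: "\<And>s. s \<in> {0..t} \<Longrightarrow> D s = D 0 + integral {0..s} d"
  shows "(\<lambda>s. f' (D s) * d s) absolutely_integrable_on {0..t}"
    and "f (D t) - f (D 0) = integral {0..t} (\<lambda>s. f' (D s) * d s)"
proof -
  have di: "d integrable_on {0..t}" using d by (auto simp: absolutely_integrable_on_def)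
  have "continuous_on {0..t} (\<lambda>s. D 0 + integral {0..s} d)"
    using indefinite_integral_continuous_1[OF di] by (intro continuous_intros)
  then have Dc: "continuous_on {0..t} D" by (rule continuous_on_eq) (simp add: D[symmetric])
  have pc: "continuous_on {0..t} (\<lambda>s. f' (D s))"
    using continuous_on_compose2[OF f' Dc] by auto
  let ?l = "\<lambda>N i. t * real i / real N"
  have ex: "\<exists>x\<in>{?l N i..?l N (Suc i)}. f (D (?l N (Suc i))) - f (D (?l N i)) = f' (D x) * integral {?l N i..?l N (Suc i)} d"
    if i: "i < N" for N i
  proof -
    have sub: "{?l N i..?l N (Suc i)} \<subseteq> {0..t}" using uniform_partition_mem[OF i t] .
    have le: "?l N i \<le> ?l N (Suc i)" using t by (intro divide_right_mono mult_left_mono) auto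
    have inD: "?l N i \<in> {0..t}" "?l N (Suc i) \<in> {0..t}" using sub le by auto
    have diff: "D (?l N (Suc i)) - D (?l N i) = integral {?l N i..?l N (Suc i)} d"
    proof -
      have "d integrable_on {0..?l N (Suc i)}" using inD by (intro integrable_on_subinterval[OF di]) auto
      then show ?thesis
      using D[OF inD(1)] D[OF inD(2)] Henstock_Kurzweil_Integration.integral_combine[of 0 "?l N i" "?l N (Suc i)" d] le inD by simp
    qed
    \<comment> \<open>The increment of \<open>D\<close> over a cell may have either sign or vanish,
      hence the closed segment and three cases.\<close>
    have "\<exists>\<xi>. \<xi> \<in> closed_segment (D (?l N i)) (D (?l N (Suc i)))
        \<and> f (D (?l N (Suc i))) - f (D (?l N i)) = f' \<xi> * (D (?l N (Suc i)) - D (?l N i))"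
    proof (cases "D (?l N i)" "D (?l N (Suc i))" rule: linorder_cases)
      case less
      from MVT2[OF less, of f f'] f obtain z where "D (?l N i) < z" "z < D (?l N (Suc i))"
        "f (D (?l N (Suc i))) - f (D (?l N i)) = (D (?l N (Suc i)) - D (?l N i)) * f' z" by blast
      then show ?thesis using less by (intro exI[of _ z]) (auto simp: closed_segment_eq_real_ivl)
    next
      case equal then show ?thesis by auto
    next
      case greater
      from MVT2[OF greater, of f f'] f obtain z where "D (?l N (Suc i)) < z" "z < D (?l N i)"
        "f (D (?l N i)) - f (D (?l N (Suc i))) = (D (?l N i) - D (?l N (Suc i))) * f' z" by blast
      then show ?thesis using greater
        by (intro exI[of _ z]) (auto simp: closed_segment_eq_real_ivl algebra_simps)
    qed
    then obtain \<xi> where \<xi>: "\<xi> \<in> closed_segment (D (?l N i)) (D (?l N (Suc i)))"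
       "f (D (?l N (Suc i))) - f (D (?l N i)) = f' \<xi> * (D (?l N (Suc i)) - D (?l N i))" by blast
    have cI: "continuous_on {?l N i..?l N (Suc i)} D" using Dc sub continuous_on_subset by blast
    \<comment> \<open>A connected set of reals contains the segment between any two of its points,
      so the mean value point is a value of \<open>D\<close> on the cell.\<close>
    have "connected (D ` {?l N i..?l N (Suc i)})" using cI by (intro connected_continuous_image) auto
    then have "closed_segment (D (?l N i)) (D (?l N (Suc i))) \<subseteq> D ` {?l N i..?l N (Suc i)}"
      using le by (intro convex_contains_segment[THEN iffD1, rule_format]) (auto simp: is_interval_connected_1[symmetric] is_interval_convex_1)
    then obtain x where "x \<in> {?l N i..?l N (Suc i)}" "\<xi> = D x" using \<xi>(1) by blast
    then show ?thesis using \<xi>(2) diff by auto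
  qed
  define \<xi> where "\<xi> N i = (SOME x. x\<in>{?l N i..?l N (Suc i)} \<and> f (D (?l N (Suc i))) - f (D (?l N i)) = f' (D x) * integral {?l N i..?l N (Suc i)} d)" for N i
  have \<xi>: "\<xi> N i \<in> {?l N i..?l N (Suc i)}" "f (D (?l N (Suc i))) - f (D (?l N i)) = f' (D (\<xi> N i)) * integral {?l N i..?l N (Suc i)} d"
    if "i < N" for N i
    using someI_ex[OF ex[OF that, unfolded Bex_def]] unfolding \<xi>_def by blast+
  note rs = riemann_stieltjes_sum_tendsto[OF pc d t, of \<xi>, OF \<xi>(1)]
  show "(\<lambda>s. f' (D s) * d s) absolutely_integrable_on {0..t}" using rs(1) by simp
  have "(\<Sum>i<N. f' (D (\<xi> N i)) * integral {?l N i..?l N (Suc i)} d) = f (D t) - f (D 0)" if "N > 0" for N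
  proof -
    have "(\<Sum>i<N. f' (D (\<xi> N i)) * integral {?l N i..?l N (Suc i)} d) = (\<Sum>i<N. f (D (?l N (Suc i))) - f (D (?l N i)))"
      using \<xi>(2) by (intro sum.cong) auto
    also have "\<dots> = f (D (?l N N)) - f (D (?l N 0))"
      by (rule sum_lessThan_telescope)
    finally show ?thesis using that by simp
  qed
  then have "(\<lambda>N. (\<Sum>i<N. f' (D (\<xi> N i)) * integral {?l N i..?l N (Suc i)} d)) \<longlonglongrightarrow> f (D t) - f (D 0)"
    by (intro tendsto_eventually) (auto intro: eventually_sequentiallyI[of 1])
  then show "f (D t) - f (D 0) = integral {0..t} (\<lambda>s. f' (D s) * d s)"
    using rs(2) LIMSEQ_unique by blast
qed

text \<open>A Tanaka formula without local time, available because \<open>D\<close> has bounded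
  variation. The smoothings \<open>sqrt (x\<^sup>2 + e\<^sup>2)\<close> of the absolute value have
  derivatives that are bounded by 1 and tend to \<open>sgn x\<close>, also at 0, so
  \<open>\<bar>d\<bar>\<close> dominates.\<close>

lemma abs_integral_sgn:
  fixes d :: "real \<Rightarrow> real"
  assumes d: "d absolutely_integrable_on {0..t}" and t: "0 \<le> t"
    and D: "\<And>s. s \<in> {0..t} \<Longrightarrow> D s = integral {0..s} d"
  shows "(\<lambda>s. sgn (D s) * d s) integrable_on {0..t}"
    and "\<bar>D t\<bar> = integral {0..t} (\<lambda>s. sgn (D s) * d s)"
proof -
  define e where "e k = inverse (real (Suc k))" for k
  have e0: "e k > 0" for k by (simp add: e_def)
  have elim: "e \<longlonglongrightarrow> 0" unfolding e_def by (rule LIMSEQ_inverse_real_of_nat)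
  let ?f = "\<lambda>k x. sqrt (x\<^sup>2 + (e k)\<^sup>2)"
  let ?f' = "\<lambda>k x. x / sqrt (x\<^sup>2 + (e k)\<^sup>2)"
  have pos: "0 < x\<^sup>2 + (e k)\<^sup>2" for x k using e0[of k] by (simp add: add_nonneg_pos)
  have der: "(?f k has_real_derivative ?f' k x) (at x)" for k x
    using pos[of x k] by (auto intro!: derivative_eq_intros simp: field_simps)
  have cont: "continuous_on UNIV (?f' k)" for k
    using pos[of _ k] by (intro continuous_intros) (auto simp: add_nonneg_eq_0_iff less_imp_neq[symmetric])
  have D0: "D 0 = 0" using D[of 0] t by simp
  have chain: "(\<lambda>s. ?f' k (D s) * d s) absolutely_integrable_on {0..t}"
     "?f k (D t) - ?f k (D 0) = integral {0..t} (\<lambda>s. ?f' k (D s) * d s)" for k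
    using integral_chain_rule[OF d t der cont, of D k] D D0 by auto
  have lim: "(\<lambda>k. ?f' k x) \<longlonglongrightarrow> sgn x" for x :: real
  proof (cases "x = 0")
    case False
    have "(\<lambda>k. ?f' k x) \<longlonglongrightarrow> x / sqrt (x\<^sup>2 + 0\<^sup>2)"
      by (intro tendsto_intros elim) (use False in auto)
    then show ?thesis by (simp add: real_sgn_eq)
  qed simp
  have lim2: "(\<lambda>k. ?f k (D t) - ?f k (D 0)) \<longlonglongrightarrow> sqrt ((D t)\<^sup>2 + 0\<^sup>2) - sqrt ((D 0)\<^sup>2 + 0\<^sup>2)"
    by (intro tendsto_intros elim)
  have bnd: "\<bar>?f' k x\<bar> \<le> 1" for k x
  proof -
    have "\<bar>x\<bar> \<le> ?f k x" by (metis abs_ge_zero power2_abs real_sqrt_sum_squares_ge1 abs_le_square_iff real_le_rsqrt le_add_same_cancel1 zero_le_power2)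
    then show ?thesis using pos[of x k] by (simp add: divide_le_eq abs_divide)
  qed
  have "(\<lambda>s. sgn (D s) * d s) integrable_on {0..t} \<and>
      (\<lambda>k. integral {0..t} (\<lambda>s. ?f' k (D s) * d s)) \<longlonglongrightarrow> integral {0..t} (\<lambda>s. sgn (D s) * d s)"
  proof (intro conjI)
    have 1: "(\<lambda>s. ?f' k (D s) * d s) integrable_on {0..t}" for k
      using chain(1) by (auto simp: absolutely_integrable_on_def)
    have 2: "(\<lambda>s. \<bar>d s\<bar>) integrable_on {0..t}" using d by (auto simp: absolutely_integrable_on_def)
    have 3: "norm (?f' k (D s) * d s) \<le> \<bar>d s\<bar>" for k s
      using mult_right_mono[OF bnd[of "D s" k], of "\<bar>d s\<bar>"] by (simp only: real_norm_def abs_mult mult_1 abs_ge_zero)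
    have 4: "(\<lambda>k. ?f' k (D s) * d s) \<longlonglongrightarrow> sgn (D s) * d s" for s by (intro tendsto_intros lim)
    show "(\<lambda>s. sgn (D s) * d s) integrable_on {0..t}" 
      by (rule dominated_convergence(1)[OF 1 2 3 4])
    show "(\<lambda>k. integral {0..t} (\<lambda>s. ?f' k (D s) * d s)) \<longlonglongrightarrow> integral {0..t} (\<lambda>s. sgn (D s) * d s)" 
      by (rule dominated_convergence(2)[OF 1 2 3 4])
  qed
  then show "(\<lambda>s. sgn (D s) * d s) integrable_on {0..t}"
    and "\<bar>D t\<bar> = integral {0..t} (\<lambda>s. sgn (D s) * d s)"
    using lim2 D0 unfolding chain(2) by (auto dest: LIMSEQ_unique)
qed

section \<open>Pathwise solutions and their uniqueness\<close>

text \<open>The common engine of uniqueness and of stability. The exceptional set is meant for zeros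
  of the paths: there the convention \<open>1 / 0 = 0\<close> destroys the monotonicity of the
  reciprocal.\<close>

lemma abs_integral_le_of_sgn_le:
  fixes d h :: "real \<Rightarrow> real"
  assumes d: "d absolutely_integrable_on {0..t}" and t: "0 \<le> t"
    and D: "\<And>s. s \<in> {0..t} \<Longrightarrow> D s = integral {0..s} d"
    and S: "negligible S" and h: "h integrable_on {0..t}"
    and le: "\<And>s. s \<in> {0..t} \<Longrightarrow> s \<notin> S \<Longrightarrow> sgn (D s) * d s \<le> h s"
  shows "\<bar>D t\<bar> \<le> integral {0..t} h"
proof -
  note A = abs_integral_sgn[OF d t D]
  let ?h = "\<lambda>s. if s \<in> S then sgn (D s) * d s else h s"
  have "\<bar>D t\<bar> = integral {0..t} (\<lambda>s. sgn (D s) * d s)" by (rule A(2))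
  also have "\<dots> \<le> integral {0..t} ?h"
    by (rule integral_le[OF A(1) integrable_spike[OF h S]]) (use le in auto)
  also have "\<dots> = integral {0..t} h" by (rule integral_spike[OF S]) auto
  finally show ?thesis .
qed

text \<open>The content of \<open>O2BP\<close> at one sample point, with gauge integrals in place of
  Lebesgue integrals; \<open>b\<close> and \<open>c\<close> are the noise paths. Comparison
  arguments can then be made without probability.\<close>

definition path_solution :: "real \<Rightarrow> real \<Rightarrow> real \<Rightarrow> real \<Rightarrow> (real \<Rightarrow> real) \<Rightarrow> (real \<Rightarrow> real) \<Rightarrow>
    (real \<Rightarrow> real) \<Rightarrow> (real \<Rightarrow> real) \<Rightarrow> bool" where
  "path_solution \<alpha> \<beta> \<gamma> \<delta> b c x y \<longleftrightarrow>
     continuous_on {0..} x \<and> continuous_on {0..} y \<and>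
     (\<forall>t\<ge>0. x t \<ge> 0 \<and> y t \<ge> 0 \<and>
        negligible {s\<in>{0..t}. x s = 0} \<and> negligible {s\<in>{0..t}. y s = 0} \<and>
        (\<lambda>s. 1 / x s) integrable_on {0..t} \<and> (\<lambda>s. 1 / y s) integrable_on {0..t} \<and>
        x t = x 0 + b t + \<alpha> * integral {0..t} (\<lambda>s. 1 / x s) + \<beta> * integral {0..t} (\<lambda>s. 1 / y s) \<and>
        y t = y 0 + c t + \<gamma> * integral {0..t} (\<lambda>s. 1 / x s) + \<delta> * integral {0..t} (\<lambda>s. 1 / y s))"

text \<open>For nonnegative functions gauge integrability is the same as absolute integrability, and
  continuity of \<open>x\<close> supplies the Borel measurability needed to descend from the
  completed measure to \<open>lborel\<close>.\<close>

lemma inverse_path_integrals: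
  fixes x :: "real \<Rightarrow> real"
  assumes c: "continuous_on {0..} x" and x: "\<And>s. 0 \<le> s \<Longrightarrow> 0 \<le> x s"
  shows "emeasure lborel {s\<in>{0..t}. x s = 0} = 0 \<longleftrightarrow> negligible {s\<in>{0..t}. x s = 0}"
    and "set_nn_integral lborel {0..t} (\<lambda>s. ennreal (1 / x s)) < \<infinity> \<longleftrightarrow> (\<lambda>s. 1 / x s) integrable_on {0..t}"
    and "(\<lambda>s. 1 / x s) integrable_on {0..t} \<Longrightarrow> (\<integral>s\<in>{0..t}. 1 / x s \<partial>lborel) = integral {0..t} (\<lambda>s. 1 / x s)"
proof -
  have c': "continuous_on {0..t} x" by (rule continuous_on_subset[OF c]) auto
  have m: "(\<lambda>s. indicator {0..t} s *\<^sub>R x s) \<in> borel_measurable borel"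
    by (rule borel_measurable_continuous_on_indicator[OF _ c']) auto
  have "closed {s\<in>{0..t}. x s = 0}"
    using continuous_closed_preimage_constant[OF c' closed_atLeastAtMost, of 0] by simp
  then have "{s\<in>{0..t}. x s = 0} \<in> sets borel" by (rule borel_closed)
  then show "emeasure lborel {s\<in>{0..t}. x s = 0} = 0 \<longleftrightarrow> negligible {s\<in>{0..t}. x s = 0}"
    by (simp add: negligible_iff_emeasure0)
  have m2: "(\<lambda>s. indicator {0..t} s *\<^sub>R (1 / x s)) \<in> borel_measurable borel"
  proof -
    have "(\<lambda>s. 1 / (indicator {0..t} s *\<^sub>R x s)) \<in> borel_measurable borel" using m by measurable
    also have "(\<lambda>s. 1 / (indicator {0..t} s *\<^sub>R x s)) = (\<lambda>s. indicator {0..t} s *\<^sub>R (1 / x s))"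
      by (auto simp: indicator_def)
    finally show ?thesis .
  qed
  have nn: "0 \<le> indicator {0..t} s *\<^sub>R (1 / x s)" for s
    using x[of s] by (auto simp: indicator_def)
  have set: "set_integrable lborel {0..t} (\<lambda>s. 1 / x s) \<longleftrightarrow> (\<lambda>s. 1 / x s) integrable_on {0..t}"
  proof
    assume "set_integrable lborel {0..t} (\<lambda>s. 1 / x s)"
    then show "(\<lambda>s. 1 / x s) integrable_on {0..t}" by (rule set_borel_integral_eq_integral(1))
  next
    assume "(\<lambda>s. 1 / x s) integrable_on {0..t}"
    then have "(\<lambda>s. 1 / x s) absolutely_integrable_on {0..t}"
      by (intro nonnegative_absolutely_integrable_1) (use x in auto)
    then show "set_integrable lborel {0..t} (\<lambda>s. 1 / x s)"
      unfolding set_integrable_def using m2 by (simp add: integrable_completion)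
  qed
  have eq: "set_nn_integral lborel {0..t} (\<lambda>s. ennreal (1 / x s)) = (\<integral>\<^sup>+s. ennreal (indicator {0..t} s *\<^sub>R (1 / x s)) \<partial>lborel)"
    by (intro nn_integral_cong) (auto simp: indicator_def)
  have "set_integrable lborel {0..t} (\<lambda>s. 1 / x s) \<longleftrightarrow> set_nn_integral lborel {0..t} (\<lambda>s. ennreal (1 / x s)) < \<infinity>"
    unfolding set_integrable_def eq integrable_iff_bounded real_norm_def abs_of_nonneg[OF nn] using m2 by simp
  then show "set_nn_integral lborel {0..t} (\<lambda>s. ennreal (1 / x s)) < \<infinity> \<longleftrightarrow> (\<lambda>s. 1 / x s) integrable_on {0..t}"
    using set by simp
  assume "(\<lambda>s. 1 / x s) integrable_on {0..t}"
  then show "(\<integral>s\<in>{0..t}. 1 / x s \<partial>lborel) = integral {0..t} (\<lambda>s. 1 / x s)"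
    using set by (intro set_borel_integral_eq_integral(2)) simp
qed

lemma O2BP_iff_path_solution:
  "O2BP M F \<alpha> \<beta> \<gamma> \<delta> B C X Y \<longleftrightarrow>
     (\<forall>t\<ge>0. X t \<in> borel_measurable (F t) \<and> Y t \<in> borel_measurable (F t)) \<and>
     (AE \<omega> in M. path_solution \<alpha> \<beta> \<gamma> \<delta> (\<lambda>t. B t \<omega>) (\<lambda>t. C t \<omega>) (\<lambda>t. X t \<omega>) (\<lambda>t. Y t \<omega>))"
proof -
  have "path_solution \<alpha> \<beta> \<gamma> \<delta> b c x y \<longleftrightarrow>
        continuous_on {0..} x \<and> continuous_on {0..} y \<and>
        (\<forall>t\<ge>0.
          x t \<ge> 0 \<and> y t \<ge> 0 \<and>
          emeasure lborel {s\<in>{0..t}. x s = 0} = 0 \<and>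
          emeasure lborel {s\<in>{0..t}. y s = 0} = 0 \<and>
          set_nn_integral lborel {0..t} (\<lambda>s. ennreal (1 / x s)) < \<infinity> \<and>
          set_nn_integral lborel {0..t} (\<lambda>s. ennreal (1 / y s)) < \<infinity> \<and>
          x t = x 0 + b t + \<alpha> * (\<integral>s\<in>{0..t}. 1 / x s \<partial>lborel)
                              + \<beta> * (\<integral>s\<in>{0..t}. 1 / y s \<partial>lborel) \<and>
          y t = y 0 + c t + \<gamma> * (\<integral>s\<in>{0..t}. 1 / x s \<partial>lborel)
                              + \<delta> * (\<integral>s\<in>{0..t}. 1 / y s \<partial>lborel))" (is "?L \<longleftrightarrow> ?R")
    for b c x y :: "real \<Rightarrow> real"
  \<comment> \<open>Each side forces continuity and nonnegativity. Under these the integrals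
    translate one by one; otherwise both sides are false.\<close>
  proof (cases "continuous_on {0..} x \<and> continuous_on {0..} y \<and> (\<forall>s\<ge>0. 0 \<le> x s \<and> 0 \<le> y s)")
    case True
    note X = inverse_path_integrals[of x] and Y = inverse_path_integrals[of y]
    show ?thesis unfolding path_solution_def
      using True X Y by (intro conj_cong refl all_cong) auto
  qed (auto simp: path_solution_def)
  then show ?thesis unfolding O2BP_def by presburger
qed

lemma path_solutionD:
  assumes "path_solution \<alpha> \<beta> \<gamma> \<delta> b c x y"
  shows "continuous_on {0..} x" "continuous_on {0..} y"
    and "\<And>t. 0 \<le> t \<Longrightarrow> 0 \<le> x t" "\<And>t. 0 \<le> t \<Longrightarrow> 0 \<le> y t"
    and "\<And>t. 0 \<le> t \<Longrightarrow> negligible {s\<in>{0..t}. x s = 0}" "\<And>t. 0 \<le> t \<Longrightarrow> negligible {s\<in>{0..t}. y s = 0}"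
    and "\<And>t. 0 \<le> t \<Longrightarrow> (\<lambda>s. 1 / x s) integrable_on {0..t}" "\<And>t. 0 \<le> t \<Longrightarrow> (\<lambda>s. 1 / y s) integrable_on {0..t}"
    and "\<And>t. 0 \<le> t \<Longrightarrow> x t = x 0 + b t + \<alpha> * integral {0..t} (\<lambda>s. 1 / x s) + \<beta> * integral {0..t} (\<lambda>s. 1 / y s)"
    and "\<And>t. 0 \<le> t \<Longrightarrow> y t = y 0 + c t + \<gamma> * integral {0..t} (\<lambda>s. 1 / x s) + \<delta> * integral {0..t} (\<lambda>s. 1 / y s)"
  using assms unfolding path_solution_def by blast+

text \<open>For cross terms: the sign of one component's difference tells nothing about the
  difference \<open>z\<close> of the other component's reciprocals, so the worst case is
  taken.\<close>

lemma sgn_cross: "u \<le> 0 \<Longrightarrow> sgn r * (u * z) \<le> - u * \<bar>z\<bar>" for r u z :: real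
proof -
  assume "u \<le> 0"
  have "sgn r * (u * z) = (- u) * (- (sgn r * z))" by simp
  also have "\<dots> \<le> (- u) * \<bar>z\<bar>" using \<open>u \<le> 0\<close> by (intro mult_left_mono) (auto simp: sgn_if)
  finally show ?thesis by simp
qed

text \<open>The weights enter through weak inequalities only, so that a vanishing determinant, as in
  the degenerate case, is covered as well.\<close>

lemma path_solution_unique:
  assumes sol: "path_solution \<alpha> \<beta> \<gamma> \<delta> b c x y" "path_solution \<alpha> \<beta> \<gamma> \<delta> b c x' y'"
    and init: "x 0 = x' 0" "y 0 = y' 0"
    and sgns: "0 < \<alpha>" "0 < \<delta>" "\<beta> \<le> 0" "\<gamma> \<le> 0"
    and v: "0 < v1" "0 < v2" "0 \<le> v1 * \<alpha> + v2 * \<gamma>" "0 \<le> v2 * \<delta> + v1 * \<beta>"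
    and t: "0 \<le> t"
  shows "x t = x' t \<and> y t = y' t"
proof -
  note S = path_solutionD[OF sol(1)] and S' = path_solutionD[OF sol(2)]
  have ai: "(\<lambda>s. 1 / x s) absolutely_integrable_on {0..t}" "(\<lambda>s. 1 / y s) absolutely_integrable_on {0..t}"
     "(\<lambda>s. 1 / x' s) absolutely_integrable_on {0..t}" "(\<lambda>s. 1 / y' s) absolutely_integrable_on {0..t}"
    using S(3,4,7,8) S'(3,4,7,8) t by (intro nonnegative_absolutely_integrable_1; simp)+
  define p where "p s = 1 / x s - 1 / x' s" for s
  define q where "q s = 1 / y s - 1 / y' s" for s
  have pq: "p absolutely_integrable_on {0..t}" "q absolutely_integrable_on {0..t}"
    unfolding p_def q_def using ai by (auto intro: set_integral_diff)
  then have pqi: "p integrable_on {0..t}" "q integrable_on {0..t}" "(\<lambda>s. \<bar>p s\<bar>) integrable_on {0..t}" "(\<lambda>s. \<bar>q s\<bar>) integrable_on {0..t}"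
    by (auto simp: absolutely_integrable_on_def)
  have sub: "p integrable_on {0..s}" "q integrable_on {0..s}" if "s \<in> {0..t}" for s
    using that integrable_on_subinterval[OF pqi(1), of 0 s] integrable_on_subinterval[OF pqi(2), of 0 s] by auto
  have D1: "x s - x' s = integral {0..s} (\<lambda>s. \<alpha> * p s + \<beta> * q s)"
    and D2: "y s - y' s = integral {0..s} (\<lambda>s. \<gamma> * p s + \<delta> * q s)" if s: "s \<in> {0..t}" for s
  proof -
    have P: "integral {0..s} p = integral {0..s} (\<lambda>s. 1 / x s) - integral {0..s} (\<lambda>s. 1 / x' s)"
      "integral {0..s} q = integral {0..s} (\<lambda>s. 1 / y s) - integral {0..s} (\<lambda>s. 1 / y' s)"
      unfolding p_def q_def using S(7,8) S'(7,8) s by (intro integral_diff; simp)+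
    have L: "integral {0..s} (\<lambda>s. a * p s + b * q s) = a * integral {0..s} p + b * integral {0..s} q" for a b
      using sub[OF s] by (simp add: integral_add integrable_on_mult_right)
    have "x s = x 0 + b s + \<alpha> * integral {0..s} (\<lambda>s. 1 / x s) + \<beta> * integral {0..s} (\<lambda>s. 1 / y s)"
         "x' s = x' 0 + b s + \<alpha> * integral {0..s} (\<lambda>s. 1 / x' s) + \<beta> * integral {0..s} (\<lambda>s. 1 / y' s)"
         "y s = y 0 + c s + \<gamma> * integral {0..s} (\<lambda>s. 1 / x s) + \<delta> * integral {0..s} (\<lambda>s. 1 / y s)"
         "y' s = y' 0 + c s + \<gamma> * integral {0..s} (\<lambda>s. 1 / x' s) + \<delta> * integral {0..s} (\<lambda>s. 1 / y' s)"
      using S(9,10)[of s] S'(9,10)[of s] s by auto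
    then show "x s - x' s = integral {0..s} (\<lambda>s. \<alpha> * p s + \<beta> * q s)"
      "y s - y' s = integral {0..s} (\<lambda>s. \<gamma> * p s + \<delta> * q s)"
      unfolding L P using init by (simp_all add: algebra_simps)
  qed
  \<comment> \<open>Collects the times at which some reciprocal takes the conventional value 0; off
    \<open>Z\<close> all four paths are positive and the reciprocal is decreasing.\<close>
  define Z where "Z = {s\<in>{0..t}. x s = 0} \<union> {s\<in>{0..t}. y s = 0} \<union> {s\<in>{0..t}. x' s = 0} \<union> {s\<in>{0..t}. y' s = 0}"
  have Z: "negligible Z" unfolding Z_def by (intro negligible_Un S(5,6) S'(5,6) t)
  have inv: "sgn (u - w) * (1 / u - 1 / w) = - \<bar>1 / u - 1 / w\<bar>" if "0 < u" "0 < w" for u w :: real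
    using that by (auto simp: sgn_if abs_if field_simps)
  have spos: "0 < x s" "0 < y s" "0 < x' s" "0 < y' s" if "s \<in> {0..t}" "s \<notin> Z" for s
    using S(3,4)[of s] S'(3,4)[of s] that by (auto simp: Z_def order_less_le)
  have e1: "\<bar>x t - x' t\<bar> \<le> integral {0..t} (\<lambda>s. - \<alpha> * \<bar>p s\<bar> - \<beta> * \<bar>q s\<bar>)"
  proof (rule abs_integral_le_of_sgn_le[where D = "\<lambda>s. x s - x' s", OF _ t D1 Z])
    show "(\<lambda>s. \<alpha> * p s + \<beta> * q s) absolutely_integrable_on {0..t}"
      using pq by (intro set_integral_add set_integrable_mult_right) auto
    show "(\<lambda>s. - \<alpha> * \<bar>p s\<bar> - \<beta> * \<bar>q s\<bar>) integrable_on {0..t}"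
      using pqi by (intro integrable_diff integrable_on_mult_right)
    fix s assume s: "s \<in> {0..t}" "s \<notin> Z"
    have "sgn (x s - x' s) * p s = - \<bar>p s\<bar>" unfolding p_def using inv spos[OF s] by blast
    moreover have "sgn (x s - x' s) * (\<beta> * q s) \<le> - \<beta> * \<bar>q s\<bar>" using sgns by (intro sgn_cross)
    ultimately show "sgn (x s - x' s) * (\<alpha> * p s + \<beta> * q s) \<le> - \<alpha> * \<bar>p s\<bar> - \<beta> * \<bar>q s\<bar>"
      by (simp add: algebra_simps)
  qed
  have e2: "\<bar>y t - y' t\<bar> \<le> integral {0..t} (\<lambda>s. - \<gamma> * \<bar>p s\<bar> - \<delta> * \<bar>q s\<bar>)"
  proof (rule abs_integral_le_of_sgn_le[where D = "\<lambda>s. y s - y' s", OF _ t D2 Z])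
    show "(\<lambda>s. \<gamma> * p s + \<delta> * q s) absolutely_integrable_on {0..t}"
      using pq by (intro set_integral_add set_integrable_mult_right) auto
    show "(\<lambda>s. - \<gamma> * \<bar>p s\<bar> - \<delta> * \<bar>q s\<bar>) integrable_on {0..t}"
      using pqi by (intro integrable_diff integrable_on_mult_right)
    fix s assume s: "s \<in> {0..t}" "s \<notin> Z"
    have "sgn (y s - y' s) * q s = - \<bar>q s\<bar>" unfolding q_def using inv spos[OF s] by blast
    moreover have "sgn (y s - y' s) * (\<gamma> * p s) \<le> - \<gamma> * \<bar>p s\<bar>" using sgns by (intro sgn_cross)
    ultimately show "sgn (y s - y' s) * (\<gamma> * p s + \<delta> * q s) \<le> - \<gamma> * \<bar>p s\<bar> - \<delta> * \<bar>q s\<bar>"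
      by (simp add: algebra_simps)
  qed
  let ?P = "integral {0..t} (\<lambda>s. \<bar>p s\<bar>)" and ?Q = "integral {0..t} (\<lambda>s. \<bar>q s\<bar>)"
  have P0: "0 \<le> ?P" "0 \<le> ?Q" using pqi by (auto intro!: integral_nonneg)
  have L: "integral {0..t} (\<lambda>s. a * \<bar>p s\<bar> - b * \<bar>q s\<bar>) = a * ?P - b * ?Q" for a b
    using pqi by (simp add: integral_diff integrable_on_mult_right)
  have "v1 * \<bar>x t - x' t\<bar> + v2 * \<bar>y t - y' t\<bar> \<le> v1 * (- \<alpha> * ?P - \<beta> * ?Q) + v2 * (- \<gamma> * ?P - \<delta> * ?Q)"
    using e1 e2 v unfolding L by (intro add_mono mult_left_mono) auto
  also have "\<dots> = - (v1 * \<alpha> + v2 * \<gamma>) * ?P - (v2 * \<delta> + v1 * \<beta>) * ?Q" by (simp add: algebra_simps)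
  also have "\<dots> \<le> 0"
    using mult_nonneg_nonneg[OF v(3) P0(1)] mult_nonneg_nonneg[OF v(4) P0(2)] by linarith
  finally have le0: "v1 * \<bar>x t - x' t\<bar> + v2 * \<bar>y t - y' t\<bar> \<le> 0" .
  moreover have "0 \<le> v1 * \<bar>x t - x' t\<bar>" "0 \<le> v2 * \<bar>y t - y' t\<bar>" using v by auto
  ultimately have "v1 * \<bar>x t - x' t\<bar> = 0" "v2 * \<bar>y t - y' t\<bar> = 0" by linarith+
  then show ?thesis using v by simp
qed

section \<open>Picard iteration\<close>

lemma continuous_on_atLeastI:
  fixes f :: "real \<Rightarrow> 'b::topological_space"
  assumes "\<And>T. 0 \<le> T \<Longrightarrow> continuous_on {0..T} f"
  shows "continuous_on {0..} f"
  unfolding continuous_on_eq_continuous_within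
proof
  fix t :: real assume "t \<in> {0..}"
  then have "continuous (at t within {0..t + 1}) f"
    using assms[of "t + 1"] by (auto simp: continuous_on_eq_continuous_within)
  moreover have "at t within {0..} = at t within {0..t + 1}"
    by (rule at_within_nhd[of _ "{..<t + 1}"]) auto
  ultimately show "continuous (at t within {0..}) f" by simp
qed

lemma continuous_on_indefinite_integral:
  fixes h :: "real \<Rightarrow> real"
  assumes "continuous_on {0..} h"
  shows "continuous_on {0..} (\<lambda>t. integral {0..t} h)"
proof (rule continuous_on_atLeastI)
  fix T :: real
  have "h integrable_on {0..T}"
    by (rule integrable_continuous_interval[OF continuous_on_subset[OF assms]]) auto
  then show "continuous_on {0..T} (\<lambda>t. integral {0..t} h)" by (rule indefinite_integral_continuous_1)
qed

text \<open>The M-test on each bounded interval, with a majorant that may depend on the interval.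
  The limit is named by \<open>lim\<close> and not by an existential, so it is one explicit function
  for all horizons.\<close>

lemma locally_uniform_limit:
  fixes X :: "nat \<Rightarrow> real \<Rightarrow> real"
  assumes X: "\<And>k. continuous_on {0..} (X k)"
    and s: "\<And>T. 0 \<le> T \<Longrightarrow> \<exists>s. summable s \<and> (\<forall>k. \<forall>t\<in>{0..T}. \<bar>X (Suc k) t - X k t\<bar> \<le> s k)"
  shows "continuous_on {0..} (\<lambda>t. lim (\<lambda>k. X k t))"
    and "\<And>t. 0 \<le> t \<Longrightarrow> (\<lambda>k. X k t) \<longlonglongrightarrow> lim (\<lambda>k. X k t)"
proof -
  have ul: "uniform_limit {0..T} (\<lambda>k t. X k t) (\<lambda>t. lim (\<lambda>k. X k t)) sequentially" if T: "0 \<le> T" for T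
  proof -
    obtain s where s: "summable s" "\<And>k t. t \<in> {0..T} \<Longrightarrow> \<bar>X (Suc k) t - X k t\<bar> \<le> s k"
      using s[OF T] by blast
    have "uniform_limit {0..T} (\<lambda>n t. \<Sum>i<n. X (Suc i) t - X i t) (\<lambda>t. \<Sum>i. X (Suc i) t - X i t) sequentially"
      using s by (intro Weierstrass_m_test) auto
    then have "uniform_limit {0..T} (\<lambda>n t. X n t - X 0 t) (\<lambda>t. \<Sum>i. X (Suc i) t - X i t) sequentially"
      by (simp only: sum_lessThan_telescope[of "\<lambda>i. X i _"])
    from uniform_limit_add[OF this uniform_limit_const[of "X 0"]]
    have u: "uniform_limit {0..T} (\<lambda>n t. X n t) (\<lambda>t. (\<Sum>i. X (Suc i) t - X i t) + X 0 t) sequentially"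
      by simp
    have "(\<Sum>i. X (Suc i) t - X i t) + X 0 t = lim (\<lambda>k. X k t)" if "t \<in> {0..T}" for t
      using tendsto_uniform_limitI[OF u that] limI by metis
    then show ?thesis by (intro uniform_limit_cong'[THEN iffD1, OF _ _ u]) auto
  qed
  show "continuous_on {0..} (\<lambda>t. lim (\<lambda>k. X k t))"
  proof (rule continuous_on_atLeastI)
    fix T :: real assume "0 \<le> T"
    show "continuous_on {0..T} (\<lambda>t. lim (\<lambda>k. X k t))"
      by (rule uniform_limit_theorem[OF _ ul[OF \<open>0 \<le> T\<close>]])
         (auto intro!: always_eventually continuous_on_subset[OF X])
  qed
  show "(\<lambda>k. X k t) \<longlonglongrightarrow> lim (\<lambda>k. X k t)" if "0 \<le> t" for t
    using tendsto_uniform_limitI[OF ul[OF that], of t] that by auto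
qed

text \<open>An explicit iteration instead of an abstract fixed point, because measurability in the
  sample point can be passed through each step.\<close>

primrec picard :: "(real \<Rightarrow> real \<Rightarrow> real) \<Rightarrow> (real \<Rightarrow> real \<Rightarrow> real) \<Rightarrow> (real \<Rightarrow> real) \<Rightarrow> (real \<Rightarrow> real) \<Rightarrow>
    nat \<Rightarrow> real \<Rightarrow> real \<times> real" where
  "picard F1 F2 f g 0 = (\<lambda>t. (f t, g t))"
| "picard F1 F2 f g (Suc k) = (\<lambda>t.
     (f t + integral {0..t} (\<lambda>s. F1 (fst (picard F1 F2 f g k s)) (snd (picard F1 F2 f g k s))),
      g t + integral {0..t} (\<lambda>s. F2 (fst (picard F1 F2 f g k s)) (snd (picard F1 F2 f g k s)))))"

text \<open>Besides the Lipschitz constant a global bound \<open>K\<close> is kept: it controls the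
  step from iterate 0 to iterate 1, and it dominates the integrands in the passage to the
  limit.\<close>

locale lipschitz_drift =
  fixes F1 F2 :: "real \<Rightarrow> real \<Rightarrow> real" and L K :: real
  assumes L: "0 < L"
    and lip1: "\<And>x y x' y'. \<bar>F1 x y - F1 x' y'\<bar> \<le> L * (\<bar>x - x'\<bar> + \<bar>y - y'\<bar>)"
    and lip2: "\<And>x y x' y'. \<bar>F2 x y - F2 x' y'\<bar> \<le> L * (\<bar>x - x'\<bar> + \<bar>y - y'\<bar>)"
    and bnd1: "\<And>x y. \<bar>F1 x y\<bar> \<le> K"
    and bnd2: "\<And>x y. \<bar>F2 x y\<bar> \<le> K"
begin

lemma tendsto_F:
  fixes u w :: "'b \<Rightarrow> real"
  assumes "(u \<longlongrightarrow> x) A" "(w \<longlongrightarrow> y) A"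
  shows "((\<lambda>s. F1 (u s) (w s)) \<longlongrightarrow> F1 x y) A" "((\<lambda>s. F2 (u s) (w s)) \<longlongrightarrow> F2 x y) A"
proof -
  have z: "((\<lambda>s. L * (\<bar>u s - x\<bar> + \<bar>w s - y\<bar>)) \<longlongrightarrow> 0) A"
    by (rule tendsto_eq_intros assms refl)+ simp
  show "((\<lambda>s. F1 (u s) (w s)) \<longlongrightarrow> F1 x y) A"
    by (rule LIM_zero_cancel, rule Lim_null_comparison[OF _ z]) (auto intro!: always_eventually lip1)
  show "((\<lambda>s. F2 (u s) (w s)) \<longlongrightarrow> F2 x y) A"
    by (rule LIM_zero_cancel, rule Lim_null_comparison[OF _ z]) (auto intro!: always_eventually lip2)
qed

lemma continuous_on_F:
  assumes "continuous_on S u" "continuous_on S w"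
  shows "continuous_on S (\<lambda>s. F1 (u s) (w s))" "continuous_on S (\<lambda>s. F2 (u s) (w s))"
  using assms tendsto_F unfolding continuous_on_def by blast+

abbreviation "px f g k t \<equiv> fst (picard F1 F2 f g k t)"
abbreviation "py f g k t \<equiv> snd (picard F1 F2 f g k t)"

lemma picard_continuous:
  assumes "continuous_on {0..} f" "continuous_on {0..} g"
  shows "continuous_on {0..} (px f g k) \<and> continuous_on {0..} (py f g k)"
proof (induction k)
  case (Suc k)
  then show ?case
    using assms by (auto intro!: continuous_intros continuous_on_indefinite_integral continuous_on_F)
qed (use assms in auto)

text \<open>Contraction in an exponentially weighted norm: integrating
  \<open>L * exp (4 * L * s)\<close> produces a factor 1/4, and the two components together give the
  ratio 1/2, with no restriction on the time horizon.\<close>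

lemma picard_diff:
  assumes fg: "continuous_on {0..} f" "continuous_on {0..} g" and t: "0 \<le> t"
  shows "\<bar>px f g (Suc k) t - px f g k t\<bar> + \<bar>py f g (Suc k) t - py f g k t\<bar>
     \<le> K / (2 * L) * (1/2) ^ k * exp (4 * L * t)"
  using t
proof (induction k arbitrary: t)
  case 0
  have K: "0 \<le> K" using bnd1[of 0 0] by linarith
  have c: "continuous_on {0..t} f" "continuous_on {0..t} g" using fg by (auto intro: continuous_on_subset)
  have int: "(\<lambda>s. F1 (f s) (g s)) integrable_on {0..t}" "(\<lambda>s. F2 (f s) (g s)) integrable_on {0..t}"
    using continuous_on_F[OF c] by (auto intro: integrable_continuous_interval)
  have "\<bar>integral {0..t} (\<lambda>s. F1 (f s) (g s))\<bar> \<le> integral {0..t} (\<lambda>s. K)"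
    using integral_norm_bound_integral[OF int(1) integrable_const_ivl[of K]] bnd1 by auto
  moreover have "\<bar>integral {0..t} (\<lambda>s. F2 (f s) (g s))\<bar> \<le> integral {0..t} (\<lambda>s. K)"
    using integral_norm_bound_integral[OF int(2) integrable_const_ivl[of K]] bnd2 by auto
  moreover have "integral {0..t} (\<lambda>s. K) = K * t" using 0 by simp
  \<comment> \<open>The constant \<open>K / (2 * L)\<close> is chosen so that this is
    \<open>z \<le> exp z\<close> at \<open>z = 4 * L * t\<close>.\<close>
  moreover have "K * t + K * t \<le> K / (2 * L) * exp (4 * L * t)"
  proof -
    have "4 * L * t \<le> exp (4 * L * t)" using exp_ge_add_one_self[of "4 * L * t"] by linarith
    then have "K / (2 * L) * (4 * L * t) \<le> K / (2 * L) * exp (4 * L * t)"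
      using K L by (intro mult_left_mono) auto
    then show ?thesis using L by (simp add: field_simps)
  qed
  ultimately show ?case using 0 by (simp add: mult.commute[of t])
next
  case (Suc k)
  let ?C = "K / (2 * L) * (1/2) ^ k"
  have C: "0 \<le> ?C" using bnd1[of 0 0] L by auto
  have sub: "{0..t} \<subseteq> {0..}" by auto
  note pc = picard_continuous[OF fg, THEN conjunct1, THEN continuous_on_subset, OF sub]
    picard_continuous[OF fg, THEN conjunct2, THEN continuous_on_subset, OF sub]
  have int: "(\<lambda>s. F1 (px f g k s) (py f g k s)) integrable_on {0..t}" "(\<lambda>s. F2 (px f g k s) (py f g k s)) integrable_on {0..t}" for k
    by (intro integrable_continuous_interval continuous_on_F pc)+
  have der: "((\<lambda>s. exp (4 * L * s) / (4 * L)) has_vector_derivative exp (4 * L * s)) (at s within {0..t})" for s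
    using L by (auto intro!: derivative_eq_intros simp: has_real_derivative_iff_has_vector_derivative[symmetric])
  have eint: "((\<lambda>s. L * (?C * exp (4 * L * s))) has_integral (L * ?C * (exp (4 * L * t) / (4 * L) - exp (4 * L * 0) / (4 * L)))) {0..t}"
    using has_integral_mult_right[OF fundamental_theorem_of_calculus[OF Suc.prems der], of "L * ?C"] by (simp only: mult.assoc)
  have est: "\<bar>integral {0..t} h\<bar> \<le> L * ?C * (exp (4 * L * t) / (4 * L))"
    if h: "h integrable_on {0..t}" and hb: "\<And>s. s \<in> {0..t} \<Longrightarrow> \<bar>h s\<bar> \<le> L * (\<bar>px f g (Suc k) s - px f g k s\<bar> + \<bar>py f g (Suc k) s - py f g k s\<bar>)" for h
  proof -
    have "norm (integral {0..t} h) \<le> integral {0..t} (\<lambda>s. L * (?C * exp (4 * L * s)))"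
    proof (rule integral_norm_bound_integral[OF h has_integral_integrable[OF eint]])
      fix s assume s: "s \<in> {0..t}"
      have "L * (\<bar>px f g (Suc k) s - px f g k s\<bar> + \<bar>py f g (Suc k) s - py f g k s\<bar>) \<le> L * (?C * exp (4 * L * s))"
        using Suc.IH[of s] s L by (intro mult_left_mono) auto
      then show "norm (h s) \<le> L * (?C * exp (4 * L * s))" using hb[OF s] by simp
    qed
    also have "\<dots> = L * ?C * (exp (4 * L * t) / (4 * L) - exp (4 * L * 0) / (4 * L))" by (rule integral_unique[OF eint])
    also have "\<dots> \<le> L * ?C * (exp (4 * L * t) / (4 * L))"
      by (rule mult_left_mono[OF _ mult_nonneg_nonneg[OF less_imp_le[OF L] C]]) (use L in auto)
    finally show ?thesis by simp
  qed
  have "px f g (Suc (Suc k)) t - px f g (Suc k) t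
     = integral {0..t} (\<lambda>s. F1 (px f g (Suc k) s) (py f g (Suc k) s) - F1 (px f g k s) (py f g k s))"
    by (subst integral_diff[OF int(1)[of "Suc k"] int(1)[of k]]) simp
  also have "\<bar>\<dots>\<bar> \<le> L * ?C * (exp (4 * L * t) / (4 * L))"
    by (rule est) (intro integrable_diff int lip1)+
  finally have 1: "\<bar>px f g (Suc (Suc k)) t - px f g (Suc k) t\<bar> \<le> L * ?C * (exp (4 * L * t) / (4 * L))" .
  have "py f g (Suc (Suc k)) t - py f g (Suc k) t
     = integral {0..t} (\<lambda>s. F2 (px f g (Suc k) s) (py f g (Suc k) s) - F2 (px f g k s) (py f g k s))"
    by (subst integral_diff[OF int(2)[of "Suc k"] int(2)[of k]]) simp
  also have "\<bar>\<dots>\<bar> \<le> L * ?C * (exp (4 * L * t) / (4 * L))"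
    by (rule est) (intro integrable_diff int lip2)+
  finally have 2: "\<bar>py f g (Suc (Suc k)) t - py f g (Suc k) t\<bar> \<le> L * ?C * (exp (4 * L * t) / (4 * L))" .
  have "L * ?C * (exp (4 * L * t) / (4 * L)) + L * ?C * (exp (4 * L * t) / (4 * L)) = K / (2 * L) * (1/2) ^ Suc k * exp (4 * L * t)"
    using L by (simp add: field_simps)
  then show ?case using 1 2 by linarith
qed

definition solx where "solx f g t = lim (\<lambda>k. px f g k t)"
definition soly where "soly f g t = lim (\<lambda>k. py f g k t)"

lemma ode_solution:
  assumes fg: "continuous_on {0..} f" "continuous_on {0..} g"
  shows "continuous_on {0..} (solx f g)" "continuous_on {0..} (soly f g)"
    and "\<And>t. 0 \<le> t \<Longrightarrow> (\<lambda>k. px f g k t) \<longlonglongrightarrow> solx f g t"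
    and "\<And>t. 0 \<le> t \<Longrightarrow> (\<lambda>k. py f g k t) \<longlonglongrightarrow> soly f g t"
    and "\<And>t. 0 \<le> t \<Longrightarrow> solx f g t = f t + integral {0..t} (\<lambda>s. F1 (solx f g s) (soly f g s))"
    and "\<And>t. 0 \<le> t \<Longrightarrow> soly f g t = g t + integral {0..t} (\<lambda>s. F2 (solx f g s) (soly f g s))"
proof -
  have K: "0 \<le> K" using bnd1[of 0 0] by linarith
  have ex: "\<exists>s. summable s \<and> (\<forall>k. \<forall>t\<in>{0..T}. \<bar>px f g (Suc k) t - px f g k t\<bar> \<le> s k)"
     "\<exists>s. summable s \<and> (\<forall>k. \<forall>t\<in>{0..T}. \<bar>py f g (Suc k) t - py f g k t\<bar> \<le> s k)" for T
  proof -
    let ?s = "\<lambda>k. K / (2 * L) * (1/2) ^ k * exp (4 * L * T)"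
    have sm: "summable ?s" by (intro summable_mult summable_mult2 summable_geometric) auto
    have b: "\<bar>px f g (Suc k) t - px f g k t\<bar> + \<bar>py f g (Suc k) t - py f g k t\<bar> \<le> ?s k" if "t \<in> {0..T}" for k t
    proof -
      have "K / (2 * L) * (1/2) ^ k * exp (4 * L * t) \<le> ?s k"
        using that L K by (intro mult_left_mono) auto
      then show ?thesis using picard_diff[OF fg, of t k] that by auto
    qed
    have "\<bar>px f g (Suc k) t - px f g k t\<bar> \<le> ?s k" "\<bar>py f g (Suc k) t - py f g k t\<bar> \<le> ?s k" if "t \<in> {0..T}" for k t
      using b[OF that, of k] abs_ge_zero[of "px f g (Suc k) t - px f g k t"] abs_ge_zero[of "py f g (Suc k) t - py f g k t"] by linarith+
    then show "\<exists>s. summable s \<and> (\<forall>k. \<forall>t\<in>{0..T}. \<bar>px f g (Suc k) t - px f g k t\<bar> \<le> s k)"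
     "\<exists>s. summable s \<and> (\<forall>k. \<forall>t\<in>{0..T}. \<bar>py f g (Suc k) t - py f g k t\<bar> \<le> s k)"
      using sm by blast+
  qed
  note Lx = locally_uniform_limit[of "px f g", OF picard_continuous[OF fg, THEN conjunct1] ex(1), folded solx_def]
  note Ly = locally_uniform_limit[of "py f g", OF picard_continuous[OF fg, THEN conjunct2] ex(2), folded soly_def]
  show "continuous_on {0..} (solx f g)" "continuous_on {0..} (soly f g)" 
    using Lx(1) Ly(1) by (simp_all add: solx_def[abs_def] soly_def[abs_def])
  show tx: "(\<lambda>k. px f g k t) \<longlonglongrightarrow> solx f g t" and ty: "(\<lambda>k. py f g k t) \<longlonglongrightarrow> soly f g t" if "0 \<le> t" for t
    using Lx(2) Ly(2) that by auto
  fix t :: real assume t: "0 \<le> t"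
  have sub: "{0..t} \<subseteq> {0..}" by auto
  note pc = picard_continuous[OF fg, THEN conjunct1, THEN continuous_on_subset, OF sub]
    picard_continuous[OF fg, THEN conjunct2, THEN continuous_on_subset, OF sub]
  have int: "(\<lambda>s. F1 (px f g k s) (py f g k s)) integrable_on {0..t}" "(\<lambda>s. F2 (px f g k s) (py f g k s)) integrable_on {0..t}" for k
    by (intro integrable_continuous_interval continuous_on_F pc)+
  have "(\<lambda>k. integral {0..t} (\<lambda>s. F1 (px f g k s) (py f g k s))) \<longlonglongrightarrow> integral {0..t} (\<lambda>s. F1 (solx f g s) (soly f g s))"
    by (rule dominated_convergence(2)[OF int(1) integrable_const_ivl[of K]])
      (use bnd1 in \<open>auto intro!: tendsto_F tx ty\<close>)
  then have "(\<lambda>k. px f g (Suc k) t) \<longlonglongrightarrow> f t + integral {0..t} (\<lambda>s. F1 (solx f g s) (soly f g s))"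
    by (auto intro!: tendsto_intros)
  then show "solx f g t = f t + integral {0..t} (\<lambda>s. F1 (solx f g s) (soly f g s))"
    using LIMSEQ_Suc[OF tx[OF t]] LIMSEQ_unique by blast
  have "(\<lambda>k. integral {0..t} (\<lambda>s. F2 (px f g k s) (py f g k s))) \<longlonglongrightarrow> integral {0..t} (\<lambda>s. F2 (solx f g s) (soly f g s))"
    by (rule dominated_convergence(2)[OF int(2) integrable_const_ivl[of K]])
      (use bnd2 in \<open>auto intro!: tendsto_F tx ty\<close>)
  then have "(\<lambda>k. py f g (Suc k) t) \<longlonglongrightarrow> g t + integral {0..t} (\<lambda>s. F2 (solx f g s) (soly f g s))"
    by (auto intro!: tendsto_intros)
  then show "soly f g t = g t + integral {0..t} (\<lambda>s. F2 (solx f g s) (soly f g s))"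
    using LIMSEQ_Suc[OF ty[OF t]] LIMSEQ_unique by blast
qed

end

section \<open>Measurability of path integrals\<close>

lemma integral_tendsto_riemann:
  fixes h :: "real \<Rightarrow> real"
  assumes "continuous_on {0..t} h" "0 \<le> t"
  shows "(\<lambda>N. \<Sum>i<N. h (t * real i / real N) * (t / real N)) \<longlonglongrightarrow> integral {0..t} h"
proof -
  have a: "(\<lambda>_::real. 1::real) absolutely_integrable_on {0..t}" by (rule absolutely_integrable_continuous_real) auto
  have tag: "t * real i / real N \<in> {t * real i / real N..t * real (Suc i) / real N}" for i N
    using assms by (auto intro!: divide_right_mono mult_left_mono)
  have "integral {t * real i / real N..t * real (Suc i) / real N} (\<lambda>_. 1) = t / real N" for i N
    using tag[of i N] by (simp add: diff_divide_distrib[symmetric] algebra_simps)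
  then show ?thesis
    using riemann_stieltjes_sum_tendsto(2)[OF assms(1) a assms(2), of "\<lambda>N i. t * real i / real N", OF tag] by simp
qed

text \<open>As a limit of Riemann sums the integral involves \<open>h\<close> at single times up to
  \<open>t\<close> only. This gives adaptedness without any joint measurability in time and sample
  point.\<close>

lemma borel_measurable_path_integral:
  fixes h :: "real \<Rightarrow> 'a \<Rightarrow> real"
  assumes "\<And>s. 0 \<le> s \<Longrightarrow> s \<le> t \<Longrightarrow> h s \<in> borel_measurable N"
    and "\<And>\<omega>. \<omega> \<in> space N \<Longrightarrow> continuous_on {0..t} (\<lambda>s. h s \<omega>)" and t: "0 \<le> t"
  shows "(\<lambda>\<omega>. integral {0..t} (\<lambda>s. h s \<omega>)) \<in> borel_measurable N"
proof (rule borel_measurable_LIMSEQ_real)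
  show "(\<lambda>n. \<Sum>i<n. h (t * real i / real n) \<omega> * (t / real n)) \<longlonglongrightarrow> integral {0..t} (\<lambda>s. h s \<omega>)" if "\<omega> \<in> space N" for \<omega>
    by (rule integral_tendsto_riemann[OF assms(2)[OF that] t])
  fix n
  have "h (t * real i / real n) \<in> borel_measurable N" if "i < n" for i
    by (rule assms(1)) (use uniform_partition_mem[OF that t] t that in \<open>auto simp: field_simps mult_left_mono\<close>)
  then show "(\<lambda>\<omega>. \<Sum>i<n. h (t * real i / real n) \<omega> * (t / real n)) \<in> borel_measurable N"
    by (intro borel_measurable_sum borel_measurable_times) auto
qed

section \<open>Approximation of the reciprocal\<close>

text \<open>\<open>psi a\<close> is a smooth upper approximation of the positive part, so \<open>phi a\<close> approximates \<open>1 / x\<close>;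
  what matters is \<open>0 \<le> psi' \<le> 1\<close>, i.e. \<open>\<bar>phi'\<bar> \<le> phi\<^sup>2\<close>, and monotonicity in \<open>a\<close>.\<close>

definition psi :: "real \<Rightarrow> real \<Rightarrow> real" where "psi a x = a + (x + sqrt (x\<^sup>2 + a\<^sup>2)) / 2"
definition phi :: "real \<Rightarrow> real \<Rightarrow> real" where "phi a x = 1 / psi a x"

lemma psi_ge: "0 < a \<Longrightarrow> a \<le> psi a x" "0 < a \<Longrightarrow> x \<le> psi a x"
proof -
  assume a: "0 < a"
  have "\<bar>x\<bar> \<le> sqrt (x\<^sup>2 + a\<^sup>2)" by (rule real_le_rsqrt) simp
  then have "- x \<le> sqrt (x\<^sup>2 + a\<^sup>2)" "x \<le> sqrt (x\<^sup>2 + a\<^sup>2)" by linarith+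
  with a show "a \<le> psi a x" "x \<le> psi a x" unfolding psi_def atomize_conj by argo
qed

lemma psi_pos: "0 < a \<Longrightarrow> 0 < psi a x" using psi_ge(1)[of a x] by simp

lemma psi_le: "0 < a \<Longrightarrow> psi a x \<le> max x 0 + 2 * a"
proof -
  assume a: "0 < a"
  have "sqrt (x\<^sup>2 + a\<^sup>2) \<le> \<bar>x\<bar> + a" using a sqrt_sum_squares_le_sum_abs[of x a] by simp
  then show ?thesis using a by (auto simp: psi_def max_def)
qed

lemma psi_mono: "0 < b \<Longrightarrow> b \<le> a \<Longrightarrow> psi b x \<le> psi a x"
  by (auto simp: psi_def intro!: add_mono divide_right_mono real_sqrt_le_mono power_mono)

definition psi' :: "real \<Rightarrow> real \<Rightarrow> real" where "psi' a x = (1 + x / sqrt (x\<^sup>2 + a\<^sup>2)) / 2"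

lemma psi'_bounds: "0 < a \<Longrightarrow> 0 \<le> psi' a x" "0 < a \<Longrightarrow> psi' a x \<le> 1"
proof -
  assume a: "0 < a"
  then have p: "0 < sqrt (x\<^sup>2 + a\<^sup>2)" by (simp add: add_nonneg_pos)
  have "\<bar>x\<bar> \<le> sqrt (x\<^sup>2 + a\<^sup>2)" by (rule real_le_rsqrt) simp
  then have "\<bar>x / sqrt (x\<^sup>2 + a\<^sup>2)\<bar> \<le> 1" using p by (simp add: abs_divide divide_le_eq)
  then have "- 1 \<le> x / sqrt (x\<^sup>2 + a\<^sup>2)" "x / sqrt (x\<^sup>2 + a\<^sup>2) \<le> 1" by linarith+
  then show "0 \<le> psi' a x" "psi' a x \<le> 1" unfolding psi'_def atomize_conj by argo
qed

lemma DERIV_psi: "0 < a \<Longrightarrow> (psi a has_real_derivative psi' a x) (at x)"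
proof -
  assume a: "0 < a"
  then have "0 < x\<^sup>2 + a\<^sup>2" by (simp add: add_nonneg_pos)
  then show ?thesis unfolding psi_def[abs_def] psi'_def
    by (auto intro!: derivative_eq_intros simp: field_simps)
qed

lemma DERIV_psi': "0 < a \<Longrightarrow> (psi' a has_real_derivative a\<^sup>2 / (2 * sqrt (x\<^sup>2 + a\<^sup>2) ^ 3)) (at x)"
proof -
  assume a: "0 < a"
  then have p: "0 < x\<^sup>2 + a\<^sup>2" by (simp add: add_nonneg_pos)
  define r where "r = sqrt (x\<^sup>2 + a\<^sup>2)"
  have r: "0 < r" "r\<^sup>2 = x\<^sup>2 + a\<^sup>2" using p by (auto simp: r_def)
  have "(psi' a has_real_derivative (1 * r - x * (x / r)) / (r * r) / 2) (at x)"
  proof -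
    have "((\<lambda>x. sqrt (x\<^sup>2 + a\<^sup>2)) has_real_derivative x / r) (at x)"
      using p r by (auto intro!: derivative_eq_intros simp: r_def field_simps)
    from DERIV_divide[OF DERIV_ident this] r a
    have "((\<lambda>x. x / sqrt (x\<^sup>2 + a\<^sup>2)) has_real_derivative (1 * r - x * (x / r)) / (r * r)) (at x)"
      by (simp add: r_def)
    from DERIV_cdivide[OF DERIV_add[OF DERIV_const[of 1] this], of 2] show ?thesis
      unfolding psi'_def[abs_def] by simp
  qed
  moreover have "(1 * r - x * (x / r)) / (r * r) / 2 = a\<^sup>2 / (2 * r ^ 3)"
  proof -
    have "(1 * r - x * (x / r)) = a\<^sup>2 / r" using r by (simp add: field_simps power2_eq_square)
    then show ?thesis using r by (simp add: power3_eq_cube field_simps)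
  qed
  ultimately show ?thesis by (simp add: r_def)
qed

lemma psi''_bound: "0 < a \<Longrightarrow> \<bar>a\<^sup>2 / (2 * sqrt (x\<^sup>2 + a\<^sup>2) ^ 3)\<bar> \<le> 1 / a"
proof -
  assume a: "0 < a"
  have "a \<le> sqrt (x\<^sup>2 + a\<^sup>2)" using a by (intro real_le_rsqrt) auto
  then have "a ^ 3 \<le> sqrt (x\<^sup>2 + a\<^sup>2) ^ 3" using a by (intro power_mono) auto
  then have "a ^ 3 \<le> 2 * sqrt (x\<^sup>2 + a\<^sup>2) ^ 3" using zero_le_power[of a 3] a by linarith
  then have "a\<^sup>2 / (2 * sqrt (x\<^sup>2 + a\<^sup>2) ^ 3) \<le> a\<^sup>2 / (a ^ 3)" using a
    by (intro divide_left_mono) (auto intro!: mult_pos_pos simp: add_nonneg_pos)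
  also have "\<dots> = 1 / a" using a by (simp add: power3_eq_cube power2_eq_square)
  finally show ?thesis using a by (simp add: abs_of_nonneg)
qed

lemma phi_pos: "0 < a \<Longrightarrow> 0 < phi a x" using psi_pos[of a x] by (simp add: phi_def)
lemma phi_le: "0 < a \<Longrightarrow> phi a x \<le> 1 / a"
  unfolding phi_def using psi_ge(1)[of a x] psi_pos[of a x] by (intro divide_left_mono) auto
lemma phi_le_inverse: "0 < a \<Longrightarrow> 0 < x \<Longrightarrow> phi a x \<le> 1 / x"
  unfolding phi_def using psi_ge(2)[where x=x] psi_pos[of a x] by (intro divide_left_mono) auto

lemma DERIV_phi: "0 < a \<Longrightarrow> (phi a has_real_derivative - (phi a x)\<^sup>2 * psi' a x) (at x)"
  unfolding phi_def[abs_def] using psi_pos[of a x] DERIV_psi[of a x]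
  by (auto intro!: derivative_eq_intros simp: field_simps power2_eq_square)

lemma phi_antimono: "0 < a \<Longrightarrow> x \<le> y \<Longrightarrow> phi a y \<le> phi a x"
  by (rule DERIV_nonpos_imp_nonincreasing[of x y])
    (auto intro!: exI[of _ "- (phi a _)\<^sup>2 * psi' a _"] DERIV_phi mult_nonneg_nonneg psi'_bounds)

lemma phi_mono_param: "0 < b \<Longrightarrow> b \<le> a \<Longrightarrow> phi a x \<le> phi b x"
  unfolding phi_def using psi_mono[of b a x] psi_pos[of b x] psi_pos[of a x] by (intro divide_left_mono) auto

lemma abs_le_of_DERIV_bound:
  fixes f f' :: "real \<Rightarrow> real"
  assumes "\<And>x. (f has_real_derivative f' x) (at x)" "\<And>x. \<bar>f' x\<bar> \<le> K"
  shows "\<bar>f x - f y\<bar> \<le> K * \<bar>x - y\<bar>"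
  using field_differentiable_bound[of UNIV f f' K x y] assms by (auto simp: abs_minus_commute)

lemma phi_lipschitz: "0 < a \<Longrightarrow> \<bar>phi a x - phi a y\<bar> \<le> (1 / a\<^sup>2) * \<bar>x - y\<bar>"
proof (rule abs_le_of_DERIV_bound[OF DERIV_phi])
  fix x assume a: "0 < a"
  have "(phi a x)\<^sup>2 * psi' a x \<le> (1 / a)\<^sup>2 * 1"
    using phi_le[OF a, of x] phi_pos[OF a, of x] psi'_bounds[OF a, of x] by (intro mult_mono power_mono) auto
  then show "\<bar>- (phi a x)\<^sup>2 * psi' a x\<bar> \<le> 1 / a\<^sup>2" 
    using psi'_bounds[OF a, of x] by (simp add: abs_mult power_divide)
qed

lemma continuous_on_phi: "0 < a \<Longrightarrow> continuous_on S f \<Longrightarrow> continuous_on S (\<lambda>s. phi a (f s))"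
  by (rule continuous_on_compose2[of UNIV "phi a"]) (auto intro!: DERIV_continuous_on DERIV_phi)

text \<open>The gap \<open>psi a x - psi b x\<close> is at most \<open>2 * a\<close>, so the
  difference is at most \<open>2 * a * phi a x * phi b x\<close>. Interpolating with
  \<open>a * phi a x \<le> 1\<close> yields a rate in \<open>a\<close> against a power of
  \<open>phi\<close> barely above 1, whose time integral has a mean bounded uniformly in the
  parameter.\<close>

lemma phi_param_diff:
  assumes "0 < b" "b \<le> a" "0 < \<epsilon>" "\<epsilon> \<le> 1"
  shows "phi b x - phi a x \<le> 2 * a powr \<epsilon> * phi b x powr (1 + \<epsilon>)"
proof -
  have a: "0 < a" using assms by simp
  note p = psi_pos[OF a, of x] psi_pos[OF assms(1), of x]
  have "max x 0 \<le> psi b x" using psi_ge(2)[OF assms(1), of x] p(2) by auto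
  then have d: "psi a x - psi b x \<le> 2 * a" using psi_le[OF a, of x] by linarith
  have "phi b x - phi a x = phi b x * phi a x * (psi a x - psi b x)"
    unfolding phi_def using p by (simp add: field_simps)
  also have "\<dots> \<le> phi b x * phi a x * (2 * a)"
    using d phi_pos[OF assms(1), of x] phi_pos[OF a, of x] by (intro mult_left_mono) auto
  also have "\<dots> = 2 * phi b x * (a * phi a x)" by simp
  \<comment> \<open>A number in (0, 1] is at most its power \<epsilon>; this trades the factor
    \<open>a\<close> for \<open>a powr \<epsilon>\<close> and one full power of
    \<open>phi a x\<close> for the power \<epsilon>.\<close>
  also have "\<dots> \<le> 2 * phi b x * (a * phi a x) powr \<epsilon>"
  proof -
    have "a * phi a x \<le> 1" using phi_le[OF a, of x] a by (simp add: field_simps)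
    then have "(a * phi a x) powr 1 \<le> (a * phi a x) powr \<epsilon>"
      using assms a phi_pos[OF a, of x] by (intro powr_mono') auto
    then show ?thesis using a phi_pos[OF a, of x] phi_pos[OF assms(1), of x] by (intro mult_left_mono) auto
  qed
  also have "\<dots> = 2 * a powr \<epsilon> * (phi b x * phi a x powr \<epsilon>)"
    using a phi_pos[OF a, of x] by (simp add: powr_mult)
  also have "\<dots> \<le> 2 * a powr \<epsilon> * (phi b x * phi b x powr \<epsilon>)"
    using phi_mono_param[OF assms(1,2), of x] phi_pos[OF a, of x] phi_pos[OF assms(1), of x] assms
    by (intro mult_left_mono powr_mono2) auto
  also have "\<dots> = 2 * a powr \<epsilon> * phi b x powr (1 + \<epsilon>)"
    using phi_pos[OF assms(1), of x] by (simp add: powr_add)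
  finally show ?thesis .
qed

text \<open>If \<open>x > x'\<close>, monotonicity in the point and in the parameter work together
  and nothing is lost. If \<open>x < x'\<close> they compete, and the loss is a change of parameter
  at \<open>x'\<close>. The error thus lives at the point of the finer approximation only, where
  \<open>phi_param_diff\<close> compares it with powers of \<open>phi b x'\<close>.\<close>

lemma sgn_phi_diff:
  assumes "0 < b" "b \<le> a"
  shows "sgn (x - x') * (phi a x - phi b x') \<le> - \<bar>phi a x - phi b x'\<bar> + 2 * (phi b x' - phi a x')"
proof (cases x x' rule: linorder_cases)
  case less
  then have "phi a x' \<le> phi a x" using assms by (intro phi_antimono) auto
  then show ?thesis using less phi_mono_param[OF assms, of x'] by (auto simp: sgn_if abs_if)
next
  case equal
  then show ?thesis using phi_mono_param[OF assms, of x] by (auto simp: sgn_if abs_if)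
next
  case greater
  then have "phi b x \<le> phi b x'" "phi a x \<le> phi b x" "phi a x' \<le> phi b x'"
    using assms phi_mono_param by (auto intro: phi_antimono)
  then show ?thesis using greater by (auto simp: sgn_if abs_if)
qed

section \<open>Passage to the limit along vanishing regularisation\<close>

lemma tendsto_psi:
  assumes "X \<longlonglongrightarrow> x" "a \<longlonglongrightarrow> 0" "\<And>k. 0 < a k"
  shows "(\<lambda>k. psi (a k) (X k)) \<longlonglongrightarrow> max x 0"
proof -
  have "(\<lambda>k. a k + (X k + sqrt ((X k)\<^sup>2 + (a k)\<^sup>2)) / 2) \<longlonglongrightarrow> 0 + (x + sqrt (x\<^sup>2 + 0\<^sup>2)) / 2"
    using assms by (intro tendsto_intros) auto
  moreover have "0 + (x + sqrt (x\<^sup>2 + 0\<^sup>2)) / 2 = max x 0" by (simp add: max_def)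
  ultimately show ?thesis unfolding psi_def by simp
qed

text \<open>Summable \<open>L1\<close> differences of the regularised reciprocals keep their
  integrals bounded, so by Fatou they cannot diverge on a set of positive measure. They do diverge
  wherever the limit path is nonpositive; hence the path is positive almost everywhere, and by
  continuity nowhere negative.\<close>

lemma limit_component:
  fixes X :: "nat \<Rightarrow> real \<Rightarrow> real" and a :: "nat \<Rightarrow> real"
  defines "x \<equiv> \<lambda>t. lim (\<lambda>k. X k t)"
  assumes a: "\<And>k. 0 < a k" "a \<longlonglongrightarrow> 0" and X: "\<And>k. continuous_on {0..} (X k)"
    and s: "\<And>T. 0 \<le> T \<Longrightarrow> \<exists>s. summable s \<and> (\<forall>k. \<forall>t\<in>{0..T}. \<bar>X (Suc k) t - X k t\<bar> \<le> s k) \<and>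
       (\<forall>k. integral {0..T} (\<lambda>r. \<bar>phi (a (Suc k)) (X (Suc k) r) - phi (a k) (X k r)\<bar>) \<le> s k)"
  shows "continuous_on {0..} x"
    and "\<And>t. 0 \<le> t \<Longrightarrow> (\<lambda>k. X k t) \<longlonglongrightarrow> x t"
    and "\<And>t. 0 \<le> t \<Longrightarrow> 0 \<le> x t"
    and "\<And>t. 0 \<le> t \<Longrightarrow> negligible {r\<in>{0..t}. x r = 0}"
    and "\<And>t. 0 \<le> t \<Longrightarrow> (\<lambda>r. 1 / x r) integrable_on {0..t}"
    and "\<And>t. 0 \<le> t \<Longrightarrow> (\<lambda>k. integral {0..t} (\<lambda>r. phi (a k) (X k r))) \<longlonglongrightarrow> integral {0..t} (\<lambda>r. 1 / x r)"
proof -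
  have s': "\<exists>s. summable s \<and> (\<forall>k. \<forall>t\<in>{0..T}. \<bar>X (Suc k) t - X k t\<bar> \<le> s k)" if "0 \<le> T" for T
    using s[OF that] by blast
  note lu = locally_uniform_limit[of X, OF X s']
  show xc: "continuous_on {0..} x" unfolding x_def using lu(1) by blast
  show xl: "(\<lambda>k. X k t) \<longlonglongrightarrow> x t" if "0 \<le> t" for t unfolding x_def using lu(2)[OF _ that] by blast
  define P where "P k r = phi (a k) (X k r)" for k r
  have Pc: "continuous_on {0..} (P k)" for k unfolding P_def by (intro continuous_on_phi a X)
  have P0: "0 < P k r" for k r unfolding P_def by (rule phi_pos[OF a(1)])
  have Pc': "continuous_on {0..T} (P k)" for k T by (rule continuous_on_subset[OF Pc]) auto
  have dint: "(\<lambda>r. \<bar>P m r - P k r\<bar>) integrable_on {0..T}" "P k integrable_on {0..T}" for k m T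
    by (intro integrable_continuous_interval continuous_intros Pc')+
  have Ppos: "(\<lambda>k. P k r) \<longlonglongrightarrow> 1 / x r" if "0 \<le> r" "0 < x r" for r
  proof -
    have "(\<lambda>k. 1 / psi (a k) (X k r)) \<longlonglongrightarrow> 1 / max (x r) 0"
      using that by (intro tendsto_intros tendsto_psi xl a) auto
    then show ?thesis using that unfolding P_def phi_def by simp
  qed
  \<comment> \<open>This covers negative limits as well as zero, because \<open>psi\<close>
    approximates the positive part and not the identity.\<close>
  have Pneg: "(\<lambda>k. ennreal (P k r)) \<longlonglongrightarrow> \<infinity>" if "0 \<le> r" "x r \<le> 0" for r
  proof -
    have "(\<lambda>k. psi (a k) (X k r)) \<longlonglongrightarrow> 0"
      using tendsto_psi[OF xl[OF that(1)] a(2,1)] that by (simp add: max_def split: if_splits)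
    then have "filterlim (\<lambda>k. psi (a k) (X k r)) (at_right 0) sequentially"
      using psi_pos[OF a(1)] by (auto simp: filterlim_at less_imp_neq[symmetric] intro!: always_eventually)
    then have "filterlim (\<lambda>k. inverse (psi (a k) (X k r))) at_top sequentially"
      by (rule filterlim_compose[OF filterlim_inverse_at_top_right])
    then have "filterlim (\<lambda>k. P k r) at_top sequentially" by (simp add: P_def phi_def inverse_eq_divide)
    then show ?thesis by (simp add: ennreal_tendsto_top_eq_at_top)
  qed
  have nnP: "(\<integral>\<^sup>+r. ennreal (h r) * indicator {0..T} r \<partial>lborel) = ennreal (integral {0..T} h)"
    if "\<And>r. 0 \<le> h r" "continuous_on {0..T} h" for h :: "real \<Rightarrow> real" and T
    by (rule nn_integral_has_integral_lebesgue') (use that in \<open>auto intro!: integrable_integral integrable_continuous_interval\<close>)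
  have mP: "(\<lambda>r. ennreal (h r) * indicator {0..T} r) \<in> borel_measurable lborel"
    if "continuous_on {0..T} h" for h :: "real \<Rightarrow> real" and T
  proof -
    have "(\<lambda>r. ennreal (indicator {0..T} r *\<^sub>R h r)) \<in> borel_measurable borel"
      by (intro measurable_compose[OF borel_measurable_continuous_on_indicator[OF _ that]]) auto
    also have "(\<lambda>r. ennreal (indicator {0..T} r *\<^sub>R h r)) = (\<lambda>r. ennreal (h r) * indicator {0..T} r)"
      by (auto simp: indicator_def)
    finally show ?thesis by simp
  qed
  \<comment> \<open>Nonnegativity of \<open>x\<close> is not yet known, so the limiting integrand is
    written with \<open>max (x r) 0\<close>. Where \<open>x r \<le> 0\<close> it takes the value
    \<open>1 / 0 = 0\<close>, but these times form a negligible set.\<close>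
  have main: "negligible {r\<in>{0..T}. x r \<le> 0} \<and> (\<lambda>r. 1 / max (x r) 0) integrable_on {0..T} \<and>
      (\<lambda>k. integral {0..T} (P k)) \<longlonglongrightarrow> integral {0..T} (\<lambda>r. 1 / max (x r) 0)" if T: "0 \<le> T" for T
  proof -
    obtain s where s: "summable s" "\<And>k. integral {0..T} (\<lambda>r. \<bar>P (Suc k) r - P k r\<bar>) \<le> s k"
      using s[OF T] unfolding P_def by blast
    have s0: "0 \<le> s k" for k
      by (rule order_trans[OF _ s(2)[of k]]) (intro integral_nonneg dint, auto)
    \<comment> \<open>The bound is uniform in \<open>n\<close>, which permits Fatou for
      \<open>n\<close> tending to infinity at fixed \<open>k\<close>.\<close>
    have tele: "integral {0..T} (\<lambda>r. \<bar>P (k + n) r - P k r\<bar>) \<le> (\<Sum>i. s (i + k))" for k n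
    proof -
      have "integral {0..T} (\<lambda>r. \<bar>P (k + n) r - P k r\<bar>) \<le> (\<Sum>i<n. s (i + k))"
      proof (induction n)
        case (Suc n)
        have "integral {0..T} (\<lambda>r. \<bar>P (k + Suc n) r - P k r\<bar>)
          \<le> integral {0..T} (\<lambda>r. \<bar>P (Suc (k + n)) r - P (k + n) r\<bar> + \<bar>P (k + n) r - P k r\<bar>)"
          by (intro integral_le integrable_add dint) auto
        also have "\<dots> = integral {0..T} (\<lambda>r. \<bar>P (Suc (k + n)) r - P (k + n) r\<bar>) + integral {0..T} (\<lambda>r. \<bar>P (k + n) r - P k r\<bar>)"
          by (intro integral_add dint)
        also have "\<dots> \<le> s (k + n) + (\<Sum>i<n. s (i + k))" using s(2)[of "k + n"] Suc by linarith
        finally show ?case by (simp add: add.commute)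
      qed simp
      also have "\<dots> \<le> (\<Sum>i. s (i + k))"
        by (intro sum_le_suminf) (use s s0 in \<open>auto simp: summable_iff_shift\<close>)
      finally show ?thesis .
    qed
    have fatou1: "(\<integral>\<^sup>+r. liminf (\<lambda>k. ennreal (P k r) * indicator {0..T} r) \<partial>lborel) < \<infinity>"
    proof -
      have "(\<integral>\<^sup>+r. liminf (\<lambda>k. ennreal (P k r) * indicator {0..T} r) \<partial>lborel)
         \<le> liminf (\<lambda>k. \<integral>\<^sup>+r. ennreal (P k r) * indicator {0..T} r \<partial>lborel)"
        by (rule nn_integral_liminf) (intro mP Pc')
      also have "\<dots> \<le> ennreal (integral {0..T} (P 0) + (\<Sum>i. s (i + 0)))"
      proof (rule Liminf_le, simp, intro always_eventually allI)
        fix k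
        have "integral {0..T} (P k) \<le> integral {0..T} (\<lambda>r. P 0 r + \<bar>P (0 + k) r - P 0 r\<bar>)"
          by (intro integral_le integrable_add dint) auto
        also have "\<dots> = integral {0..T} (P 0) + integral {0..T} (\<lambda>r. \<bar>P (0 + k) r - P 0 r\<bar>)"
          by (intro integral_add dint)
        also have "\<dots> \<le> integral {0..T} (P 0) + (\<Sum>i. s (i + 0))" using tele[of 0 k] by linarith
        finally show "(\<integral>\<^sup>+r. ennreal (P k r) * indicator {0..T} r \<partial>lborel) \<le> ennreal (integral {0..T} (P 0) + (\<Sum>i. s (i + 0)))"
          by (subst nnP) (use P0 Pc' in \<open>auto intro: less_imp_le ennreal_leI\<close>)
      qed
      finally show ?thesis by (simp add: le_less_trans ennreal_less_top)
    qed
    have "AE r in lborel. liminf (\<lambda>k. ennreal (P k r) * indicator {0..T} r) \<noteq> \<infinity>"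
      by (rule nn_integral_noteq_infinite) (use fatou1 mP Pc' in \<open>auto intro!: borel_measurable_liminf\<close>)
    then have AEpos: "AE r in lborel. r \<in> {0..T} \<longrightarrow> 0 < x r"
    proof (eventually_elim, intro impI)
      fix r assume h: "liminf (\<lambda>k. ennreal (P k r) * indicator {0..T} r) \<noteq> \<infinity>" "r \<in> {0..T}"
      show "0 < x r"
      proof (rule ccontr)
        assume "\<not> 0 < x r"
        then have "(\<lambda>k. ennreal (P k r)) \<longlonglongrightarrow> \<infinity>" using h by (intro Pneg) auto
        then have "liminf (\<lambda>k. ennreal (P k r)) = \<infinity>" by (intro lim_imp_Liminf) auto
        then show False using h by simp
      qed
    qed
    have xc': "continuous_on {0..T} x" by (rule continuous_on_subset[OF xc]) auto
    have neg: "negligible {r\<in>{0..T}. x r \<le> 0}"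
    proof -
      have cl: "closed {r\<in>{0..T}. x r \<le> 0}"
        using continuous_closed_preimage[OF xc' closed_atLeastAtMost closed_atMost[of 0]]
        by (simp add: vimage_def Int_def)
      have "AE r in lborel. r \<notin> {r\<in>{0..T}. x r \<le> 0}" using AEpos by eventually_elim auto
      then have "{r\<in>{0..T}. x r \<le> 0} \<in> null_sets lborel"
        by (rule AE_iff_null_sets[THEN iffD2, rotated]) (use cl in auto)
      then show ?thesis by (simp add: negligible_iff_null_sets null_sets_completionI)
    qed
    let ?h = "\<lambda>r. 1 / max (x r) 0"
    have hm: "(\<lambda>r. indicator {0..T} r *\<^sub>R ?h r) \<in> borel_measurable borel"
    proof -
      have "(\<lambda>r. 1 / max (indicator {0..T} r *\<^sub>R x r) 0) \<in> borel_measurable borel"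
        using borel_measurable_continuous_on_indicator[OF _ xc'] by measurable
      also have "(\<lambda>r. 1 / max (indicator {0..T} r *\<^sub>R x r) 0) = (\<lambda>r. indicator {0..T} r *\<^sub>R ?h r)"
        by (auto simp: indicator_def)
      finally show ?thesis .
    qed
    \<comment> \<open>Fatou a second time, now for differences from a fixed index: the
      \<open>L1\<close> distance to the limit is at most a tail of the series.\<close>
    have est: "(\<integral>\<^sup>+r. ennreal \<bar>?h r - P k r\<bar> * indicator {0..T} r \<partial>lborel) \<le> ennreal (\<Sum>i. s (i + k))" for k
    proof -
      have "(\<integral>\<^sup>+r. ennreal \<bar>?h r - P k r\<bar> * indicator {0..T} r \<partial>lborel)
          = (\<integral>\<^sup>+r. liminf (\<lambda>n. ennreal \<bar>P (k + n) r - P k r\<bar> * indicator {0..T} r) \<partial>lborel)"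
      proof (rule nn_integral_cong_AE, use AEpos in eventually_elim)
        fix r assume r: "r \<in> {0..T} \<longrightarrow> 0 < x r"
        show "ennreal \<bar>?h r - P k r\<bar> * indicator {0..T} r = liminf (\<lambda>n. ennreal \<bar>P (k + n) r - P k r\<bar> * indicator {0..T} r)"
        proof (cases "r \<in> {0..T}")
          case True
          then have "(\<lambda>n. P n r) \<longlonglongrightarrow> ?h r" using r Ppos[of r] by (simp add: max_def)
          then have "(\<lambda>n. P (k + n) r) \<longlonglongrightarrow> ?h r" using LIMSEQ_ignore_initial_segment[of _ _ k] by (simp add: add.commute)
          then have "(\<lambda>n. ennreal \<bar>P (k + n) r - P k r\<bar>) \<longlonglongrightarrow> ennreal \<bar>?h r - P k r\<bar>"
            by (intro tendsto_intros tendsto_ennrealI)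
          then have "liminf (\<lambda>n. ennreal \<bar>P (k + n) r - P k r\<bar>) = ennreal \<bar>?h r - P k r\<bar>"
            by (rule lim_imp_Liminf[rotated]) simp
          then show ?thesis using True by simp
        qed (simp add: Liminf_const)
      qed
      also have "\<dots> \<le> liminf (\<lambda>n. \<integral>\<^sup>+r. ennreal \<bar>P (k + n) r - P k r\<bar> * indicator {0..T} r \<partial>lborel)"
        by (rule nn_integral_liminf) (intro mP continuous_intros Pc')
      also have "\<dots> \<le> ennreal (\<Sum>i. s (i + k))"
      proof (rule Liminf_le, simp, intro always_eventually allI)
        fix n show "(\<integral>\<^sup>+r. ennreal \<bar>P (k + n) r - P k r\<bar> * indicator {0..T} r \<partial>lborel) \<le> ennreal (\<Sum>i. s (i + k))"
          by (subst nnP) (use tele[of k n] in \<open>auto intro!: continuous_intros Pc' ennreal_leI\<close>)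
      qed
      finally show ?thesis .
    qed
    have di: "set_integrable lborel {0..T} (\<lambda>r. ?h r - P k r)" for k
      unfolding set_integrable_def
    proof (rule integrableI_bounded)
      have "(\<lambda>r. indicator {0..T} r *\<^sub>R P k r) \<in> borel_measurable borel"
        by (rule borel_measurable_continuous_on_indicator[OF _ Pc']) auto
      then have "(\<lambda>r. indicator {0..T} r *\<^sub>R ?h r - indicator {0..T} r *\<^sub>R P k r) \<in> borel_measurable borel"
        using hm by (intro borel_measurable_diff)
      then show "(\<lambda>r. indicator {0..T} r *\<^sub>R (?h r - P k r)) \<in> borel_measurable lborel" by (simp add: algebra_simps)
      have "(\<integral>\<^sup>+r. ennreal (norm (indicator {0..T} r *\<^sub>R (?h r - P k r))) \<partial>lborel) = (\<integral>\<^sup>+r. ennreal \<bar>?h r - P k r\<bar> * indicator {0..T} r \<partial>lborel)"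
        by (intro nn_integral_cong) (auto simp: indicator_def)
      then show "(\<integral>\<^sup>+r. ennreal (norm (indicator {0..T} r *\<^sub>R (?h r - P k r))) \<partial>lborel) < \<infinity>"
        using est[of k] by (simp add: le_less_trans ennreal_less_top)
    qed
    have dI: "(\<lambda>r. ?h r - P k r) integrable_on {0..T}" for k by (rule set_borel_integral_eq_integral(1)[OF di])
    have "(\<lambda>r. (?h r - P 0 r) + P 0 r) integrable_on {0..T}" by (intro integrable_add dI dint)
    then have hI: "?h integrable_on {0..T}" by simp
    have bd: "\<bar>integral {0..T} (P k) - integral {0..T} ?h\<bar> \<le> (\<Sum>i. s (i + k))" for k
    proof -
      have ai: "(\<lambda>r. \<bar>?h r - P k r\<bar>) integrable_on {0..T}"
        using set_borel_integral_eq_integral(1)[OF set_integrable_abs[OF di[of k]]] .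
      have "ennreal (integral {0..T} (\<lambda>r. \<bar>?h r - P k r\<bar>)) = (\<integral>\<^sup>+r. ennreal \<bar>?h r - P k r\<bar> * indicator {0..T} r \<partial>lborel)"
        by (rule nn_integral_has_integral_lebesgue'[symmetric]) (use ai in \<open>auto intro: integrable_integral\<close>)
      then have "ennreal (integral {0..T} (\<lambda>r. \<bar>?h r - P k r\<bar>)) \<le> ennreal (\<Sum>i. s (i + k))" using est by simp
      then have "integral {0..T} (\<lambda>r. \<bar>?h r - P k r\<bar>) \<le> (\<Sum>i. s (i + k))"
        by (subst (asm) ennreal_le_iff) (auto intro!: suminf_nonneg s0 simp: summable_iff_shift s)
      moreover have "norm (integral {0..T} (\<lambda>r. ?h r - P k r)) \<le> integral {0..T} (\<lambda>r. \<bar>?h r - P k r\<bar>)"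
        by (rule integral_norm_bound_integral[OF dI ai]) auto
      moreover have "integral {0..T} (\<lambda>r. ?h r - P k r) = integral {0..T} ?h - integral {0..T} (P k)"
        by (intro integral_diff hI dint)
      ultimately show ?thesis by simp
    qed
    have "(\<lambda>k. \<Sum>i. s (i + k)) \<longlonglongrightarrow> 0" by (rule suminf_exist_split2[OF s(1)])
    then have "(\<lambda>k. integral {0..T} (P k) - integral {0..T} ?h) \<longlonglongrightarrow> 0"
      by (rule Lim_null_comparison[rotated]) (use bd in \<open>auto intro!: always_eventually\<close>)
    then show ?thesis using neg hI by (auto dest: LIM_zero_cancel)
  qed
  \<comment> \<open>A negative value would persist on an interval of positive length contained in a
    negligible set.\<close>
  show x0: "0 \<le> x t" if t: "0 \<le> t" for t
  proof (rule ccontr)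
    assume "\<not> 0 \<le> x t"
    then have lt: "x t < 0" by simp
    have "continuous (at t within {0..}) x" using xc t by (auto simp: continuous_on_eq_continuous_within)
    then have "(x \<longlongrightarrow> x t) (at t within {0..})" by (simp add: continuous_within)
    then have "eventually (\<lambda>r. x r < 0) (at t within {0..})" using lt by (rule order_tendstoD)
    then obtain d where d: "0 < d" "\<And>r. 0 \<le> r \<Longrightarrow> r \<noteq> t \<Longrightarrow> dist r t < d \<Longrightarrow> x r < 0"
      unfolding eventually_at by auto
    have "{t..t + d / 2} \<subseteq> {r\<in>{0..t + d}. x r \<le> 0}"
    proof
      fix r assume r: "r \<in> {t..t + d / 2}"
      have "x r < 0" using r d lt t by (cases "r = t") (auto simp: dist_real_def)
      then show "r \<in> {r\<in>{0..t + d}. x r \<le> 0}" using r d t by auto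
    qed
    then have "negligible {t..t + d / 2}" using main[of "t + d"] negligible_subset t d by (metis add_nonneg_nonneg less_imp_le)
    then show False using d negligible_interval(1)[of t "t + d / 2"] by (simp add: box_real cbox_interval)
  qed
  show "negligible {r\<in>{0..t}. x r = 0}" if "0 \<le> t" for t
    by (rule negligible_subset[OF main[OF that, THEN conjunct1]]) auto
  show "(\<lambda>r. 1 / x r) integrable_on {0..t}" if "0 \<le> t" for t
    by (rule integrable_eq[OF main[OF that, THEN conjunct2, THEN conjunct1]]) (simp add: x0 max_absorb1)
  show "(\<lambda>k. integral {0..t} (\<lambda>r. phi (a k) (X k r))) \<longlonglongrightarrow> integral {0..t} (\<lambda>r. 1 / x r)" if "0 \<le> t" for t
  proof -
    have "integral {0..t} (\<lambda>r. 1 / max (x r) 0) = integral {0..t} (\<lambda>r. 1 / x r)"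
      by (intro integral_cong) (simp add: x0 max_absorb1)
    then show ?thesis using main[OF that] by (simp add: P_def[abs_def])
  qed
qed

section \<open>Gaussian increments\<close>

text \<open>For a sub-sigma-algebra \<open>G\<close> of \<open>M\<close> this encodes that
  \<open>V\<close> is centred normal with variance \<open>h\<close> and independent of
  \<open>G\<close>, in the form in which \<open>planar_BM\<close> provides it. The value
  \<open>h = 0\<close> is allowed and serves the degenerate sum of the two noises.\<close>

definition conditionally_gaussian :: "'a measure \<Rightarrow> 'a measure \<Rightarrow> real \<Rightarrow> ('a \<Rightarrow> real) \<Rightarrow> bool" where
  "conditionally_gaussian M G h V \<longleftrightarrow> (\<forall>u. \<forall>A\<in>sets G.
     (\<integral>\<omega>. indicator A \<omega> * exp (\<i> * complex_of_real (u * V \<omega>)) \<partial>M)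
        = complex_of_real (measure M A * exp (- h * u\<^sup>2 / 2)))"

lemma conditionally_gaussianD:
  "conditionally_gaussian M G h V \<Longrightarrow> A \<in> sets G \<Longrightarrow>
     (\<integral>\<omega>. indicator A \<omega> * exp (\<i> * complex_of_real (u * V \<omega>)) \<partial>M)
        = complex_of_real (measure M A * exp (- h * u\<^sup>2 / 2))"
  by (simp add: conditionally_gaussian_def)

context prob_space
begin

text \<open>Conditioning on \<open>A\<close> means passing to \<open>uniform_measure M A\<close>.
  The hypothesis gives the characteristic function of \<open>V\<close> under that measure, and
  Levy's uniqueness theorem identifies the law; a null set \<open>A\<close> is treated
  apart.\<close>

lemma conditional_std_normal:
  fixes V :: "'a \<Rightarrow> real"
  assumes V[measurable]: "V \<in> borel_measurable M" and A[measurable]: "A \<in> events" and E[measurable]: "E \<in> sets borel"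
    and char: "\<And>u. (\<integral>\<omega>. indicator A \<omega> * exp (\<i> * complex_of_real (u * V \<omega>)) \<partial>M)
        = complex_of_real (prob A * exp (- 1 * u\<^sup>2 / 2))"
  shows "prob (A \<inter> (V -` E \<inter> space M)) = prob A * measure std_normal_distribution E"
proof (cases "prob A = 0")
  case True
  then have "prob (A \<inter> (V -` E \<inter> space M)) = 0"
    by (metis A finite_measure_mono inf_le1 measure_nonneg order_antisym)
  then show ?thesis using True by simp
next
  case False
  then have pos: "0 < prob A" by (simp add: zero_less_measure_iff)
  let ?U = "uniform_measure M A"
  interpret U: prob_space ?U
    by (rule prob_space_uniform_measure) (use pos in \<open>auto simp: emeasure_eq_measure\<close>)
  have Ueq: "?U = density M (\<lambda>x. ennreal (indicator A x / prob A))"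
    unfolding uniform_measure_def
    by (intro density_cong) (auto simp: emeasure_eq_measure pos divide_ennreal[symmetric] ennreal_indicator)
  have [measurable]: "V \<in> borel_measurable ?U" using V by (simp add: uniform_measure_def)
  have rd: "real_distribution (distr ?U borel V)" by (rule U.real_distribution_distr) simp
  have "distr ?U borel V = std_normal_distribution"
  proof (rule Levy_uniqueness[OF rd real_dist_normal_dist])
    show "char (distr ?U borel V) = char std_normal_distribution"
    proof
      fix u
      have "char (distr ?U borel V) u = (\<integral>\<omega>. exp (\<i> * complex_of_real (u * V \<omega>)) \<partial>?U)"
        unfolding char_def by (subst integral_distr) auto
      also have "\<dots> = (\<integral>\<omega>. (indicator A \<omega> / prob A) *\<^sub>R exp (\<i> * complex_of_real (u * V \<omega>)) \<partial>M)"
        unfolding Ueq by (subst integral_density) (auto)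
      also have "\<dots> = (\<integral>\<omega>. complex_of_real (1 / prob A) * (indicator A \<omega> * exp (\<i> * complex_of_real (u * V \<omega>))) \<partial>M)"
        by (intro Bochner_Integration.integral_cong) (auto simp: scaleR_conv_of_real indicator_def)
      also have "\<dots> = complex_of_real (1 / prob A) * complex_of_real (prob A * exp (- 1 * u\<^sup>2 / 2))"
        by (simp only: integral_mult_right_zero char)
      also have "\<dots> = char std_normal_distribution u"
        unfolding char_std_normal_distribution using False by simp
      finally show "char (distr ?U borel V) u = char std_normal_distribution u" .
    qed
  qed
  then have "measure std_normal_distribution E = measure ?U (V -` E \<inter> space M)"
    by (metis E \<open>V \<in> borel_measurable ?U\<close> measure_distr space_uniform_measure)
  also have "\<dots> = prob (A \<inter> (V -` E \<inter> space M)) / prob A"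
    by (rule measure_uniform_measure) (use pos in \<open>auto simp: emeasure_eq_measure\<close>)
  finally show ?thesis using False by simp
qed

text \<open>The factorisation above, applied to the whole space, gives the law of \<open>V\<close>;
  applied to the events generated by \<eta>, it gives independence.\<close>

lemma std_normal_independent:
  fixes V \<eta> :: "'a \<Rightarrow> real"
  assumes V: "V \<in> borel_measurable M"
    and G: "space G = space M" "sets G \<subseteq> events"
    and char: "conditionally_gaussian M G 1 V"
    and \<eta>: "\<eta> \<in> borel_measurable G"
  shows "indep_var borel \<eta> borel V" and "distr M borel V = std_normal_distribution"
proof -
  have \<eta>M: "\<eta> \<in> borel_measurable M" using \<eta> G by (intro measurable_from_subalg[of M G]) (auto simp: subalgebra_def)
  have sp: "space M \<in> sets G" using G(1) sets.top[of G] by simp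
  have PV: "prob (V -` E \<inter> space M) = measure std_normal_distribution E" if "E \<in> sets borel" for E
  proof -
    have "prob (space M \<inter> (V -` E \<inter> space M)) = prob (space M) * measure std_normal_distribution E"
      by (rule conditional_std_normal[OF V _ that conditionally_gaussianD[OF char sp]]) simp
    moreover have "space M \<inter> (V -` E \<inter> space M) = V -` E \<inter> space M" by auto
    ultimately show ?thesis by (simp add: prob_space)
  qed
  show "distr M borel V = std_normal_distribution"
  proof (rule measure_eqI)
    interpret N: real_distribution std_normal_distribution by (rule real_dist_normal_dist)
    fix E assume "E \<in> sets (distr M borel V)"
    then have E: "E \<in> sets borel" by simp
    show "emeasure (distr M borel V) E = emeasure std_normal_distribution E"
      using V E PV[OF E] by (simp add: emeasure_distr emeasure_eq_measure N.emeasure_eq_measure)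
  qed simp
  show "indep_var borel \<eta> borel V"
    unfolding indep_var_eq
  proof (intro conjI \<eta>M V indep_setI)
    have gen: "sigma_sets (space M) {f -` A \<inter> space M |A. A \<in> sets borel} = {f -` A \<inter> space M |A. A \<in> sets borel}"
      for f :: "'a \<Rightarrow> real"
      using sets.sigma_sets_eq[of "vimage_algebra (space M) f borel"] by (simp add: sets_vimage_algebra2)
    show "sigma_sets (space M) {\<eta> -` A \<inter> space M |A. A \<in> sets borel} \<subseteq> events"
      "sigma_sets (space M) {V -` A \<inter> space M |A. A \<in> sets borel} \<subseteq> events"
      unfolding gen using \<eta>M V by (auto intro: measurable_sets)
    fix a b assume "a \<in> sigma_sets (space M) {\<eta> -` A \<inter> space M |A. A \<in> sets borel}"
      "b \<in> sigma_sets (space M) {V -` A \<inter> space M |A. A \<in> sets borel}"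
    then obtain D E where DE: "a = \<eta> -` D \<inter> space M" "b = V -` E \<inter> space M" "D \<in> sets borel" "E \<in> sets borel"
      unfolding gen by auto
    have aG: "a \<in> sets G" using measurable_sets[OF \<eta> DE(3)] DE(1) G(1) by simp
    have "prob (a \<inter> (V -` E \<inter> space M)) = prob a * measure std_normal_distribution E"
      by (rule conditional_std_normal[OF V _ DE(4) conditionally_gaussianD[OF char aG]]) (use aG G in auto)
    then show "prob (a \<inter> b) = prob a * prob b" using PV[OF DE(4)] DE(2) by simp
  qed
qed

text \<open>After division by \<open>sqrt h\<close> everything reduces to standard normal moments.
  The last two clauses are the martingale property and the variance of an increment, tested against
  bounded \<open>G\<close>-measurable weights; they stand in for the Ito calculus.\<close>

lemma gaussian_moments:
  fixes V :: "'a \<Rightarrow> real"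
  assumes V[measurable]: "V \<in> borel_measurable M" and h: "0 < h"
    and G: "space G = space M" "sets G \<subseteq> events"
    and char: "conditionally_gaussian M G h V"
  shows "distr M borel (\<lambda>\<omega>. V \<omega> / sqrt h) = std_normal_distribution"
    and "integrable M (\<lambda>\<omega>. \<bar>V \<omega>\<bar> ^ k)"
    and "(\<integral>\<omega>. \<bar>V \<omega>\<bar> \<partial>M) = sqrt (2 / pi) * sqrt h"
    and "(\<integral>\<omega>. \<bar>V \<omega>\<bar> ^ 3 \<partial>M) = 2 * sqrt (2 / pi) * (h * sqrt h)"
    and "\<And>\<eta> K. \<eta> \<in> borel_measurable G \<Longrightarrow> (\<And>\<omega>. \<omega> \<in> space M \<Longrightarrow> \<bar>\<eta> \<omega>\<bar> \<le> K) \<Longrightarrow> (\<integral>\<omega>. \<eta> \<omega> * V \<omega> \<partial>M) = 0"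
    and "\<And>\<eta> K. \<eta> \<in> borel_measurable G \<Longrightarrow> (\<And>\<omega>. \<omega> \<in> space M \<Longrightarrow> \<bar>\<eta> \<omega>\<bar> \<le> K) \<Longrightarrow>
       (\<integral>\<omega>. \<eta> \<omega> * (V \<omega>)\<^sup>2 \<partial>M) = h * (\<integral>\<omega>. \<eta> \<omega> \<partial>M)"
proof -
  define U where "U \<omega> = V \<omega> / sqrt h" for \<omega>
  have U[measurable]: "U \<in> borel_measurable M" unfolding U_def by measurable
  have VU: "V \<omega> = sqrt h * U \<omega>" for \<omega> using h by (simp add: U_def)
  have charU: "conditionally_gaussian M G 1 U"
    unfolding conditionally_gaussian_def
  proof (intro allI ballI)
    fix u A assume A: "A \<in> sets G"
    have "u / sqrt h * V \<omega> = u * U \<omega>" for \<omega> by (simp add: U_def)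
    moreover have "- h * (u / sqrt h)\<^sup>2 / 2 = - 1 * u\<^sup>2 / 2" using h by (simp add: power_divide)
    ultimately show "(\<integral>\<omega>. indicator A \<omega> * exp (\<i> * complex_of_real (u * U \<omega>)) \<partial>M)
        = complex_of_real (prob A * exp (- 1 * u\<^sup>2 / 2))"
      using conditionally_gaussianD[OF char A, of "u / sqrt h"] by (simp only:)
  qed
  note ind = std_normal_independent[OF U G charU]
  have d: "distr M borel U = std_normal_distribution" by (rule ind(2)[of "\<lambda>_. 0"]) auto
  then show "distr M borel (\<lambda>\<omega>. V \<omega> / sqrt h) = std_normal_distribution" by (simp add: U_def[abs_def])
  have dU: "(\<integral>\<omega>. f (U \<omega>) \<partial>M) = (\<integral>x. std_normal_density x * f x \<partial>lborel)"
    and dI: "integrable M (\<lambda>\<omega>. f (U \<omega>)) \<longleftrightarrow> integrable lborel (\<lambda>x. std_normal_density x * f x)"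
    if [measurable]: "f \<in> borel_measurable borel" for f :: "real \<Rightarrow> real"
  proof -
    have "(\<integral>\<omega>. f (U \<omega>) \<partial>M) = (\<integral>x. f x \<partial>std_normal_distribution)" unfolding d[symmetric] by (subst integral_distr) auto
    also have "\<dots> = (\<integral>x. std_normal_density x * f x \<partial>lborel)" by (subst integral_density) auto
    finally show "(\<integral>\<omega>. f (U \<omega>) \<partial>M) = (\<integral>x. std_normal_density x * f x \<partial>lborel)" .
    have "integrable M (\<lambda>\<omega>. f (U \<omega>)) \<longleftrightarrow> integrable std_normal_distribution f" unfolding d[symmetric] by (subst integrable_distr_eq) auto
    also have "\<dots> \<longleftrightarrow> integrable lborel (\<lambda>x. std_normal_density x * f x)" by (subst integrable_density) auto
    finally show "integrable M (\<lambda>\<omega>. f (U \<omega>)) \<longleftrightarrow> integrable lborel (\<lambda>x. std_normal_density x * f x)" .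
  qed
  have iU: "integrable M (\<lambda>\<omega>. \<bar>U \<omega>\<bar> ^ k)" "integrable M (\<lambda>\<omega>. U \<omega> ^ k)" for k
    using dI[of "\<lambda>x. \<bar>x\<bar> ^ k"] integrable_std_normal_moment_abs[of k] dI[of "\<lambda>x. x ^ k"] integrable_std_normal_moment[of k] by auto
  show "integrable M (\<lambda>\<omega>. \<bar>V \<omega>\<bar> ^ k)"
    unfolding VU using h iU(1)[of k] by (simp add: abs_mult power_mult_distrib)
  show "(\<integral>\<omega>. \<bar>V \<omega>\<bar> \<partial>M) = sqrt (2 / pi) * sqrt h"
    unfolding VU using h dU[of "\<lambda>x. \<bar>x\<bar>"] integral_std_normal_moment_abs_odd[of 0] by (simp add: abs_mult)
  have s3: "sqrt h ^ 3 = h * sqrt h" using h by (simp add: power3_eq_cube)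
  show "(\<integral>\<omega>. \<bar>V \<omega>\<bar> ^ 3 \<partial>M) = 2 * sqrt (2 / pi) * (h * sqrt h)"
    unfolding VU using h dU[of "\<lambda>x. \<bar>x\<bar> ^ 3"] integral_std_normal_moment_abs_odd[of 1]
    by (simp add: abs_mult power_mult_distrib s3 numeral_3_eq_3[symmetric])
  fix \<eta> :: "'a \<Rightarrow> real" and K assume \<eta>: "\<eta> \<in> borel_measurable G" and b: "\<And>\<omega>. \<omega> \<in> space M \<Longrightarrow> \<bar>\<eta> \<omega>\<bar> \<le> K"
  have \<eta>M[measurable]: "\<eta> \<in> borel_measurable M" using \<eta> G by (intro measurable_from_subalg[of M G]) (auto simp: subalgebra_def)
  have i\<eta>: "integrable M \<eta>" by (rule integrable_const_bound[of _ K]) (use b in auto)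
  have EU: "(\<integral>\<omega>. U \<omega> \<partial>M) = 0" "(\<integral>\<omega>. (U \<omega>)\<^sup>2 \<partial>M) = 1"
    using dU[of "\<lambda>x. x"] integral_std_normal_moment_odd[of 0] dU[of "\<lambda>x. x\<^sup>2"] integral_std_normal_moment_even[of 1] by auto
  have "(\<integral>\<omega>. \<eta> \<omega> * U \<omega> \<partial>M) = 0"
    using indep_var_lebesgue_integral[OF ind(1)[OF \<eta>] i\<eta>] iU(2)[of 1] EU by simp
  then show "(\<integral>\<omega>. \<eta> \<omega> * V \<omega> \<partial>M) = 0" unfolding VU by (simp add: mult.left_commute)
  have "indep_var borel ((\<lambda>x. x) \<circ> \<eta>) borel ((\<lambda>x. x\<^sup>2) \<circ> U)"
    by (rule indep_var_compose[OF ind(1)[OF \<eta>]]) auto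
  then have "indep_var borel \<eta> borel (\<lambda>\<omega>. (U \<omega>)\<^sup>2)" by (simp add: o_def)
  from indep_var_lebesgue_integral[OF this i\<eta>] have "(\<integral>\<omega>. \<eta> \<omega> * (U \<omega>)\<^sup>2 \<partial>M) = (\<integral>\<omega>. \<eta> \<omega> \<partial>M)"
    using iU(2)[of 2] EU by simp
  then show "(\<integral>\<omega>. \<eta> \<omega> * (V \<omega>)\<^sup>2 \<partial>M) = h * (\<integral>\<omega>. \<eta> \<omega> \<partial>M)"
    unfolding VU using h by (simp add: power_mult_distrib mult.left_commute)
qed


text \<open>One cell of a partition: the increment is noise \<open>V\<close> plus a drift
  \<open>D\<close> of order \<open>h\<close>. In expectation the term linear in \<open>V\<close>
  vanishes and the square of \<open>V\<close> may be replaced by \<open>h\<close>. The mixed term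
  and the cubic remainder are of order \<open>h * sqrt h\<close>, still negligible after summing
  about \<open>1 / h\<close> cells.\<close>

lemma taylor_step_expectation:
  fixes V D z \<eta> :: "'a \<Rightarrow> real" and g g1 g2 :: "real \<Rightarrow> real"
  assumes V[measurable]: "V \<in> borel_measurable M" and h: "0 < h"
    and G: "space G = space M" "sets G \<subseteq> events"
    and char: "conditionally_gaussian M G h V"
    and D[measurable]: "D \<in> borel_measurable M" and Db: "\<And>\<omega>. \<omega> \<in> space M \<Longrightarrow> \<bar>D \<omega>\<bar> \<le> K * h"
    and z: "z \<in> borel_measurable G" and A: "A \<in> sets G"
    and g[measurable]: "g \<in> borel_measurable borel" "g1 \<in> borel_measurable borel" "g2 \<in> borel_measurable borel"
    and gb: "\<And>x. \<bar>g1 x\<bar> \<le> K1" "\<And>x. \<bar>g2 x\<bar> \<le> K2"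
    and taylor: "\<And>x d. \<bar>g (x + d) - g x - g1 x * d - g2 x * d\<^sup>2 / 2\<bar> \<le> L * \<bar>d\<bar> ^ 3"
    and nonneg: "0 \<le> K" "0 \<le> L"
  defines "r \<equiv> \<lambda>\<omega>. indicator A \<omega> * (g (z \<omega> + (V \<omega> + D \<omega>)) - g (z \<omega>) - g1 (z \<omega>) * D \<omega> - g2 (z \<omega>) / 2 * h)"
  shows "integrable M r"
    and "\<bar>\<integral>\<omega>. r \<omega> \<partial>M\<bar> \<le> 4 * L * (2 * sqrt (2 / pi) * (h * sqrt h) + (K * h) ^ 3)
        + K2 / 2 * (2 * K * h * (sqrt (2 / pi) * sqrt h) + (K * h)\<^sup>2)"
proof -
  note mom = gaussian_moments[OF V h G char]
  have sub: "f \<in> borel_measurable M" if "f \<in> borel_measurable G" for f :: "'a \<Rightarrow> real"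
    using that G by (intro measurable_from_subalg[of M G]) (auto simp: subalgebra_def)
  have zM[measurable]: "z \<in> borel_measurable M" by (rule sub[OF z])
  have AM[measurable]: "A \<in> events" using A G by auto
  have K2: "0 \<le> K2" using gb(2)[of 0] by linarith
  let ?a = "\<lambda>\<omega>. indicator A \<omega> * g1 (z \<omega>)" and ?b = "\<lambda>\<omega>. indicator A \<omega> * g2 (z \<omega>) / 2"
  have abG: "?a \<in> borel_measurable G" "?b \<in> borel_measurable G" using z A by measurable
  have aB: "\<bar>?a \<omega>\<bar> \<le> K1" and bB: "\<bar>?b \<omega>\<bar> \<le> K2 / 2" for \<omega>
    using gb(1)[of "z \<omega>"] gb(2)[of "z \<omega>"] by (auto simp: indicator_def)
  note [measurable] = sub[OF abG(1)] sub[OF abG(2)]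
  have iV: "integrable M V" using mom(2)[of 1] by (simp add: integrable_abs_iff)
  have iV2: "integrable M (\<lambda>\<omega>. (V \<omega>)\<^sup>2)" using mom(2)[of 2] by simp
  have prod: "integrable M (\<lambda>\<omega>. u \<omega> * w \<omega>)"
    if [measurable]: "u \<in> borel_measurable M" and u: "\<And>\<omega>. \<bar>u \<omega>\<bar> \<le> c" and w: "integrable M w"
    for u w :: "'a \<Rightarrow> real" and c
  proof (rule Bochner_Integration.integrable_bound[OF integrable_mult_right[OF w, of c]])
    show "(\<lambda>\<omega>. u \<omega> * w \<omega>) \<in> borel_measurable M" using w by measurable
    show "AE \<omega> in M. norm (u \<omega> * w \<omega>) \<le> norm (c * w \<omega>)"
      unfolding real_norm_def abs_mult by (intro AE_I2 mult_right_mono order_trans[OF u abs_ge_self] abs_ge_zero)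
  qed
  have i1: "integrable M (\<lambda>\<omega>. ?a \<omega> * V \<omega>)" by (rule prod[OF _ aB iV]) measurable
  have i2: "integrable M (\<lambda>\<omega>. ?b \<omega> * (V \<omega>)\<^sup>2)" by (rule prod[OF _ bB iV2]) measurable
  have i3: "integrable M ?b" by (rule integrable_const_bound[of _ "K2 / 2"]) (use bB in auto)
  \<comment> \<open>Removes from \<open>r\<close> the two mean-zero terms \<open>?a * V\<close> and
    \<open>?b * (V\<^sup>2 - h)\<close>. Unlike \<open>r\<close> itself, the rest is small in
    absolute value.\<close>
  define R where "R \<omega> = r \<omega> - ?a \<omega> * V \<omega> - ?b \<omega> * (V \<omega>)\<^sup>2 + h * ?b \<omega>" for \<omega>
  define H where "H \<omega> = 4 * L * (\<bar>V \<omega>\<bar> ^ 3 + (K * h) ^ 3) + K2 / 2 * (2 * K * h * \<bar>V \<omega>\<bar> + (K * h)\<^sup>2)" for \<omega>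
  have iH: "integrable M H" unfolding H_def using mom(2)[of 3] iV by (auto intro!: integrable_abs)
  have rM[measurable]: "r \<in> borel_measurable M" unfolding r_def by measurable
  have RM[measurable]: "R \<in> borel_measurable M" unfolding R_def by measurable
  have RH: "\<bar>R \<omega>\<bar> \<le> H \<omega>" if \<omega>: "\<omega> \<in> space M" for \<omega>
  proof -
    let ?d = "V \<omega> + D \<omega>"
    have 1: "R \<omega> = indicator A \<omega> * (g (z \<omega> + ?d) - g (z \<omega>) - g1 (z \<omega>) * ?d - g2 (z \<omega>) * ?d\<^sup>2 / 2)
       + ?b \<omega> * (2 * V \<omega> * D \<omega> + (D \<omega>)\<^sup>2)"
      unfolding R_def r_def by (simp add: field_simps power2_eq_square)
    have Dh: "\<bar>D \<omega>\<bar> \<le> K * h" by (rule Db[OF \<omega>])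
    have "\<bar>?d\<bar> ^ 3 \<le> (\<bar>V \<omega>\<bar> + K * h) ^ 3" using Dh by (intro power_mono) auto
    also have "\<dots> \<le> 4 * (\<bar>V \<omega>\<bar> ^ 3 + (K * h) ^ 3)"
    proof -
      have "(a + b) ^ 3 \<le> 4 * (a ^ 3 + b ^ 3)" if "0 \<le> a" "0 \<le> b" for a b :: real
      proof -
        have "4 * (a ^ 3 + b ^ 3) - (a + b) ^ 3 = 3 * (a + b) * (a - b)\<^sup>2"
          by (simp add: power3_eq_cube power2_eq_square algebra_simps)
        also have "\<dots> \<ge> 0" using that by simp
        finally show ?thesis by simp
      qed
      then show ?thesis using nonneg h by simp
    qed
    finally have "L * \<bar>?d\<bar> ^ 3 \<le> L * (4 * (\<bar>V \<omega>\<bar> ^ 3 + (K * h) ^ 3))"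
      by (rule mult_left_mono[OF _ nonneg(2)])
    then have "L * \<bar>?d\<bar> ^ 3 \<le> 4 * L * (\<bar>V \<omega>\<bar> ^ 3 + (K * h) ^ 3)" by (simp only: mult_ac)
    with taylor[of "z \<omega>" ?d] have t: "\<bar>g (z \<omega> + ?d) - g (z \<omega>) - g1 (z \<omega>) * ?d - g2 (z \<omega>) * ?d\<^sup>2 / 2\<bar> \<le> 4 * L * (\<bar>V \<omega>\<bar> ^ 3 + (K * h) ^ 3)"
      by linarith
    have 2: "\<bar>indicator A \<omega> * (g (z \<omega> + ?d) - g (z \<omega>) - g1 (z \<omega>) * ?d - g2 (z \<omega>) * ?d\<^sup>2 / 2)\<bar> \<le> 4 * L * (\<bar>V \<omega>\<bar> ^ 3 + (K * h) ^ 3)"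
      using order_trans[OF abs_ge_zero t] t by (auto simp: indicator_def)
    have "\<bar>2 * V \<omega> * D \<omega> + (D \<omega>)\<^sup>2\<bar> \<le> 2 * \<bar>V \<omega>\<bar> * \<bar>D \<omega>\<bar> + \<bar>D \<omega>\<bar>\<^sup>2"
      by (rule order_trans[OF abs_triangle_ineq]) (simp add: abs_mult)
    also have "\<dots> \<le> 2 * \<bar>V \<omega>\<bar> * (K * h) + (K * h)\<^sup>2" using Dh by (intro add_mono mult_left_mono power_mono) auto
    finally have "\<bar>2 * V \<omega> * D \<omega> + (D \<omega>)\<^sup>2\<bar> \<le> 2 * K * h * \<bar>V \<omega>\<bar> + (K * h)\<^sup>2" by (simp add: mult_ac)
    then have "\<bar>?b \<omega>\<bar> * \<bar>2 * V \<omega> * D \<omega> + (D \<omega>)\<^sup>2\<bar> \<le> K2 / 2 * (2 * K * h * \<bar>V \<omega>\<bar> + (K * h)\<^sup>2)"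
      using bB[of \<omega>] K2 by (intro mult_mono) auto
    then have 3: "\<bar>?b \<omega> * (2 * V \<omega> * D \<omega> + (D \<omega>)\<^sup>2)\<bar> \<le> K2 / 2 * (2 * K * h * \<bar>V \<omega>\<bar> + (K * h)\<^sup>2)"
      by (simp only: abs_mult)
    show ?thesis unfolding 1 H_def by (rule order_trans[OF abs_triangle_ineq add_mono[OF 2 3]])
  qed
  have iR: "integrable M R" by (rule Bochner_Integration.integrable_bound[OF iH]) (use RH in \<open>auto intro!: AE_I2 order_trans[OF RH]\<close>)
  have rR: "r \<omega> = R \<omega> + ?a \<omega> * V \<omega> + ?b \<omega> * (V \<omega>)\<^sup>2 - h * ?b \<omega>" for \<omega> unfolding R_def by simp
  have hb: "integrable M (\<lambda>\<omega>. h * ?b \<omega>)" by (rule integrable_mult_right[OF i3])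
  have "integrable M (\<lambda>\<omega>. R \<omega> + ?a \<omega> * V \<omega> + ?b \<omega> * (V \<omega>)\<^sup>2 - h * ?b \<omega>)"
    by (intro Bochner_Integration.integrable_diff Bochner_Integration.integrable_add iR i1 i2 hb)
  then show "integrable M r" unfolding rR[abs_def, symmetric] .
  have "(\<integral>\<omega>. r \<omega> \<partial>M) = (\<integral>\<omega>. R \<omega> \<partial>M) + (\<integral>\<omega>. ?a \<omega> * V \<omega> \<partial>M) + (\<integral>\<omega>. ?b \<omega> * (V \<omega>)\<^sup>2 \<partial>M) - (\<integral>\<omega>. h * ?b \<omega> \<partial>M)"
    unfolding rR by (simp only: Bochner_Integration.integral_diff[OF Bochner_Integration.integrable_add[OF Bochner_Integration.integrable_add[OF iR i1] i2] hb]
      Bochner_Integration.integral_add[OF Bochner_Integration.integrable_add[OF iR i1] i2] Bochner_Integration.integral_add[OF iR i1])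
  also have "(\<integral>\<omega>. ?a \<omega> * V \<omega> \<partial>M) = 0" by (rule mom(5)[OF abG(1) aB])
  also have "(\<integral>\<omega>. ?b \<omega> * (V \<omega>)\<^sup>2 \<partial>M) = h * (\<integral>\<omega>. ?b \<omega> \<partial>M)" by (rule mom(6)[OF abG(2) bB])
  also have "(\<integral>\<omega>. h * ?b \<omega> \<partial>M) = h * (\<integral>\<omega>. ?b \<omega> \<partial>M)" by (rule integral_mult_right_zero)
  finally have "(\<integral>\<omega>. r \<omega> \<partial>M) = (\<integral>\<omega>. R \<omega> \<partial>M)" by simp
  also have "\<bar>\<dots>\<bar> \<le> (\<integral>\<omega>. \<bar>R \<omega>\<bar> \<partial>M)" by (rule integral_abs_bound)
  also have "\<dots> \<le> (\<integral>\<omega>. H \<omega> \<partial>M)" by (rule integral_mono[OF integrable_abs[OF iR] iH RH])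
  also have "\<dots> = 4 * L * (2 * sqrt (2 / pi) * (h * sqrt h) + (K * h) ^ 3)
        + K2 / 2 * (2 * K * h * (sqrt (2 / pi) * sqrt h) + (K * h)\<^sup>2)"
    unfolding H_def using mom(2)[of 3] mom(2)[of 1] by (simp add: mom(3,4) prob_space)
  finally show "\<bar>\<integral>\<omega>. r \<omega> \<partial>M\<bar> \<le> 4 * L * (2 * sqrt (2 / pi) * (h * sqrt h) + (K * h) ^ 3)
        + K2 / 2 * (2 * K * h * (sqrt (2 / pi) * sqrt h) + (K * h)\<^sup>2)" .
qed

end

section \<open>Dynkin's formula\<close>

locale filtered_prob_space = prob_space M for M :: "'a measure" +
  fixes F :: "real \<Rightarrow> 'a measure"
  assumes space_F: "space (F t) = space M"
    and sets_F: "sets (F t) \<subseteq> sets M"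
    and mono_F: "0 \<le> s \<Longrightarrow> s \<le> t \<Longrightarrow> sets (F s) \<subseteq> sets (F t)"
begin

lemma measurable_F_mono: "0 \<le> s \<Longrightarrow> s \<le> t \<Longrightarrow> f \<in> borel_measurable (F s) \<Longrightarrow> f \<in> borel_measurable (F t)"
  by (rule measurable_from_subalg[of "F t" "F s"]) (auto simp: subalgebra_def space_F dest: mono_F[THEN subsetD])

lemma measurable_F_M: "f \<in> borel_measurable (F t) \<Longrightarrow> f \<in> borel_measurable M"
  by (rule measurable_from_subalg[of M "F t"]) (use sets_F in \<open>auto simp: subalgebra_def space_F\<close>)

text \<open>Over \<open>N\<close> cells the one-step errors add up to order
  \<open>1 / sqrt N\<close>, while the drift terms form Riemann-Stieltjes sums converging boundedly.
  Only the difference \<open>g (Z T) - g (Z 0)\<close> is averaged, so \<open>Z 0\<close> needs no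
  moments; the set \<open>A\<close> in \<open>F 0\<close> permits restriction by the initial
  value.\<close>

lemma dynkin_formula:
  fixes W Z a :: "real \<Rightarrow> 'a \<Rightarrow> real" and g g1 g2 :: "real \<Rightarrow> real"
  assumes T: "0 < T"
    and W: "\<And>t. 0 \<le> t \<Longrightarrow> W t \<in> borel_measurable (F t)"
    and Wg: "\<And>s t. 0 \<le> s \<Longrightarrow> s < t \<Longrightarrow> conditionally_gaussian M (F s) (t - s) (\<lambda>\<omega>. W t \<omega> - W s \<omega>)"
    and Z: "\<And>t. 0 \<le> t \<Longrightarrow> Z t \<in> borel_measurable (F t)"
    and Zeq: "\<And>\<omega> t. \<omega> \<in> space M \<Longrightarrow> 0 \<le> t \<Longrightarrow> Z t \<omega> = Z 0 \<omega> + (W t \<omega> - W 0 \<omega>) + integral {0..t} (\<lambda>s. a s \<omega>)"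
    and Zc: "\<And>\<omega>. \<omega> \<in> space M \<Longrightarrow> continuous_on {0..} (\<lambda>s. Z s \<omega>)"
    and ac: "\<And>\<omega>. \<omega> \<in> space M \<Longrightarrow> continuous_on {0..} (\<lambda>s. a s \<omega>)"
    and ab: "\<And>\<omega> s. \<omega> \<in> space M \<Longrightarrow> 0 \<le> s \<Longrightarrow> \<bar>a s \<omega>\<bar> \<le> K"
    and gc: "continuous_on UNIV g" "continuous_on UNIV g1" "continuous_on UNIV g2"
    and gb: "\<And>x. \<bar>g1 x\<bar> \<le> K1" "\<And>x. \<bar>g2 x\<bar> \<le> K2"
    and taylor: "\<And>x d. \<bar>g (x + d) - g x - g1 x * d - g2 x * d\<^sup>2 / 2\<bar> \<le> L * \<bar>d\<bar> ^ 3"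
    and A: "A \<in> sets (F 0)"
  shows "integrable M (\<lambda>\<omega>. indicator A \<omega> * (g (Z T \<omega>) - g (Z 0 \<omega>)))" (is "integrable M ?Q")
    and "integrable M (\<lambda>\<omega>. indicator A \<omega> * integral {0..T} (\<lambda>s. g1 (Z s \<omega>) * a s \<omega> + g2 (Z s \<omega>) / 2))" (is "integrable M ?I")
    and "(\<integral>\<omega>. indicator A \<omega> * (g (Z T \<omega>) - g (Z 0 \<omega>)) \<partial>M)
      = (\<integral>\<omega>. indicator A \<omega> * integral {0..T} (\<lambda>s. g1 (Z s \<omega>) * a s \<omega> + g2 (Z s \<omega>) / 2) \<partial>M)"
proof -
  have gm[measurable]: "g \<in> borel_measurable borel" "g1 \<in> borel_measurable borel" "g2 \<in> borel_measurable borel"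
    using gc by (auto intro: borel_measurable_continuous_onI)
  have AM[measurable]: "A \<in> events" using A sets_F by auto
  obtain \<omega>0 where \<omega>0: "\<omega>0 \<in> space M" using not_empty by blast
  have K: "0 \<le> K" using ab[OF \<omega>0, of 0] by simp
  have K12: "0 \<le> K1" "0 \<le> K2" using gb[of 0] by linarith+
  have L: "0 \<le> L" using taylor[of 0 1] by simp
  have abs_sum: "\<bar>\<Sum>i<N. f i\<bar> \<le> real N * c" if "\<And>i. \<bar>f i\<bar> \<le> c" for f :: "nat \<Rightarrow> real" and c N
    using order_trans[OF sum_abs sum_bounded_above[of "{..<N}" "\<lambda>i. \<bar>f i\<bar>" c]] that by simp
  let ?t = "\<lambda>N i. T * real i / real N"
  have t0: "0 \<le> ?t N i" for N i using T by simp
  have tS: "?t N (Suc i) - ?t N i = T / real N" for N i by (simp add: diff_divide_distrib[symmetric] algebra_simps)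
  have tle: "?t N i \<le> ?t N (Suc i)" for N i using T by (intro divide_right_mono mult_left_mono) auto
  \<comment> \<open>Defined through increments to make measurability immediate; that it equals the
    integral of the drift is shown next.\<close>
  define D where "D N i \<omega> = (Z (?t N (Suc i)) \<omega> - Z (?t N i) \<omega>) - (W (?t N (Suc i)) \<omega> - W (?t N i) \<omega>)" for N i \<omega>
  have aint: "(\<lambda>s. a s \<omega>) integrable_on {0..t}" if "\<omega> \<in> space M" for \<omega> t
    by (rule integrable_continuous_interval[OF continuous_on_subset[OF ac[OF that]]]) auto
  have D: "D N i \<omega> = integral {?t N i..?t N (Suc i)} (\<lambda>s. a s \<omega>)" if "\<omega> \<in> space M" for N i \<omega>
    unfolding D_def using Zeq[OF that t0[of i N]] Zeq[OF that t0[of "Suc i" N]]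
      Henstock_Kurzweil_Integration.integral_combine[OF t0 tle aint[OF that], of i N] by linarith
  have Db: "\<bar>D N i \<omega>\<bar> \<le> K * (T / real N)" if \<omega>: "\<omega> \<in> space M" for N i \<omega>
  proof -
    have "(\<lambda>s. a s \<omega>) integrable_on {?t N i..?t N (Suc i)}"
      by (rule integrable_continuous_interval[OF continuous_on_subset[OF ac[OF \<omega>]]]) (use t0[of i N] in auto)
    then have "norm (integral {?t N i..?t N (Suc i)} (\<lambda>s. a s \<omega>)) \<le> integral {?t N i..?t N (Suc i)} (\<lambda>_. K)"
      by (rule integral_norm_bound_integral) (use ab[OF \<omega>] t0[of i N] in auto)
    also have "\<dots> = K * (T / real N)" using tle[of i N] tS[of i N] by simp
    finally show ?thesis using D[OF \<omega>] by simp
  qed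
  define S where "S N \<omega> = (\<Sum>i<N. g1 (Z (?t N i) \<omega>) * D N i \<omega>) + (\<Sum>i<N. g2 (Z (?t N i) \<omega>) / 2 * (T / real N))" for N \<omega>
  have WM[measurable]: "W (?t N i) \<in> borel_measurable M" and ZM[measurable]: "Z (?t N i) \<in> borel_measurable M" for N i
    using measurable_F_M[OF W[OF t0]] measurable_F_M[OF Z[OF t0]] by auto
  have DM[measurable]: "D N i \<in> borel_measurable M" for N i unfolding D_def by measurable
  have SM[measurable]: "S N \<in> borel_measurable M" for N unfolding S_def by measurable
  have Sb: "\<bar>S N \<omega>\<bar> \<le> K1 * K * T + K2 / 2 * T" if \<omega>: "\<omega> \<in> space M" for N \<omega>
  proof (cases "N = 0")
    case False
    have "\<bar>g1 (Z (?t N i) \<omega>) * D N i \<omega>\<bar> \<le> K1 * (K * (T / real N))" for i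
      unfolding abs_mult using gb(1) Db[OF \<omega>] K12 by (intro mult_mono) auto
    then have 1: "\<bar>\<Sum>i<N. g1 (Z (?t N i) \<omega>) * D N i \<omega>\<bar> \<le> real N * (K1 * (K * (T / real N)))"
      by (rule abs_sum)
    have "\<bar>g2 (Z (?t N i) \<omega>) / 2 * (T / real N)\<bar> \<le> K2 / 2 * (T / real N)" for i
      unfolding abs_mult using gb(2)[of "Z (?t N i) \<omega>"] T by (intro mult_mono) auto
    then have 2: "\<bar>\<Sum>i<N. g2 (Z (?t N i) \<omega>) / 2 * (T / real N)\<bar> \<le> real N * (K2 / 2 * (T / real N))"
      by (rule abs_sum)
    have "\<bar>S N \<omega>\<bar> \<le> real N * (K1 * (K * (T / real N))) + real N * (K2 / 2 * (T / real N))"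
      unfolding S_def by (rule order_trans[OF abs_triangle_ineq add_mono[OF 1 2]])
    then show ?thesis using False by simp
  qed (use K12 K T in \<open>simp add: S_def\<close>)
  define I where "I \<omega> = integral {0..T} (\<lambda>s. g1 (Z s \<omega>) * a s \<omega> + g2 (Z s \<omega>) / 2)" for \<omega>
  have SI: "(\<lambda>N. S N \<omega>) \<longlonglongrightarrow> I \<omega>" if \<omega>: "\<omega> \<in> space M" for \<omega>
  proof -
    have Zc': "continuous_on {0..T} (\<lambda>s. Z s \<omega>)" by (rule continuous_on_subset[OF Zc[OF \<omega>]]) auto
    have ac': "continuous_on {0..T} (\<lambda>s. a s \<omega>)" by (rule continuous_on_subset[OF ac[OF \<omega>]]) auto
    have c1: "continuous_on {0..T} (\<lambda>s. g1 (Z s \<omega>))" "continuous_on {0..T} (\<lambda>s. g2 (Z s \<omega>) / 2)"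
      by (auto intro!: continuous_intros continuous_on_compose2[OF gc(2) Zc'] continuous_on_compose2[OF gc(3) Zc'])
    have "(\<lambda>N. \<Sum>i<N. g1 (Z (?t N i) \<omega>) * integral {?t N i..?t N (Suc i)} (\<lambda>s. a s \<omega>)) \<longlonglongrightarrow> integral {0..T} (\<lambda>s. g1 (Z s \<omega>) * a s \<omega>)"
      by (rule riemann_stieltjes_sum_tendsto(2)[OF c1(1) absolutely_integrable_continuous_real[OF ac']]) (use T tle in auto)
    then have "(\<lambda>N. \<Sum>i<N. g1 (Z (?t N i) \<omega>) * D N i \<omega>) \<longlonglongrightarrow> integral {0..T} (\<lambda>s. g1 (Z s \<omega>) * a s \<omega>)"
      by (simp only: D[OF \<omega>])
    moreover have "(\<lambda>N. \<Sum>i<N. g2 (Z (?t N i) \<omega>) / 2 * (T / real N)) \<longlonglongrightarrow> integral {0..T} (\<lambda>s. g2 (Z s \<omega>) / 2)"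
      by (rule integral_tendsto_riemann[OF c1(2)]) (use T in simp)
    moreover have "I \<omega> = integral {0..T} (\<lambda>s. g1 (Z s \<omega>) * a s \<omega>) + integral {0..T} (\<lambda>s. g2 (Z s \<omega>) / 2)"
      unfolding I_def using c1 ac' by (intro integral_add integrable_continuous_interval continuous_on_mult)
    ultimately show ?thesis unfolding S_def by (auto intro: tendsto_add)
  qed
  have IM[measurable]: "I \<in> borel_measurable M" by (rule borel_measurable_LIMSEQ_real[OF SI SM])
  have Ib: "\<bar>I \<omega>\<bar> \<le> K1 * K * T + K2 / 2 * T" if "\<omega> \<in> space M" for \<omega>
    by (rule Lim_bounded[OF tendsto_rabs[OF SI[OF that]], of 0]) (use Sb[OF that] in auto)
  have indb: "\<bar>indicator A \<omega> * x\<bar> \<le> y" if "\<bar>x\<bar> \<le> y" for x y :: real and \<omega> :: 'a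
    using that by (auto simp: indicator_def)
  show iI: "integrable M ?I"
    unfolding I_def[symmetric]
    by (rule integrable_const_bound[of _ "K1 * K * T + K2 / 2 * T"]) (use Ib in \<open>auto intro!: AE_I2 indb\<close>)
  have lim1: "(\<lambda>N. \<integral>\<omega>. indicator A \<omega> * S N \<omega> \<partial>M) \<longlonglongrightarrow> (\<integral>\<omega>. indicator A \<omega> * I \<omega> \<partial>M)"
    by (rule integral_dominated_convergence[where w = "\<lambda>_. K1 * K * T + K2 / 2 * T"])
      (use Sb SI in \<open>auto intro!: AE_I2 indb tendsto_intros\<close>)
  define r where "r N i \<omega> = indicator A \<omega> * (g (Z (?t N i) \<omega> + ((W (?t N (Suc i)) \<omega> - W (?t N i) \<omega>) + D N i \<omega>)) - g (Z (?t N i) \<omega>)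
      - g1 (Z (?t N i) \<omega>) * D N i \<omega> - g2 (Z (?t N i) \<omega>) / 2 * (T / real N))" for N i \<omega>
  define b where "b h = 4 * L * (2 * sqrt (2 / pi) * (h * sqrt h) + (K * h) ^ 3)
        + K2 / 2 * (2 * K * h * (sqrt (2 / pi) * sqrt h) + (K * h)\<^sup>2)" for h
  have step: "integrable M (r N i)" "\<bar>\<integral>\<omega>. r N i \<omega> \<partial>M\<bar> \<le> b (T / real N)" if N: "0 < N" for N i
  proof -
    have lt: "?t N i < ?t N (Suc i)" using T N by (intro divide_strict_right_mono mult_strict_left_mono) auto
    have cg: "conditionally_gaussian M (F (?t N i)) (T / real N) (\<lambda>\<omega>. W (?t N (Suc i)) \<omega> - W (?t N i) \<omega>)"
      using Wg[OF t0 lt] unfolding tS .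
    have AF: "A \<in> sets (F (?t N i))" using A mono_F[of 0, OF _ t0] by auto
    have h: "0 < T / real N" using T N by simp
    have dM: "(\<lambda>\<omega>. W (?t N (Suc i)) \<omega> - W (?t N i) \<omega>) \<in> borel_measurable M" by measurable
    show "integrable M (r N i)" unfolding r_def
      by (rule taylor_step_expectation(1)[OF dM h space_F sets_F cg DM Db Z[OF t0] AF gm gb taylor K L])
    show "\<bar>\<integral>\<omega>. r N i \<omega> \<partial>M\<bar> \<le> b (T / real N)" unfolding r_def b_def
      by (rule taylor_step_expectation(2)[OF dM h space_F sets_F cg DM Db Z[OF t0] AF gm gb taylor K L])
  qed
  \<comment> \<open>An exact identity for every positive \<open>N\<close>: one-step errors and
    Riemann sums together telescope to the total increment.\<close>
  have tel: "?Q \<omega> = (\<Sum>i<N. r N i \<omega>) + indicator A \<omega> * S N \<omega>" if N: "0 < N" for N \<omega>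
  proof -
    have *: "Z (?t N i) \<omega> + ((W (?t N (Suc i)) \<omega> - W (?t N i) \<omega>) + D N i \<omega>) = Z (?t N (Suc i)) \<omega>" for i
      by (simp add: D_def)
    have ring: "c * (u - v - p - q) + c * (p + q) = c * (u - v)" for c u v p q :: real by (simp add: algebra_simps)
    have "(\<Sum>i<N. r N i \<omega>) + indicator A \<omega> * S N \<omega> = indicator A \<omega> * (\<Sum>i<N. g (Z (?t N (Suc i)) \<omega>) - g (Z (?t N i) \<omega>))"
      unfolding r_def S_def * sum_distrib_left[symmetric] sum_subtractf by (rule ring)
    also have "(\<Sum>i<N. g (Z (?t N (Suc i)) \<omega>) - g (Z (?t N i) \<omega>)) = g (Z (?t N N) \<omega>) - g (Z (?t N 0) \<omega>)"
      by (rule sum_lessThan_telescope)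
    finally show ?thesis using N by simp
  qed
  have iS: "integrable M (\<lambda>\<omega>. indicator A \<omega> * S N \<omega>)" for N
    by (rule integrable_const_bound[of _ "K1 * K * T + K2 / 2 * T"]) (use Sb in \<open>auto intro!: AE_I2 indb\<close>)
  show "integrable M ?Q"
    unfolding tel[of 1, simplified] using step(1)[of 1 0] iS[of 1] by simp
  have err: "\<bar>(\<integral>\<omega>. ?Q \<omega> \<partial>M) - (\<integral>\<omega>. indicator A \<omega> * S N \<omega> \<partial>M)\<bar> \<le> real N * b (T / real N)" if N: "0 < N" for N
  proof -
    have "(\<integral>\<omega>. ?Q \<omega> \<partial>M) = (\<Sum>i<N. \<integral>\<omega>. r N i \<omega> \<partial>M) + (\<integral>\<omega>. indicator A \<omega> * S N \<omega> \<partial>M)"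
      unfolding tel[OF N] using step(1)[OF N] iS
      by (subst Bochner_Integration.integral_add) (auto intro!: Bochner_Integration.integral_sum)
    then have "\<bar>(\<integral>\<omega>. ?Q \<omega> \<partial>M) - (\<integral>\<omega>. indicator A \<omega> * S N \<omega> \<partial>M)\<bar> = \<bar>\<Sum>i<N. \<integral>\<omega>. r N i \<omega> \<partial>M\<bar>" by simp
    also have "\<dots> \<le> real N * b (T / real N)"
      by (rule abs_sum[OF step(2)[OF N]])
    finally show ?thesis .
  qed
  \<comment> \<open>Every term of \<open>b h\<close> is of order \<open>h * sqrt h\<close> or
    smaller, so one factor \<open>h\<close> pays for the number of cells and the rest
    vanishes.\<close>
  have blim: "(\<lambda>N. real N * b (T / real N)) \<longlonglongrightarrow> 0"
  proof -
    have h0: "(\<lambda>N. T / real N) \<longlonglongrightarrow> 0" by (rule lim_const_over_n)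
    have l: "(\<lambda>N. 4 * L * (2 * sqrt (2 / pi) * (T * sqrt (T / real N)) + K ^ 3 * T * (T / real N)\<^sup>2)
        + K2 / 2 * (2 * K * T * (sqrt (2 / pi) * sqrt (T / real N)) + K\<^sup>2 * T * (T / real N)))
      \<longlonglongrightarrow> 4 * L * (2 * sqrt (2 / pi) * (T * sqrt 0) + K ^ 3 * T * 0\<^sup>2)
        + K2 / 2 * (2 * K * T * (sqrt (2 / pi) * sqrt 0) + K\<^sup>2 * T * 0)"
      by (intro tendsto_intros h0)
    have e: "real N * b (T / real N) = 4 * L * (2 * sqrt (2 / pi) * (T * sqrt (T / real N)) + K ^ 3 * T * (T / real N)\<^sup>2)
        + K2 / 2 * (2 * K * T * (sqrt (2 / pi) * sqrt (T / real N)) + K\<^sup>2 * T * (T / real N))" if "0 < N" for N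
    proof -
      define h where "h = T / real N"
      have Th: "T = real N * h" using that by (simp add: h_def)
      show ?thesis unfolding b_def h_def[symmetric] unfolding Th
        by (simp add: algebra_simps power2_eq_square power3_eq_cube)
    qed
    from Lim_transform_eventually[OF l eventually_mono[OF eventually_gt_at_top[of 0] e[symmetric]]]
    show ?thesis by simp
  qed
  have "(\<lambda>N. (\<integral>\<omega>. ?Q \<omega> \<partial>M) - (\<integral>\<omega>. indicator A \<omega> * S N \<omega> \<partial>M)) \<longlonglongrightarrow> 0"
    by (rule Lim_null_comparison[OF _ blim]) (use err in \<open>auto intro!: eventually_mono[OF eventually_gt_at_top[of 0]]\<close>)
  from tendsto_diff[OF tendsto_const[of "\<integral>\<omega>. ?Q \<omega> \<partial>M"] this]
  have "(\<lambda>N. \<integral>\<omega>. indicator A \<omega> * S N \<omega> \<partial>M) \<longlonglongrightarrow> (\<integral>\<omega>. ?Q \<omega> \<partial>M)" by simp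
  then show "(\<integral>\<omega>. ?Q \<omega> \<partial>M) = (\<integral>\<omega>. indicator A \<omega> * integral {0..T} (\<lambda>s. g1 (Z s \<omega>) * a s \<omega> + g2 (Z s \<omega>) / 2) \<partial>M)"
    using lim1 LIMSEQ_unique unfolding I_def by blast
qed

end

text \<open>\<open>g\<close> is an antiderivative of \<open>phi powr \<epsilon>\<close>. A drift
  proportional to \<open>phi\<close> then produces the wanted power \<open>1 + \<epsilon>\<close>,
  and the second derivative has the same order with the small factor \<epsilon>. The Taylor constant
  \<open>L\<close> may blow up as \<open>a\<close> tends to 0, since Dynkin's formula is used at
  fixed \<open>a\<close>; the growth bound must be free of \<open>a\<close>.\<close>

lemma phi_test_function:
  assumes a: "0 < a" and \<epsilon>: "0 < \<epsilon>" "\<epsilon> \<le> 1 / 2"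
  obtains g L where "continuous_on UNIV g"
    and "\<And>x d. \<bar>g (x + d) - g x - phi a x powr \<epsilon> * d - (- \<epsilon> * phi a x powr (1 + \<epsilon>) * psi' a x) * d\<^sup>2 / 2\<bar> \<le> L * \<bar>d\<bar> ^ 3"
    and "\<And>x x0. 0 \<le> x0 \<Longrightarrow> g x - g x0 \<le> 2 + 3 * \<bar>x - x0\<bar>"
proof -
  note pp = phi_pos[OF a]
  let ?g1 = "\<lambda>x. phi a x powr \<epsilon>" and ?g2 = "\<lambda>x. - \<epsilon> * phi a x powr (1 + \<epsilon>) * psi' a x"
  have dpow: "((\<lambda>x. phi a x powr q) has_real_derivative q * phi a x powr (q - 1) * (- (phi a x)\<^sup>2 * psi' a x)) (at x)" for q x
    by (rule DERIV_cong[OF DERIV_powr[OF DERIV_phi[OF a] pp DERIV_const[of q]]])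
      (use pp[of x] in \<open>simp add: powr_diff\<close>)
  have dg1: "(?g1 has_real_derivative ?g2 x) (at x)" for x
  proof (rule DERIV_cong[OF dpow])
    have "phi a x powr (\<epsilon> - 1) * (phi a x)\<^sup>2 = phi a x powr (1 + \<epsilon>)"
      using pp[of x] by (simp add: powr_add[symmetric] powr_numeral[symmetric] del: powr_numeral)
    then show "\<epsilon> * phi a x powr (\<epsilon> - 1) * (- (phi a x)\<^sup>2 * psi' a x) = ?g2 x" by (simp add: mult.assoc[symmetric])
  qed
  let ?p2 = "\<lambda>x. a\<^sup>2 / (2 * sqrt (x\<^sup>2 + a\<^sup>2) ^ 3)"
  let ?g3 = "\<lambda>x. - \<epsilon> * ((1 + \<epsilon>) * phi a x powr (1 + \<epsilon> - 1) * (- (phi a x)\<^sup>2 * psi' a x) * psi' a x + ?p2 x * phi a x powr (1 + \<epsilon>))"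
  have dg2: "(?g2 has_real_derivative ?g3 x) (at x)" for x
    using DERIV_cmult[OF DERIV_mult[OF dpow[of "1 + \<epsilon>" x] DERIV_psi'[OF a, of x]], of "- \<epsilon>"] by (simp only: mult.assoc)
  define L where "L = 2 * ((1/a) powr \<epsilon> * (1/a)\<^sup>2) + 1 / a * (1/a) powr (1 + \<epsilon>)"
  have g3b: "\<bar>?g3 x\<bar> \<le> L" for x
  proof -
    have p: "phi a x powr q \<le> (1/a) powr q" if "0 \<le> q" for q using phi_le[OF a, of x] pp[of x] that by (intro powr_mono2) auto
    have 1: "\<bar>(1 + \<epsilon>) * phi a x powr (1 + \<epsilon> - 1) * (- (phi a x)\<^sup>2 * psi' a x) * psi' a x\<bar> \<le> 2 * ((1/a) powr \<epsilon> * (1/a)\<^sup>2)"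
    proof -
      have "\<bar>(1 + \<epsilon>) * phi a x powr (1 + \<epsilon> - 1) * (- (phi a x)\<^sup>2 * psi' a x) * psi' a x\<bar>
        = (1 + \<epsilon>) * (phi a x powr \<epsilon> * (phi a x)\<^sup>2) * (psi' a x * psi' a x)"
        using \<epsilon> psi'_bounds[OF a, of x] by (simp add: abs_mult)
      also have "\<dots> \<le> 2 * ((1/a) powr \<epsilon> * (1/a)\<^sup>2) * (1 * 1)"
        using \<epsilon> psi'_bounds[OF a, of x] p[of \<epsilon>] phi_le[OF a, of x] pp[of x]
        by (intro mult_mono power_mono) auto
      finally show ?thesis by simp
    qed
    have 2: "\<bar>?p2 x * phi a x powr (1 + \<epsilon>)\<bar> \<le> 1 / a * (1/a) powr (1 + \<epsilon>)"
      unfolding abs_mult using psi''_bound[OF a, of x] p[of "1 + \<epsilon>"] \<epsilon> a by (intro mult_mono) auto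
    have "\<bar>?g3 x\<bar> \<le> 1 * L"
      unfolding L_def abs_mult using \<epsilon>
      by (intro mult_mono order_trans[OF abs_triangle_ineq add_mono[OF 1 2]]) auto
    then show ?thesis by simp
  qed
  have L0: "0 \<le> L" using g3b[of 0] by linarith
  have c1: "isCont ?g1 x" for x using dg1 DERIV_isCont by blast
  obtain g where g: "\<And>x. (g has_real_derivative ?g1 x) (at x)"
    using einterval_antiderivative[of "-\<infinity>" "\<infinity>" ?g1] c1 by (auto simp: has_real_derivative_iff_has_vector_derivative)
  show ?thesis
  proof (rule that[of g L])
    show "continuous_on UNIV g" by (rule DERIV_continuous_on[OF g])
    show "\<bar>g (x + d) - g x - ?g1 x * d - ?g2 x * d\<^sup>2 / 2\<bar> \<le> L * \<bar>d\<bar> ^ 3" for x d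
    proof (cases "d = 0")
      case False
      define df where "df m = (if m = 0 then g else if m = 1 then ?g1 else if m = 2 then ?g2 else ?g3)" for m :: nat
      have "\<exists>t. (if x + d < x then x + d < t \<and> t < x else x < t \<and> t < x + d) \<and>
          g (x + d) = (\<Sum>m<3. df m x / fact m * (x + d - x) ^ m) + df 3 t / fact 3 * (x + d - x) ^ 3"
      proof (rule Taylor[where a = "min x (x + d)" and b = "max x (x + d)"])
        show "\<forall>m t. m < 3 \<and> min x (x + d) \<le> t \<and> t \<le> max x (x + d) \<longrightarrow> (df m has_real_derivative df (Suc m) t) (at t)"
          unfolding df_def using g dg1 dg2 by (auto simp: less_Suc_eq numeral_3_eq_3 numeral_2_eq_2)
      qed (use False in \<open>auto simp: df_def\<close>)
      then obtain t where "g (x + d) = (\<Sum>m<3. df m x / fact m * d ^ m) + df 3 t / fact 3 * d ^ 3" by auto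
      then have eq: "g (x + d) - g x - ?g1 x * d - ?g2 x * d\<^sup>2 / 2 = ?g3 t / 6 * d ^ 3"
        by (simp add: df_def numeral_3_eq_3 fact_numeral power2_eq_square) 
      have "\<bar>?g3 t / 6 * d ^ 3\<bar> = \<bar>?g3 t\<bar> / 6 * \<bar>d\<bar> ^ 3" by (simp add: abs_mult power_abs)
      also have "\<dots> \<le> L * \<bar>d\<bar> ^ 3" using g3b[of t] L0 by (intro mult_right_mono) auto
      finally show ?thesis unfolding eq .
    qed simp
    show "g x - g x0 \<le> 2 + 3 * \<bar>x - x0\<bar>" if x0: "0 \<le> x0" for x x0
    proof (cases "x \<le> x0")
      case True
      have "g x \<le> g x0" by (rule DERIV_nonneg_imp_nondecreasing[OF True]) (use g in \<open>auto intro!: exI[of _ "?g1 _"]\<close>)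
      then show ?thesis by (smt (verit) abs_ge_zero)
    next
      case False
      \<comment> \<open>For positive arguments the derivative of \<open>g\<close> is at most
        \<open>1 + 1 / sqrt y\<close> whatever \<open>a\<close> is; this uses
        \<open>\<epsilon> \<le> 1 / 2\<close>. The constants 2 and 3 of the growth bound then come
        from \<open>sqrt z \<le> 1 + z\<close>.\<close>
      let ?k = "\<lambda>y. y + 2 * sqrt y - g y"
      have "?k x0 \<le> ?k x"
      proof (rule DERIV_nonneg_imp_increasing_open[where f = ?k])
        fix y assume y: "x0 < y" "y < x"
        then have y0: "0 < y" using x0 by simp
        have "(?k has_real_derivative 1 + 1 / sqrt y - ?g1 y) (at y)"
          using y0 by (auto intro!: derivative_eq_intros g simp: field_simps)
        moreover have "?g1 y \<le> 1 + 1 / sqrt y"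
        proof -
          have "?g1 y \<le> (1 / y) powr \<epsilon>" using phi_le_inverse[OF a y0] pp[of y] \<epsilon> by (intro powr_mono2) auto
          also have "\<dots> \<le> 1 + 1 / sqrt y"
          proof (cases "y \<le> 1")
            case True
            have "(1 / y) powr \<epsilon> \<le> (1 / y) powr (1/2)" using True y0 \<epsilon> by (intro powr_mono) auto
            also have "\<dots> = 1 / sqrt y" using y0 by (simp add: powr_half_sqrt real_sqrt_divide)
            finally show ?thesis by simp
          next
            case False
            have "(1 / y) powr \<epsilon> \<le> 1 powr \<epsilon>" using False \<epsilon> by (intro powr_mono2) auto
            then show ?thesis using y0 by (simp add: add_increasing2)
          qed
          finally show ?thesis .
        qed
        ultimately show "\<exists>z. (?k has_real_derivative z) (at y) \<and> 0 \<le> z" by auto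
      next
        show "continuous_on {x0..x} ?k"
          by (intro continuous_intros continuous_on_subset[OF DERIV_continuous_on[OF g]]) auto
      qed (use False in auto)
      then have "g x - g x0 \<le> (x - x0) + 2 * (sqrt x - sqrt x0)" by (simp add: algebra_simps)
      moreover have "sqrt x - sqrt x0 \<le> sqrt (x - x0)"
        using sqrt_add_le_add_sqrt[of "x - x0" x0] x0 False by simp
      moreover have "sqrt (x - x0) \<le> 1 + (x - x0)"
      proof (rule real_le_lsqrt)
        have "u \<le> (1 + u)\<^sup>2" for u :: real
          using zero_le_power2[of "u + 1/2"] by (simp add: power2_eq_square algebra_simps)
        then show "x - x0 \<le> (1 + (x - x0))\<^sup>2" .
      qed (use False in auto)
      ultimately show ?thesis using False by simp
    qed
  qed
qed

section \<open>The approximating processes\<close>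

lemma borel_measurable_phi: "0 < a \<Longrightarrow> phi a \<in> borel_measurable borel"
  by (intro borel_measurable_continuous_onI continuous_on_phi continuous_on_id)

text \<open>Path properties hold at every point of \<open>space M\<close> here;
  \<open>bessel_driver_exists\<close> arranges this by altering data on a null set. Two filtrations
  occur: increments are Gaussian given the large \<open>F\<close>, while adaptedness to the smaller
  \<open>G\<close> is what makes a solution strong.\<close>

locale bessel_driver = filtered_prob_space M F for M :: "'a measure" and F +
  fixes \<alpha> \<beta> \<gamma> \<delta> :: real and B C :: "real \<Rightarrow> 'a \<Rightarrow> real" and X0 Y0 :: "'a \<Rightarrow> real"
    and G :: "real \<Rightarrow> 'a measure"
  assumes signs: "0 < \<alpha>" "0 < \<delta>" "\<beta> \<le> 0" "\<gamma> \<le> 0"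
    and BC_cont: "\<And>\<omega>. \<omega> \<in> space M \<Longrightarrow> continuous_on {0..} (\<lambda>t. B t \<omega>)" "\<And>\<omega>. \<omega> \<in> space M \<Longrightarrow> continuous_on {0..} (\<lambda>t. C t \<omega>)"
    and BC_0: "\<And>\<omega>. \<omega> \<in> space M \<Longrightarrow> B 0 \<omega> = 0" "\<And>\<omega>. \<omega> \<in> space M \<Longrightarrow> C 0 \<omega> = 0"
    and BC_gauss: "\<And>s t. 0 \<le> s \<Longrightarrow> s < t \<Longrightarrow> conditionally_gaussian M (F s) (t - s) (\<lambda>\<omega>. B t \<omega> - B s \<omega>)"
      "\<And>s t. 0 \<le> s \<Longrightarrow> s < t \<Longrightarrow> conditionally_gaussian M (F s) (t - s) (\<lambda>\<omega>. C t \<omega> - C s \<omega>)"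
    and init_nonneg: "\<And>\<omega>. \<omega> \<in> space M \<Longrightarrow> 0 \<le> X0 \<omega>" "\<And>\<omega>. \<omega> \<in> space M \<Longrightarrow> 0 \<le> Y0 \<omega>"
    and space_G: "\<And>t. space (G t) = space M"
    and G_F: "\<And>t. 0 \<le> t \<Longrightarrow> sets (G t) \<subseteq> sets (F t)"
    and G_mono: "\<And>s t. 0 \<le> s \<Longrightarrow> s \<le> t \<Longrightarrow> sets (G s) \<subseteq> sets (G t)"
    and init_G: "X0 \<in> borel_measurable (G 0)" "Y0 \<in> borel_measurable (G 0)"
    and BC_G: "\<And>t. 0 \<le> t \<Longrightarrow> B t \<in> borel_measurable (G t)" "\<And>t. 0 \<le> t \<Longrightarrow> C t \<in> borel_measurable (G t)"
begin

lemma measurable_G_mono: "0 \<le> s \<Longrightarrow> s \<le> t \<Longrightarrow> f \<in> borel_measurable (G s) \<Longrightarrow> f \<in> borel_measurable (G t)"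
  by (rule measurable_from_subalg[of "G t" "G s"]) (auto simp: subalgebra_def space_G dest: G_mono[THEN subsetD])

lemma measurable_G_F: "0 \<le> t \<Longrightarrow> f \<in> borel_measurable (G t) \<Longrightarrow> f \<in> borel_measurable (F t)"
  by (rule measurable_from_subalg[of "F t" "G t"]) (auto simp: subalgebra_def space_G space_F dest: G_F[THEN subsetD])

definition drift1 where "drift1 a x y = \<alpha> * phi a x + \<beta> * phi a y"
definition drift2 where "drift2 a x y = \<gamma> * phi a x + \<delta> * phi a y"
abbreviation "csum \<equiv> \<bar>\<alpha>\<bar> + \<bar>\<beta>\<bar> + \<bar>\<gamma>\<bar> + \<bar>\<delta>\<bar>"

lemma drift_lipschitz:
  assumes a: "0 < a"
  shows "lipschitz_drift (drift1 a) (drift2 a) (csum / a\<^sup>2) (csum / a)"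
proof -
  have lip: "\<bar>(u * phi a x + v * phi a y) - (u * phi a x' + v * phi a y')\<bar> \<le> csum / a\<^sup>2 * (\<bar>x - x'\<bar> + \<bar>y - y'\<bar>)"
    and bnd: "\<bar>u * phi a x + v * phi a y\<bar> \<le> csum / a"
    if uv: "\<bar>u\<bar> + \<bar>v\<bar> \<le> csum" for u v x y x' y'
  proof -
    have uv': "\<bar>u\<bar> \<le> csum" "\<bar>v\<bar> \<le> csum" using uv abs_ge_zero[of u] abs_ge_zero[of v] by linarith+
    have "\<bar>(u * phi a x + v * phi a y) - (u * phi a x' + v * phi a y')\<bar> = \<bar>u * (phi a x - phi a x') + v * (phi a y - phi a y')\<bar>"
      by (simp add: algebra_simps)
    also have "\<dots> \<le> \<bar>u\<bar> * \<bar>phi a x - phi a x'\<bar> + \<bar>v\<bar> * \<bar>phi a y - phi a y'\<bar>"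
      by (rule order_trans[OF abs_triangle_ineq]) (simp add: abs_mult)
    also have "\<dots> \<le> csum * (1 / a\<^sup>2 * \<bar>x - x'\<bar>) + csum * (1 / a\<^sup>2 * \<bar>y - y'\<bar>)"
      using phi_lipschitz[OF a] by (intro add_mono mult_mono uv') auto
    also have "\<dots> = csum / a\<^sup>2 * (\<bar>x - x'\<bar> + \<bar>y - y'\<bar>)"
    proof -
      have "k * (1 / d * m) + k * (1 / d * n) = k / d * (m + n)" for k d m n :: real by (simp add: distrib_left)
      then show ?thesis .
    qed
    finally show "\<bar>(u * phi a x + v * phi a y) - (u * phi a x' + v * phi a y')\<bar> \<le> csum / a\<^sup>2 * (\<bar>x - x'\<bar> + \<bar>y - y'\<bar>)" .
    have "\<bar>u * phi a x + v * phi a y\<bar> \<le> \<bar>u\<bar> * phi a x + \<bar>v\<bar> * phi a y"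
      using phi_pos[OF a] by (intro order_trans[OF abs_triangle_ineq]) (simp add: abs_mult less_imp_le)
    also have "\<dots> \<le> \<bar>u\<bar> * (1 / a) + \<bar>v\<bar> * (1 / a)" using phi_le[OF a] by (intro add_mono mult_left_mono) auto
    also have "\<dots> = (\<bar>u\<bar> + \<bar>v\<bar>) / a" by (simp add: add_divide_distrib)
    also have "\<dots> \<le> csum / a" using uv a by (intro divide_right_mono) auto
    finally show "\<bar>u * phi a x + v * phi a y\<bar> \<le> csum / a" .
  qed
  show ?thesis
    unfolding drift1_def[abs_def] drift2_def[abs_def]
  proof
    show "0 < csum / a\<^sup>2" using signs a by (intro divide_pos_pos) auto
  qed (rule lip bnd; simp)+
qed

definition X where "X a t \<omega> = lipschitz_drift.solx (drift1 a) (drift2 a) (\<lambda>t. X0 \<omega> + B t \<omega>) (\<lambda>t. Y0 \<omega> + C t \<omega>) t"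
definition Y where "Y a t \<omega> = lipschitz_drift.soly (drift1 a) (drift2 a) (\<lambda>t. X0 \<omega> + B t \<omega>) (\<lambda>t. Y0 \<omega> + C t \<omega>) t"
abbreviation "P a t \<omega> \<equiv> phi a (X a t \<omega>)"
abbreviation "Q a t \<omega> \<equiv> phi a (Y a t \<omega>)"

lemma input_continuous:
  assumes "\<omega> \<in> space M"
  shows "continuous_on {0..} (\<lambda>t. X0 \<omega> + B t \<omega>)" "continuous_on {0..} (\<lambda>t. Y0 \<omega> + C t \<omega>)"
  using BC_cont[OF assms] by (auto intro!: continuous_intros)

lemma XY_continuous:
  assumes "0 < a" "\<omega> \<in> space M"
  shows "continuous_on {0..} (\<lambda>t. X a t \<omega>)" "continuous_on {0..} (\<lambda>t. Y a t \<omega>)"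
  unfolding X_def Y_def using lipschitz_drift.ode_solution(1,2)[OF drift_lipschitz[OF assms(1)] input_continuous[OF assms(2)]]
  by (simp_all add: eta_contract_eq)

lemma PQ_continuous:
  assumes "0 < a" "\<omega> \<in> space M" "S \<subseteq> {0..}"
  shows "continuous_on S (\<lambda>t. P a t \<omega>)" "continuous_on S (\<lambda>t. Q a t \<omega>)"
  using XY_continuous[OF assms(1,2)] by (auto intro!: continuous_on_phi assms continuous_on_subset[OF _ assms(3)])

lemma PQ_integrable:
  assumes "0 < a" "\<omega> \<in> space M"
  shows "(\<lambda>t. P a t \<omega>) integrable_on {0..t}" "(\<lambda>t. Q a t \<omega>) integrable_on {0..t}"
  using PQ_continuous[OF assms, of "{0..t}"] by (auto intro!: integrable_continuous_interval)

lemma XY_eq: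
  assumes "0 < a" "\<omega> \<in> space M" "0 \<le> t"
  shows "X a t \<omega> = X0 \<omega> + B t \<omega> + integral {0..t} (\<lambda>s. \<alpha> * P a s \<omega> + \<beta> * Q a s \<omega>)"
    and "Y a t \<omega> = Y0 \<omega> + C t \<omega> + integral {0..t} (\<lambda>s. \<gamma> * P a s \<omega> + \<delta> * Q a s \<omega>)"
  using lipschitz_drift.ode_solution(5,6)[OF drift_lipschitz[OF assms(1)] input_continuous[OF assms(2)] assms(3)]
  unfolding X_def Y_def by (simp_all add: drift1_def drift2_def)

lemma XY_0: "0 < a \<Longrightarrow> \<omega> \<in> space M \<Longrightarrow> X a 0 \<omega> = X0 \<omega>" "0 < a \<Longrightarrow> \<omega> \<in> space M \<Longrightarrow> Y a 0 \<omega> = Y0 \<omega>"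
  using XY_eq[of a \<omega> 0] BC_0[of \<omega>] by auto

text \<open>The induction ranges over all times, because the integral up to \<open>t\<close> uses
  the previous iterate at every \<open>s \<le> t\<close>, where it is \<open>G s\<close>-measurable
  and hence \<open>G t\<close>-measurable.\<close>

lemma picard_measurable:
  assumes a: "0 < a" and t: "0 \<le> t"
  shows "(\<lambda>\<omega>. fst (picard (drift1 a) (drift2 a) (\<lambda>t. X0 \<omega> + B t \<omega>) (\<lambda>t. Y0 \<omega> + C t \<omega>) k t)) \<in> borel_measurable (G t) \<and>
    (\<lambda>\<omega>. snd (picard (drift1 a) (drift2 a) (\<lambda>t. X0 \<omega> + B t \<omega>) (\<lambda>t. Y0 \<omega> + C t \<omega>) k t)) \<in> borel_measurable (G t)"
  using t
proof (induction k arbitrary: t)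
  case 0
  note [measurable] = measurable_G_mono[OF order_refl 0 init_G(1)] measurable_G_mono[OF order_refl 0 init_G(2)] BC_G[OF 0]
  show ?case by simp
next
  case (Suc k)
  note [measurable] = measurable_G_mono[OF order_refl Suc.prems init_G(1)] measurable_G_mono[OF order_refl Suc.prems init_G(2)] BC_G[OF Suc.prems]
    borel_measurable_phi[OF a]
  interpret ld: lipschitz_drift "drift1 a" "drift2 a" "csum / a\<^sup>2" "csum / a" by (rule drift_lipschitz[OF a])
  let ?x = "\<lambda>s \<omega>. fst (picard (drift1 a) (drift2 a) (\<lambda>t. X0 \<omega> + B t \<omega>) (\<lambda>t. Y0 \<omega> + C t \<omega>) k s)"
  let ?y = "\<lambda>s \<omega>. snd (picard (drift1 a) (drift2 a) (\<lambda>t. X0 \<omega> + B t \<omega>) (\<lambda>t. Y0 \<omega> + C t \<omega>) k s)"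
  have c: "continuous_on {0..t} (\<lambda>s. ?x s \<omega>)" "continuous_on {0..t} (\<lambda>s. ?y s \<omega>)" if "\<omega> \<in> space M" for \<omega>
    using ld.picard_continuous[OF input_continuous[OF that], of k] by (auto elim!: continuous_on_subset)
  have m: "?x s \<in> borel_measurable (G t)" "?y s \<in> borel_measurable (G t)" if "0 \<le> s" "s \<le> t" for s
    using Suc.IH[OF that(1)] measurable_G_mono[OF that] by auto
  have dm: "(\<lambda>\<omega>. drift1 a (f \<omega>) (h \<omega>)) \<in> borel_measurable (G t)" "(\<lambda>\<omega>. drift2 a (f \<omega>) (h \<omega>)) \<in> borel_measurable (G t)"
    if [measurable]: "f \<in> borel_measurable (G t)" "h \<in> borel_measurable (G t)" for f h
    unfolding drift1_def drift2_def by measurable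
  have "(\<lambda>\<omega>. integral {0..t} (\<lambda>s. drift1 a (?x s \<omega>) (?y s \<omega>))) \<in> borel_measurable (G t)"
    "(\<lambda>\<omega>. integral {0..t} (\<lambda>s. drift2 a (?x s \<omega>) (?y s \<omega>))) \<in> borel_measurable (G t)"
  proof -
    have "(\<lambda>\<omega>. drift1 a (?x s \<omega>) (?y s \<omega>)) \<in> borel_measurable (G t)" "(\<lambda>\<omega>. drift2 a (?x s \<omega>) (?y s \<omega>)) \<in> borel_measurable (G t)"
      if "0 \<le> s" "s \<le> t" for s
      by (rule dm[OF m[OF that]])+
    then show "(\<lambda>\<omega>. integral {0..t} (\<lambda>s. drift1 a (?x s \<omega>) (?y s \<omega>))) \<in> borel_measurable (G t)"
      "(\<lambda>\<omega>. integral {0..t} (\<lambda>s. drift2 a (?x s \<omega>) (?y s \<omega>))) \<in> borel_measurable (G t)"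
      using ld.continuous_on_F[OF c] Suc.prems by (auto intro!: borel_measurable_path_integral simp: space_G)
  qed
  then show ?case by simp
qed

lemma XY_measurable:
  assumes a: "0 < a" and t: "0 \<le> t"
  shows "X a t \<in> borel_measurable (G t)" "Y a t \<in> borel_measurable (G t)"
    and "X a t \<in> borel_measurable (F t)" "Y a t \<in> borel_measurable (F t)"
    and "X a t \<in> borel_measurable M" "Y a t \<in> borel_measurable M"
proof -
  interpret ld: lipschitz_drift "drift1 a" "drift2 a" "csum / a\<^sup>2" "csum / a" by (rule drift_lipschitz[OF a])
  show 1: "X a t \<in> borel_measurable (G t)"
    by (rule borel_measurable_LIMSEQ_real[OF _ picard_measurable[OF a t, THEN conjunct1]])
      (use ld.ode_solution(3)[OF input_continuous t] in \<open>auto simp: X_def space_G\<close>)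
  show 2: "Y a t \<in> borel_measurable (G t)"
    by (rule borel_measurable_LIMSEQ_real[OF _ picard_measurable[OF a t, THEN conjunct2]])
      (use ld.ode_solution(4)[OF input_continuous t] in \<open>auto simp: Y_def space_G\<close>)
  show "X a t \<in> borel_measurable (F t)" "Y a t \<in> borel_measurable (F t)"
    using 1 2 measurable_G_F[OF t] by auto
  then show "X a t \<in> borel_measurable M" "Y a t \<in> borel_measurable M"
    using measurable_F_M by auto
qed

lemma integrable_path_integral:
  fixes u :: "real \<Rightarrow> 'a \<Rightarrow> real"
  assumes A: "A \<in> events" and u: "\<And>s. 0 \<le> s \<Longrightarrow> u s \<in> borel_measurable M"
    and c: "\<And>\<omega>. \<omega> \<in> space M \<Longrightarrow> continuous_on {0..} (\<lambda>s. u s \<omega>)"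
    and b: "\<And>s \<omega>. 0 \<le> s \<Longrightarrow> \<omega> \<in> space M \<Longrightarrow> \<bar>u s \<omega>\<bar> \<le> k" and T: "0 \<le> T"
  shows "integrable M (\<lambda>\<omega>. indicator A \<omega> * integral {0..T} (\<lambda>s. u s \<omega>))"
proof (rule integrable_const_bound[of _ "k * T"])
  have c': "continuous_on {0..T} (\<lambda>s. u s \<omega>)" if "\<omega> \<in> space M" for \<omega> by (rule continuous_on_subset[OF c[OF that]]) auto
  have "(\<lambda>\<omega>. integral {0..T} (\<lambda>s. u s \<omega>)) \<in> borel_measurable M"
    by (rule borel_measurable_path_integral[OF u c' T])
  then show "(\<lambda>\<omega>. indicator A \<omega> * integral {0..T} (\<lambda>s. u s \<omega>)) \<in> borel_measurable M" using A by measurable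
  show "AE \<omega> in M. norm (indicator A \<omega> * integral {0..T} (\<lambda>s. u s \<omega>)) \<le> k * T"
  proof (rule AE_I2)
    fix \<omega> assume \<omega>: "\<omega> \<in> space M"
    have "norm (integral {0..T} (\<lambda>s. u s \<omega>)) \<le> integral {0..T} (\<lambda>_. k)"
      by (rule integral_norm_bound_integral[OF integrable_continuous_interval[OF c'[OF \<omega>]]]) (use b \<omega> in auto)
    also have "\<dots> = k * T" using T by simp
    finally have *: "\<bar>integral {0..T} (\<lambda>s. u s \<omega>)\<bar> \<le> k * T" by simp
    then show "norm (indicator A \<omega> * integral {0..T} (\<lambda>s. u s \<omega>)) \<le> k * T"
      using order_trans[OF abs_ge_zero *] by (auto simp: indicator_def)
  qed
qed

text \<open>Dynkin's formula for one component with own drift \<open>u * phi a Z\<close> and cross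
  drift \<open>w * q\<close>. \<open>J\<close> bounds the drift of \<open>g Z\<close> from below, by
  \<open>psi' \<le> 1\<close>, and subtracts three times the absolute sizes of the two drift parts,
  which pays for the growth of \<open>g\<close>. In expectation the increments of \<open>g\<close>
  cancel, leaving the mean of \<open>2 + 3 * \<bar>W T\<bar>\<close>, which is independent of
  \<open>a\<close>.\<close>

lemma component_moment_inequality:
  fixes W Z q :: "real \<Rightarrow> 'a \<Rightarrow> real"
  assumes a: "0 < a" and \<epsilon>: "0 < \<epsilon>" "\<epsilon> \<le> 1 / 2" and T: "0 < T" and A: "A \<in> sets (F 0)"
    and uv: "0 \<le> u" "w \<le> 0"
    and W: "\<And>t. 0 \<le> t \<Longrightarrow> W t \<in> borel_measurable (F t)"
    and Wg: "\<And>s t. 0 \<le> s \<Longrightarrow> s < t \<Longrightarrow> conditionally_gaussian M (F s) (t - s) (\<lambda>\<omega>. W t \<omega> - W s \<omega>)"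
    and W0: "\<And>\<omega>. \<omega> \<in> space M \<Longrightarrow> W 0 \<omega> = 0"
    and Z: "\<And>t. 0 \<le> t \<Longrightarrow> Z t \<in> borel_measurable (F t)"
    and Z0: "\<And>\<omega>. \<omega> \<in> space M \<Longrightarrow> 0 \<le> Z 0 \<omega>"
    and Zc: "\<And>\<omega>. \<omega> \<in> space M \<Longrightarrow> continuous_on {0..} (\<lambda>s. Z s \<omega>)"
    and qm: "\<And>t. 0 \<le> t \<Longrightarrow> q t \<in> borel_measurable M"
    and qc: "\<And>\<omega>. \<omega> \<in> space M \<Longrightarrow> continuous_on {0..} (\<lambda>s. q s \<omega>)"
    and qb: "\<And>s \<omega>. 0 \<le> q s \<omega>" "\<And>s \<omega>. q s \<omega> \<le> 1 / a"
    and Zeq: "\<And>\<omega> t. \<omega> \<in> space M \<Longrightarrow> 0 \<le> t \<Longrightarrow> Z t \<omega> = Z 0 \<omega> + W t \<omega> + integral {0..t} (\<lambda>s. u * phi a (Z s \<omega>) + w * q s \<omega>)"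
  defines "J \<equiv> \<lambda>s \<omega>. phi a (Z s \<omega>) powr \<epsilon> * (u * phi a (Z s \<omega>) + w * q s \<omega>) - \<epsilon> / 2 * phi a (Z s \<omega>) powr (1 + \<epsilon>)
     - 3 * (u * phi a (Z s \<omega>) - w * q s \<omega>)"
  shows "integrable M (\<lambda>\<omega>. indicator A \<omega> * integral {0..T} (\<lambda>s. J s \<omega>))"
    and "(\<integral>\<omega>. indicator A \<omega> * integral {0..T} (\<lambda>s. J s \<omega>) \<partial>M) \<le> 2 + 3 * (sqrt (2 / pi) * sqrt T)"
proof -
  have AM[measurable]: "A \<in> events" using A sets_F by auto
  note [measurable] = borel_measurable_phi[OF a]
  have ZM: "0 \<le> t \<Longrightarrow> Z t \<in> borel_measurable M" for t using Z measurable_F_M by auto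
  define p where "p s \<omega> = phi a (Z s \<omega>)" for s \<omega>
  have pm: "p s \<in> borel_measurable M" if "0 \<le> s" for s unfolding p_def using ZM[OF that] by measurable
  have pc: "continuous_on {0..} (\<lambda>s. p s \<omega>)" if "\<omega> \<in> space M" for \<omega> unfolding p_def by (rule continuous_on_phi[OF a Zc[OF that]])
  have pb: "0 < p s \<omega>" "p s \<omega> \<le> 1 / a" for s \<omega> unfolding p_def using phi_pos[OF a] phi_le[OF a] by auto
  have ppb: "\<bar>p s \<omega> powr r\<bar> \<le> (1/a) powr r" if "0 \<le> r" for s \<omega> r
    using pb[of s \<omega>] that by (auto intro!: powr_mono2)
  obtain g L where gc: "continuous_on UNIV g"
    and taylor: "\<And>x d. \<bar>g (x + d) - g x - phi a x powr \<epsilon> * d - (- \<epsilon> * phi a x powr (1 + \<epsilon>) * psi' a x) * d\<^sup>2 / 2\<bar> \<le> L * \<bar>d\<bar> ^ 3"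
    and gle: "\<And>x x0. 0 \<le> x0 \<Longrightarrow> g x - g x0 \<le> 2 + 3 * \<bar>x - x0\<bar>"
    using phi_test_function[OF a \<epsilon>] by blast
  let ?g1 = "\<lambda>x. phi a x powr \<epsilon>" and ?g2 = "\<lambda>x. - \<epsilon> * phi a x powr (1 + \<epsilon>) * psi' a x"
  have powc: "continuous_on UNIV (\<lambda>x. phi a x powr r)" for r
    using phi_pos[OF a] by (intro continuous_intros continuous_on_phi a) (auto simp: less_imp_neq[symmetric])
  have psic: "continuous_on UNIV (psi' a)" by (rule DERIV_continuous_on[OF DERIV_psi'[OF a]])
  have g1c: "continuous_on UNIV ?g1" "continuous_on UNIV ?g2" by (intro continuous_intros powc psic)+
  have g1b: "\<bar>?g1 x\<bar> \<le> (1/a) powr \<epsilon>" and powb: "phi a x powr (1 + \<epsilon>) \<le> (1/a) powr (1 + \<epsilon>)" for x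
    using phi_pos[OF a, of x] phi_le[OF a, of x] \<epsilon> by (auto intro!: powr_mono2)
  have g2b: "\<bar>?g2 x\<bar> \<le> 1 * (1/a) powr (1 + \<epsilon>) * 1" for x
    unfolding abs_mult using \<epsilon> psi'_bounds[OF a, of x] powb[of x] by (intro mult_mono) auto
  define d where "d s \<omega> = u * p s \<omega> + w * q s \<omega>" for s \<omega>
  have dc: "continuous_on {0..} (\<lambda>s. d s \<omega>)" if "\<omega> \<in> space M" for \<omega>
    unfolding d_def by (intro continuous_intros pc qc that)
  have db: "\<bar>d s \<omega>\<bar> \<le> u * (1/a) + (- w) * (1/a)" and db': "\<bar>d s \<omega>\<bar> \<le> u * p s \<omega> - w * q s \<omega>" for s \<omega>
  proof -
    have "\<bar>d s \<omega>\<bar> \<le> \<bar>u * p s \<omega>\<bar> + \<bar>w * q s \<omega>\<bar>" unfolding d_def by (rule abs_triangle_ineq)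
    also have "\<dots> = u * p s \<omega> + (- w) * q s \<omega>" using uv pb[of s \<omega>] qb(1)[of s \<omega>] qb(2)[of s \<omega>] by (simp add: abs_mult)
    finally show *: "\<bar>d s \<omega>\<bar> \<le> u * p s \<omega> - w * q s \<omega>" by simp
    have "u * p s \<omega> + (- w) * q s \<omega> \<le> u * (1/a) + (- w) * (1/a)"
      using uv pb[of s \<omega>] qb(1)[of s \<omega>] qb(2)[of s \<omega>] by (intro add_mono mult_left_mono) auto
    then show "\<bar>d s \<omega>\<bar> \<le> u * (1/a) + (- w) * (1/a)" using * by linarith
  qed
  have Zeq': "Z t \<omega> = Z 0 \<omega> + (W t \<omega> - W 0 \<omega>) + integral {0..t} (\<lambda>s. d s \<omega>)" if "\<omega> \<in> space M" "0 \<le> t" for \<omega> t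
    using Zeq[OF that] W0[OF that(1)] by (simp add: d_def p_def)
  note dyn = dynkin_formula[OF T W Wg Z Zeq' Zc dc db gc g1c g1b g2b taylor A]
  define D where "D s \<omega> = ?g1 (Z s \<omega>) * d s \<omega> + ?g2 (Z s \<omega>) / 2" for s \<omega>
  define R where "R s \<omega> = u * p s \<omega> - w * q s \<omega>" for s \<omega>
  have Rc: "continuous_on {0..} (\<lambda>s. R s \<omega>)" if "\<omega> \<in> space M" for \<omega>
    unfolding R_def by (intro continuous_intros pc qc that)
  have Rm: "R s \<in> borel_measurable M" if "0 \<le> s" for s unfolding R_def using pm[OF that] qm[OF that] by measurable
  have Rb: "0 \<le> R s \<omega>" "R s \<omega> \<le> u * (1/a) + (- w) * (1/a)" for s \<omega>
  proof -
    have "0 \<le> u * p s \<omega>" "0 \<le> - w * q s \<omega>" using uv pb[of s \<omega>] qb(1)[of s \<omega>] by (auto intro!: mult_nonneg_nonneg simp: mult_nonpos_nonneg)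
    then show "0 \<le> R s \<omega>" unfolding R_def by simp
    show "R s \<omega> \<le> u * (1/a) + (- w) * (1/a)" unfolding R_def diff_conv_add_uminus minus_mult_left
      using uv pb[of s \<omega>] qb(1)[of s \<omega>] qb(2)[of s \<omega>] by (intro add_mono mult_left_mono) auto
  qed
  have iR: "integrable M (\<lambda>\<omega>. indicator A \<omega> * integral {0..T} (\<lambda>s. R s \<omega>))"
    by (rule integrable_path_integral[OF AM Rm Rc]) (use Rb T in auto)
  have Jeq: "J s \<omega> = p s \<omega> powr \<epsilon> * d s \<omega> - \<epsilon> / 2 * p s \<omega> powr (1 + \<epsilon>) - 3 * R s \<omega>" for s \<omega>
    by (simp add: J_def d_def p_def R_def)
  have Jc: "continuous_on {0..} (\<lambda>s. J s \<omega>)" if \<omega>: "\<omega> \<in> space M" for \<omega>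
    unfolding Jeq using pb by (intro continuous_intros pc dc Rc \<omega>) (auto simp: less_imp_neq[symmetric])
  have dm: "d s \<in> borel_measurable M" if "0 \<le> s" for s unfolding d_def using pm[OF that] qm[OF that] by measurable
  have Jm: "J s \<in> borel_measurable M" if "0 \<le> s" for s
    unfolding Jeq[abs_def] using pm[OF that] dm[OF that] Rm[OF that] by measurable
  let ?k = "(1/a) powr \<epsilon> * (u * (1/a) + (- w) * (1/a)) + \<epsilon> / 2 * (1/a) powr (1 + \<epsilon>) + 3 * (u * (1/a) + (- w) * (1/a))"
  have Jb: "\<bar>J s \<omega>\<bar> \<le> ?k" for s \<omega>
  proof -
    have "\<bar>p s \<omega> powr \<epsilon> * d s \<omega>\<bar> \<le> (1/a) powr \<epsilon> * (u * (1/a) + (- w) * (1/a))"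
      unfolding abs_mult using ppb[of \<epsilon> s \<omega>] db[of s \<omega>] \<epsilon> by (intro mult_mono) auto
    moreover have "\<bar>\<epsilon> / 2 * p s \<omega> powr (1 + \<epsilon>)\<bar> \<le> \<epsilon> / 2 * (1/a) powr (1 + \<epsilon>)"
      using ppb[of "1 + \<epsilon>" s \<omega>] \<epsilon> by (simp add: abs_mult)
    moreover have "\<bar>3 * R s \<omega>\<bar> \<le> 3 * (u * (1/a) + (- w) * (1/a))" using Rb[of s \<omega>] by simp
    ultimately show ?thesis unfolding Jeq by linarith
  qed
  show iJ: "integrable M (\<lambda>\<omega>. indicator A \<omega> * integral {0..T} (\<lambda>s. J s \<omega>))"
    by (rule integrable_path_integral[OF AM Jm Jc Jb]) (use T in auto)
  have WT: "W T \<in> borel_measurable M" using W[of T] T measurable_F_M by auto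
  have cgT: "conditionally_gaussian M (F 0) (T - 0) (\<lambda>\<omega>. W T \<omega> - W 0 \<omega>)" by (rule Wg) (use T in auto)
  have WT0: "(\<lambda>\<omega>. W T \<omega> - W 0 \<omega>) \<in> borel_measurable M" using WT measurable_F_M[OF W[of 0]] by measurable
  note mom = gaussian_moments[OF WT0 _ space_F sets_F cgT]
  have iW: "integrable M (\<lambda>\<omega>. \<bar>W T \<omega> - W 0 \<omega>\<bar>)" using mom(2)[of 1] T by simp
  have EW: "(\<integral>\<omega>. \<bar>W T \<omega> - W 0 \<omega>\<bar> \<partial>M) = sqrt (2 / pi) * sqrt T" using mom(3) T by simp
  \<comment> \<open>The increment of \<open>g\<close> is kept on the left, where Dynkin's formula
    makes its mean cancel against that of the integral of \<open>D\<close>.\<close>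
  have path: "indicator A \<omega> * integral {0..T} (\<lambda>s. J s \<omega>) + indicator A \<omega> * (g (Z T \<omega>) - g (Z 0 \<omega>))
      \<le> indicator A \<omega> * integral {0..T} (\<lambda>s. D s \<omega>) + (2 + 3 * \<bar>W T \<omega> - W 0 \<omega>\<bar>)" if \<omega>: "\<omega> \<in> space M" for \<omega>
  proof (cases "\<omega> \<in> A")
    case True
    have sub: "{0..T} \<subseteq> {0..}" by auto
    note cs = continuous_on_subset[OF _ sub]
    have Zc': "continuous_on {0..T} (\<lambda>s. Z s \<omega>)" by (rule cs[OF Zc[OF \<omega>]])
    have iint: "(\<lambda>s. R s \<omega>) integrable_on {0..T}" "(\<lambda>s. J s \<omega>) integrable_on {0..T}" "(\<lambda>s. d s \<omega>) integrable_on {0..T}"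
      by (intro integrable_continuous_interval cs Rc Jc dc \<omega>)+
    have Dint: "(\<lambda>s. D s \<omega>) integrable_on {0..T}"
      unfolding D_def
      by (intro integrable_continuous_interval continuous_on_add continuous_on_mult continuous_on_divide continuous_on_const
          cs[OF dc[OF \<omega>]] continuous_on_compose2[OF g1c(1) Zc'] continuous_on_compose2[OF g1c(2) Zc']) auto
    have "g (Z T \<omega>) - g (Z 0 \<omega>) \<le> 2 + 3 * \<bar>Z T \<omega> - Z 0 \<omega>\<bar>" by (rule gle[OF Z0[OF \<omega>]])
    also have "\<bar>Z T \<omega> - Z 0 \<omega>\<bar> \<le> \<bar>W T \<omega> - W 0 \<omega>\<bar> + \<bar>integral {0..T} (\<lambda>s. d s \<omega>)\<bar>"
      using Zeq'[OF \<omega>, of T] T by simp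
    also have "\<bar>integral {0..T} (\<lambda>s. d s \<omega>)\<bar> \<le> integral {0..T} (\<lambda>s. R s \<omega>)"
      using integral_norm_bound_integral[OF iint(3,1)] db' by (simp add: R_def)
    finally have 1: "g (Z T \<omega>) - g (Z 0 \<omega>) \<le> 2 + 3 * (\<bar>W T \<omega> - W 0 \<omega>\<bar> + integral {0..T} (\<lambda>s. R s \<omega>))" by simp
    have "integral {0..T} (\<lambda>s. J s \<omega>) \<le> integral {0..T} (\<lambda>s. D s \<omega> - 3 * R s \<omega>)"
    proof (rule integral_le)
      show "(\<lambda>s. D s \<omega> - 3 * R s \<omega>) integrable_on {0..T}" by (intro integrable_diff integrable_on_mult_right Dint iint)
      fix s
      have "\<epsilon> * p s \<omega> powr (1 + \<epsilon>) * psi' a (Z s \<omega>) \<le> \<epsilon> * p s \<omega> powr (1 + \<epsilon>) * 1"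
        using psi'_bounds(2)[OF a] \<epsilon> by (intro mult_left_mono) auto
      then show "J s \<omega> \<le> D s \<omega> - 3 * R s \<omega>" unfolding Jeq D_def p_def by simp
    qed (rule iint)
    also have "\<dots> = integral {0..T} (\<lambda>s. D s \<omega>) - 3 * integral {0..T} (\<lambda>s. R s \<omega>)"
      by (subst integral_diff) (auto intro!: Dint iint integrable_on_mult_right)
    finally show ?thesis using 1 True by simp
  qed simp
  have DI: "(\<integral>\<omega>. indicator A \<omega> * (g (Z T \<omega>) - g (Z 0 \<omega>)) \<partial>M) = (\<integral>\<omega>. indicator A \<omega> * integral {0..T} (\<lambda>s. D s \<omega>) \<partial>M)"
    and iQ: "integrable M (\<lambda>\<omega>. indicator A \<omega> * (g (Z T \<omega>) - g (Z 0 \<omega>)))"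
    and iD: "integrable M (\<lambda>\<omega>. indicator A \<omega> * integral {0..T} (\<lambda>s. D s \<omega>))"
    using dyn unfolding D_def by auto
  have "(\<integral>\<omega>. indicator A \<omega> * integral {0..T} (\<lambda>s. J s \<omega>) + indicator A \<omega> * (g (Z T \<omega>) - g (Z 0 \<omega>)) \<partial>M)
     \<le> (\<integral>\<omega>. indicator A \<omega> * integral {0..T} (\<lambda>s. D s \<omega>) + (2 + 3 * \<bar>W T \<omega> - W 0 \<omega>\<bar>) \<partial>M)"
    by (rule integral_mono) (use iJ iQ iD iW path in auto)
  then have "(\<integral>\<omega>. indicator A \<omega> * integral {0..T} (\<lambda>s. J s \<omega>) \<partial>M) + (\<integral>\<omega>. indicator A \<omega> * (g (Z T \<omega>) - g (Z 0 \<omega>)) \<partial>M)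
     \<le> (\<integral>\<omega>. indicator A \<omega> * integral {0..T} (\<lambda>s. D s \<omega>) \<partial>M) + (2 + 3 * (sqrt (2 / pi) * sqrt T))"
    using iJ iQ iD iW by (simp add: EW prob_space)
  then show "(\<integral>\<omega>. indicator A \<omega> * integral {0..T} (\<lambda>s. J s \<omega>) \<partial>M) \<le> 2 + 3 * (sqrt (2 / pi) * sqrt T)"
    unfolding DI by simp
qed

end

section \<open>Moment bounds\<close>

text \<open>A Young inequality whose constants matter: for fixed \<eta> the factor
  \<open>\<eta> powr (- \<epsilon>)\<close> tends to 1 as \<epsilon> tends to 0. The mixed product
  is thus charged to \<open>q\<close> at a cost close to 1 and to \<open>p\<close> at the
  arbitrarily small cost \<eta>.\<close>

lemma powr_cross_le:
  fixes p q \<epsilon> \<eta> :: real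
  assumes "0 < p" "0 < q" "0 < \<epsilon>" "0 < \<eta>"
  shows "p powr \<epsilon> * q \<le> \<eta> * p powr (1 + \<epsilon>) + \<eta> powr (- \<epsilon>) * q powr (1 + \<epsilon>)"
proof (cases "q \<le> \<eta> * p")
  case True
  then have "p powr \<epsilon> * q \<le> p powr \<epsilon> * (\<eta> * p)" by (intro mult_left_mono) auto
  also have "\<dots> = \<eta> * p powr (1 + \<epsilon>)" using assms by (simp add: powr_add)
  finally show ?thesis by (simp add: add_increasing2)
next
  case False
  then have "p \<le> q / \<eta>" using assms by (simp add: field_simps)
  then have "p powr \<epsilon> * q \<le> (q / \<eta>) powr \<epsilon> * q" using assms by (intro mult_right_mono powr_mono2) auto
  also have "\<dots> = \<eta> powr (- \<epsilon>) * q powr (1 + \<epsilon>)" using assms by (simp add: powr_divide powr_add powr_minus field_simps)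
  finally show ?thesis using assms by (simp add: add_increasing)
qed

text \<open>Absorbs first-order terms into the power \<open>1 + \<epsilon>\<close> at the price of a
  constant.\<close>

lemma le_powr_plus_const:
  fixes p \<epsilon> \<eta> :: real
  assumes "0 < p" "0 < \<epsilon>" "0 < \<eta>"
  shows "p \<le> \<eta> * p powr (1 + \<epsilon>) + (1 / \<eta>) powr (1 / \<epsilon>)"
proof (cases "1 / \<eta> \<le> p powr \<epsilon>")
  case True
  then have "1 \<le> \<eta> * p powr \<epsilon>" using assms by (simp add: field_simps)
  then have "p * 1 \<le> p * (\<eta> * p powr \<epsilon>)" using assms by (intro mult_left_mono) auto
  also have "\<dots> = \<eta> * p powr (1 + \<epsilon>)" using assms by (simp add: powr_add)
  finally show ?thesis by (simp add: add_increasing2)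
next
  case False
  then have "(p powr \<epsilon>) powr (1 / \<epsilon>) \<le> (1 / \<eta>) powr (1 / \<epsilon>)" using assms by (intro powr_mono2) auto
  then have "p \<le> (1 / \<eta>) powr (1 / \<epsilon>)" using assms by (simp add: powr_powr)
  then show ?thesis using assms by (simp add: add_increasing)
qed

text \<open>The right-hand side is the drift of \<open>v1 * g X + v2 * g Y\<close> for a test function with \<open>g' = phi powr \<epsilon>\<close>,
  bounding \<open>g''\<close> from below, minus what \<open>g X - g X0\<close> can contribute through the drift of \<open>X\<close>.\<close>

definition coercive :: "real \<Rightarrow> real \<Rightarrow> real \<Rightarrow> real \<Rightarrow> real \<Rightarrow> real \<Rightarrow> real \<Rightarrow> real \<Rightarrow> real \<Rightarrow> real \<Rightarrow> real \<Rightarrow> bool" where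
  "coercive \<alpha> \<beta> \<gamma> \<delta> v1 v2 \<epsilon> \<kappa> k p q \<longleftrightarrow>
     \<kappa> * (p powr (1 + \<epsilon>) + q powr (1 + \<epsilon>)) - k \<le>
       v1 * (p powr \<epsilon> * (\<alpha> * p + \<beta> * q) - \<epsilon> / 2 * p powr (1 + \<epsilon>) - 3 * (\<alpha> * p - \<beta> * q)) +
       v2 * (q powr \<epsilon> * (\<delta> * q + \<gamma> * p) - \<epsilon> / 2 * q powr (1 + \<epsilon>) - 3 * (\<delta> * q - \<gamma> * p))"

text \<open>To leading order both powers carry the coefficient \<open>c\<close>, the determinant, by
  the choice of weights. Half of \<open>c\<close> is reserved for what vanishes with \<epsilon>, a
  quarter for the contributions of \<eta> and the first-order terms, and the last quarter is
  \<kappa>.\<close>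

lemma coercive_M_matrix:
  fixes \<alpha> \<beta> \<gamma> \<delta> :: real
  assumes s: "0 < \<alpha>" "0 < \<delta>" "\<beta> \<le> 0" "\<gamma> \<le> 0" and det: "\<beta> * \<gamma> < \<alpha> * \<delta>"
  shows "\<exists>\<epsilon> \<kappa> k. 0 < \<epsilon> \<and> \<epsilon> \<le> 1 / 2 \<and> 0 < \<kappa> \<and> 0 \<le> k \<and> (\<forall>p>0. \<forall>q>0. coercive \<alpha> \<beta> \<gamma> \<delta> (\<delta> - \<gamma>) (\<alpha> - \<beta>) \<epsilon> \<kappa> k p q)"
proof -
  define v1 v2 c where "v1 = \<delta> - \<gamma>" and "v2 = \<alpha> - \<beta>" and "c = \<alpha> * \<delta> - \<beta> * \<gamma>"
  define m where "m = 3 * (v1 * \<alpha> - v1 * \<beta> + v2 * \<delta> - v2 * \<gamma>)"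
  define n where "n = - v1 * \<beta> - v2 * \<gamma>"
  have v: "0 < v1" "0 < v2" "0 < c" using s det by (auto simp: v1_def v2_def c_def)
  have nonneg: "0 \<le> v1 * \<alpha>" "0 \<le> - v1 * \<beta>" "0 \<le> v2 * \<delta>" "0 \<le> - v2 * \<gamma>" using v s by (auto simp: mult_nonneg_nonpos)
  then have n: "0 \<le> n" and m: "0 \<le> m" by (auto simp: n_def m_def)
  have v1\<alpha>: "v1 * \<alpha> = c - v2 * \<gamma>" and v2\<delta>: "v2 * \<delta> = c - v1 * \<beta>" by (auto simp: v1_def v2_def c_def algebra_simps)
  \<comment> \<open>Sized for \<open>(n + m) * \<eta> \<le> c / 4\<close>. It is fixed before
    \<epsilon>, because \<open>\<eta> powr (- \<epsilon>)\<close> has to be made close to 1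
    afterwards.\<close>
  define \<eta> where "\<eta> = c / (4 * (n + m + 1))"
  have \<eta>: "0 < \<eta>" using v n m by (simp add: \<eta>_def)
  have \<eta>le: "(n + m) * \<eta> \<le> c / 4"
  proof -
    have "(n + m) * c \<le> (n + m + 1) * c" using v by simp
    then have "(n + m) * c / (4 * (n + m + 1)) \<le> (n + m + 1) * c / (4 * (n + m + 1))" using n m by (intro divide_right_mono) auto
    then show ?thesis using n m v by (simp add: \<eta>_def field_simps)
  qed
  \<comment> \<open>The limit on the right is 0, so every sufficiently small \<epsilon> is
    admissible.\<close>
  have "((\<lambda>\<epsilon>. v1 * \<epsilon> / 2 + v2 * \<epsilon> / 2 + n * (\<eta> powr (- \<epsilon>) - 1)) \<longlongrightarrow> v1 * 0 / 2 + v2 * 0 / 2 + n * (\<eta> powr (- 0) - 1)) (at_right 0)"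
    using \<eta> by (intro tendsto_intros) auto
  then have "eventually (\<lambda>\<epsilon>. v1 * \<epsilon> / 2 + v2 * \<epsilon> / 2 + n * (\<eta> powr (- \<epsilon>) - 1) < c / 2) (at_right 0)"
    using v \<eta> by (intro order_tendstoD(2)) auto
  moreover have "eventually (\<lambda>\<epsilon>::real. \<epsilon> \<in> {0<..<1/2}) (at_right 0)" by (rule eventually_at_right_real) simp
  ultimately have "eventually (\<lambda>\<epsilon>. v1 * \<epsilon> / 2 + v2 * \<epsilon> / 2 + n * (\<eta> powr (- \<epsilon>) - 1) < c / 2 \<and> \<epsilon> \<in> {0<..<1/2}) (at_right 0)"
    by eventually_elim simp
  then obtain \<epsilon> where e: "v1 * \<epsilon> / 2 + v2 * \<epsilon> / 2 + n * (\<eta> powr (- \<epsilon>) - 1) < c / 2" "0 < \<epsilon>" "\<epsilon> < 1/2"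
    using eventually_happens[of _ "at_right (0::real)"] by auto
  define N where "N = (1 / \<eta>) powr (1 / \<epsilon>)"
  define h where "h = \<eta> powr (- \<epsilon>)"
  have N: "0 \<le> N" and h: "0 \<le> h" by (auto simp: N_def h_def)
  have "coercive \<alpha> \<beta> \<gamma> \<delta> v1 v2 \<epsilon> (c / 4) (2 * m * N) p q" if pq: "0 < p" "0 < q" for p q
  proof -
    define P Q where "P = p powr (1 + \<epsilon>)" and "Q = q powr (1 + \<epsilon>)"
    have PQ: "0 \<le> P" "0 \<le> Q" by (auto simp: P_def Q_def)
    have pp: "p powr \<epsilon> * p = P" "q powr \<epsilon> * q = Q" using pq by (auto simp: P_def Q_def powr_add)
    have c1: "p powr \<epsilon> * q \<le> \<eta> * P + h * Q" and c2: "q powr \<epsilon> * p \<le> \<eta> * Q + h * P"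
      using powr_cross_le[OF pq e(2) \<eta>] powr_cross_le[OF pq(2,1) e(2) \<eta>] by (auto simp: P_def Q_def h_def)
    have l: "p \<le> \<eta> * P + N" "q \<le> \<eta> * Q + N"
      using le_powr_plus_const[OF pq(1) e(2) \<eta>] le_powr_plus_const[OF pq(2) e(2) \<eta>] by (auto simp: P_def Q_def N_def)
    have x1: "- v1 * \<beta> * (p powr \<epsilon> * q) \<le> - v1 * \<beta> * (\<eta> * P + h * Q)" by (rule mult_left_mono[OF c1 nonneg(2)])
    have x2: "- v2 * \<gamma> * (q powr \<epsilon> * p) \<le> - v2 * \<gamma> * (\<eta> * Q + h * P)" by (rule mult_left_mono[OF c2 nonneg(4)])
    have x3: "3 * v1 * (\<alpha> * p - \<beta> * q) + 3 * v2 * (\<delta> * q - \<gamma> * p) \<le> m * (\<eta> * P + N) + m * (\<eta> * Q + N)"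
    proof -
      have "3 * v1 * (\<alpha> * p - \<beta> * q) + 3 * v2 * (\<delta> * q - \<gamma> * p) = 3 * (v1 * \<alpha> + (- v2 * \<gamma>)) * p + 3 * ((- v1 * \<beta>) + v2 * \<delta>) * q"
        by (simp add: algebra_simps)
      also have "\<dots> \<le> m * p + m * q" using nonneg pq by (intro add_mono mult_right_mono) (auto simp: m_def)
      also have "\<dots> \<le> m * (\<eta> * P + N) + m * (\<eta> * Q + N)" using l m by (intro add_mono mult_left_mono) auto
      finally show ?thesis .
    qed
    have nsplit: "(- v1 * \<beta>) \<le> n" "(- v2 * \<gamma>) \<le> n" using nonneg by (auto simp: n_def)
    have k1: "c / 4 \<le> v1 * \<alpha> - v1 * \<epsilon> / 2 + v1 * \<beta> * \<eta> + v2 * \<gamma> * h - m * \<eta>"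
      and k2: "c / 4 \<le> v2 * \<delta> - v2 * \<epsilon> / 2 + v2 * \<gamma> * \<eta> + v1 * \<beta> * h - m * \<eta>"
    proof -
      have v\<epsilon>: "0 \<le> v1 * \<epsilon> / 2" "0 \<le> v2 * \<epsilon> / 2" using v e by auto
      have a1: "(- v1 * \<beta>) * \<eta> \<le> n * \<eta>" "(- v2 * \<gamma>) * \<eta> \<le> n * \<eta>" 
        by (rule mult_right_mono[OF nsplit(1)] mult_right_mono[OF nsplit(2)], use \<eta> in simp)+
      have a2: "(n + m) * \<eta> = n * \<eta> + m * \<eta>" by (simp add: algebra_simps)
      have h1: "v2 * \<gamma> * h = v2 * \<gamma> - (- v2 * \<gamma>) * (h - 1)" "v1 * \<beta> * h = v1 * \<beta> - (- v1 * \<beta>) * (h - 1)" by (auto simp: algebra_simps)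
      have h2: "(- v2 * \<gamma>) * (h - 1) \<le> c / 2 - v1 * \<epsilon> / 2 - v2 * \<epsilon> / 2" "(- v1 * \<beta>) * (h - 1) \<le> c / 2 - v1 * \<epsilon> / 2 - v2 * \<epsilon> / 2"
      proof -
        have eh: "n * (h - 1) < c / 2 - v1 * \<epsilon> / 2 - v2 * \<epsilon> / 2" using e(1) unfolding h_def by linarith
        \<comment> \<open>Gives \<open>h \<ge> 1\<close>, so that in front of \<open>h - 1\<close>
          each cross coefficient may be replaced by the larger \<open>n\<close>.\<close>
        have "\<eta> < 1"
        proof -
          have "c \<le> m" 
          proof -
            have "c \<le> v1 * \<alpha>" using v1\<alpha> nonneg by linarith
            then show ?thesis using nonneg by (simp add: m_def)
          qed
          then show ?thesis using n v by (simp add: \<eta>_def field_simps)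
        qed
        then have "\<eta> powr \<epsilon> \<le> 1" using \<eta> e(2) by (intro powr_le1) auto
        then have h1: "1 \<le> h" unfolding h_def using \<eta> by (simp add: powr_minus_divide)
        have "(- v2 * \<gamma>) * (h - 1) \<le> n * (h - 1)" "(- v1 * \<beta>) * (h - 1) \<le> n * (h - 1)"
          by (rule mult_right_mono[OF nsplit(2)] mult_right_mono[OF nsplit(1)], use h1 in simp)+
        then show "(- v2 * \<gamma>) * (h - 1) \<le> c / 2 - v1 * \<epsilon> / 2 - v2 * \<epsilon> / 2" "(- v1 * \<beta>) * (h - 1) \<le> c / 2 - v1 * \<epsilon> / 2 - v2 * \<epsilon> / 2"
          using eh by linarith+
      qed
      show "c / 4 \<le> v1 * \<alpha> - v1 * \<epsilon> / 2 + v1 * \<beta> * \<eta> + v2 * \<gamma> * h - m * \<eta>"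
        using h1(1) h2(1) a1(1) a2 \<eta>le v\<epsilon> v1\<alpha> by (simp only: mult_minus_left)
      show "c / 4 \<le> v2 * \<delta> - v2 * \<epsilon> / 2 + v2 * \<gamma> * \<eta> + v1 * \<beta> * h - m * \<eta>"
        using h1(2) h2(2) a1(2) a2 \<eta>le v\<epsilon> v2\<delta> by (simp only: mult_minus_left)
    qed
    have "c / 4 * (P + Q) - 2 * m * N \<le> (v1 * \<alpha> - v1 * \<epsilon> / 2 + v1 * \<beta> * \<eta> + v2 * \<gamma> * h - m * \<eta>) * P
         + (v2 * \<delta> - v2 * \<epsilon> / 2 + v2 * \<gamma> * \<eta> + v1 * \<beta> * h - m * \<eta>) * Q - 2 * m * N"
      using mult_right_mono[OF k1 PQ(1)] mult_right_mono[OF k2 PQ(2)] distrib_left[of "c / 4" P Q] by linarith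
    also have "\<dots> = v1 * \<alpha> * P - v1 * (\<epsilon> / 2 * P) - (- v1 * \<beta> * (\<eta> * P + h * Q)) + v2 * \<delta> * Q - v2 * (\<epsilon> / 2 * Q)
         - (- v2 * \<gamma> * (\<eta> * Q + h * P)) - (m * (\<eta> * P + N) + m * (\<eta> * Q + N))"
      by (simp add: algebra_simps)
    also have "\<dots> \<le> v1 * \<alpha> * P - v1 * (\<epsilon> / 2 * P) - (- v1 * \<beta> * (p powr \<epsilon> * q)) + v2 * \<delta> * Q - v2 * (\<epsilon> / 2 * Q)
         - (- v2 * \<gamma> * (q powr \<epsilon> * p)) - (3 * v1 * (\<alpha> * p - \<beta> * q) + 3 * v2 * (\<delta> * q - \<gamma> * p))"
      using x1 x2 x3 by linarith
    also have "\<dots> = v1 * (p powr \<epsilon> * (\<alpha> * p + \<beta> * q) - \<epsilon> / 2 * P - 3 * (\<alpha> * p - \<beta> * q)) +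
       v2 * (q powr \<epsilon> * (\<delta> * q + \<gamma> * p) - \<epsilon> / 2 * Q - 3 * (\<delta> * q - \<gamma> * p))"
      unfolding pp[symmetric] by (simp add: algebra_simps)
    finally show ?thesis unfolding coercive_def P_def Q_def .
  qed
  then show ?thesis
    using e v m N unfolding v1_def[symmetric] v2_def[symmetric]
    by (intro exI[of _ \<epsilon>] exI[of _ "c / 4"] exI[of _ "2 * m * N"]) auto
qed

text \<open>The determinant is 0 here and leaves no surplus. But if one of \<open>p\<close> and
  \<open>q\<close> stays below \<open>R\<close>, each mixed product is at most linear in
  \<open>p\<close> and \<open>q\<close>, hence of lower order than the diagonal powers.\<close>

lemma coercive_antisymmetric:
  fixes \<alpha> \<delta> R :: real
  assumes s: "0 < \<alpha>" "0 < \<delta>" and R: "1 \<le> R"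
  shows "\<exists>\<epsilon> \<kappa> k. 0 < \<epsilon> \<and> \<epsilon> \<le> 1 / 2 \<and> 0 < \<kappa> \<and> 0 \<le> k \<and>
    (\<forall>p>0. \<forall>q>0. p \<le> R \<or> q \<le> R \<longrightarrow> coercive \<alpha> (- \<delta>) (- \<alpha>) \<delta> 1 1 \<epsilon> \<kappa> k p q)"
proof -
  \<comment> \<open>With \<epsilon> below \<alpha> and \<delta>, each diagonal coefficient keeps at
    least \<open>\<epsilon> / 2\<close> after the second-order loss of
    \<open>\<epsilon> / 2\<close>.\<close>
  define \<epsilon> where "\<epsilon> = min (1/2) (min \<alpha> \<delta>)"
  have e: "0 < \<epsilon>" "\<epsilon> \<le> 1/2" "\<epsilon> \<le> \<alpha>" "\<epsilon> \<le> \<delta>" using s by (auto simp: \<epsilon>_def)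
  \<comment> \<open>The total coefficient of linear terms: \<open>(\<alpha> + \<delta>) * R\<close>
    from the mixed products, and 6 because each drift term incurs the penalty 3 in both
    components.\<close>
  define m where "m = (\<alpha> + \<delta>) * R + 6 * (\<alpha> + \<delta>)"
  have m: "0 < m" using s R by (simp add: m_def add_pos_pos)
  define \<eta> where "\<eta> = \<epsilon> / (4 * m)"
  have \<eta>: "0 < \<eta>" "m * \<eta> = \<epsilon> / 4" using m e by (auto simp: \<eta>_def field_simps)
  define N where "N = (1 / \<eta>) powr (1 / \<epsilon>)"
  have N: "0 \<le> N" by (simp add: N_def)
  have "coercive \<alpha> (- \<delta>) (- \<alpha>) \<delta> 1 1 \<epsilon> (\<epsilon> / 4) (m * (1 + 2 * N)) p q" if pq: "0 < p" "0 < q" "p \<le> R \<or> q \<le> R" for p q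
  proof -
    define P Q where "P = p powr (1 + \<epsilon>)" and "Q = q powr (1 + \<epsilon>)"
    have PQ: "0 \<le> P" "0 \<le> Q" by (auto simp: P_def Q_def)
    have pp: "p powr \<epsilon> * p = P" "q powr \<epsilon> * q = Q" using pq by (auto simp: P_def Q_def powr_add)
    have l: "p \<le> \<eta> * P + N" "q \<le> \<eta> * Q + N"
      using le_powr_plus_const[OF pq(1) e(1) \<eta>(1)] le_powr_plus_const[OF pq(2) e(1) \<eta>(1)] by (auto simp: P_def Q_def N_def)
    have pw: "x powr \<epsilon> \<le> 1 + x" if "0 < x" for x :: real
    proof (cases "x \<le> 1")
      case True
      then have "x powr \<epsilon> \<le> 1" using that e by (intro powr_le1) auto
      then show ?thesis using that by simp
    next
      case False
      then have "x powr \<epsilon> \<le> x powr 1" using e by (intro powr_mono) auto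
      then show ?thesis using that by simp
    qed
    \<comment> \<open>If \<open>y\<close> is the bounded one, use
      \<open>x powr \<epsilon> \<le> 1 + x\<close>; otherwise \<open>x \<le> R\<close>, and
      \<open>x powr \<epsilon> \<le> R\<close> because \<open>R \<ge> 1\<close>.\<close>
    have cr: "x powr \<epsilon> * y \<le> R * (1 + x + y)" if xy: "0 < x" "0 < y" "x \<le> R \<or> y \<le> R" for x y
    proof (cases "y \<le> R")
      case True
      have "x powr \<epsilon> * y \<le> (1 + x) * R" using pw[OF xy(1)] xy True by (intro mult_mono) auto
      also have "\<dots> \<le> R * (1 + x + y)" using R xy by (simp add: algebra_simps)
      finally show ?thesis .
    next
      case False
      then have "x powr \<epsilon> \<le> R powr \<epsilon>" using xy e by (intro powr_mono2) auto
      also have "\<dots> \<le> R powr 1" using R e by (intro powr_mono) auto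
      finally have "x powr \<epsilon> * y \<le> R * y" using R xy by (intro mult_right_mono) auto
      also have "\<dots> \<le> R * (1 + x + y)" using R xy by (intro mult_left_mono) auto
      finally show ?thesis .
    qed
    have c1: "\<delta> * (p powr \<epsilon> * q) \<le> \<delta> * (R * (1 + p + q))" using cr[OF pq(1,2)] pq(3) s by (intro mult_left_mono) auto
    have c2: "\<alpha> * (q powr \<epsilon> * p) \<le> \<alpha> * (R * (1 + p + q))" using cr[OF pq(2,1)] pq(3) s by (intro mult_left_mono) (auto simp: add.commute add.left_commute)
    have c3: "6 * (\<alpha> * p + \<delta> * q) \<le> 6 * (\<alpha> + \<delta>) * (1 + p + q)"
    proof -
      have "\<alpha> * p + \<delta> * q \<le> (\<alpha> + \<delta>) * p + (\<alpha> + \<delta>) * q" using s pq by (intro add_mono mult_right_mono) auto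
      also have "\<dots> \<le> (\<alpha> + \<delta>) * (1 + p + q)" using s by (simp add: algebra_simps)
      finally have "6 * (\<alpha> * p + \<delta> * q) \<le> 6 * ((\<alpha> + \<delta>) * (1 + p + q))" by (rule mult_left_mono) simp
      then show ?thesis by (simp only: mult.assoc)
    qed
    have "m * (1 + p + q) \<le> m * (1 + (\<eta> * P + N) + (\<eta> * Q + N))" using l m by (intro mult_left_mono add_mono) auto
    also have "\<dots> = (m * \<eta>) * P + (m * \<eta>) * Q + m * (1 + 2 * N)" by (simp add: algebra_simps)
    finally have lin: "m * (1 + p + q) \<le> \<epsilon> / 4 * P + \<epsilon> / 4 * Q + m * (1 + 2 * N)" unfolding \<eta>(2) .
    have k: "\<epsilon> / 2 * P \<le> (\<alpha> - \<epsilon> / 2) * P" "\<epsilon> / 2 * Q \<le> (\<delta> - \<epsilon> / 2) * Q" 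
      by (rule mult_right_mono; use e PQ in simp)+
    have mm: "m * (1 + p + q) = \<delta> * (R * (1 + p + q)) + \<alpha> * (R * (1 + p + q)) + 6 * (\<alpha> + \<delta>) * (1 + p + q)"
      unfolding m_def by (simp add: algebra_simps)
    have "\<epsilon> / 4 * (P + Q) - m * (1 + 2 * N) = \<epsilon> / 2 * P + \<epsilon> / 2 * Q - (\<epsilon> / 4 * P + \<epsilon> / 4 * Q + m * (1 + 2 * N))" by (simp add: algebra_simps)
    also have "\<dots> \<le> (\<alpha> - \<epsilon> / 2) * P + (\<delta> - \<epsilon> / 2) * Q - \<delta> * (p powr \<epsilon> * q) - \<alpha> * (q powr \<epsilon> * p) - 6 * (\<alpha> * p + \<delta> * q)"
      using k lin mm c1 c2 c3 by linarith
    also have "\<dots> = 1 * (p powr \<epsilon> * (\<alpha> * p + - \<delta> * q) - \<epsilon> / 2 * P - 3 * (\<alpha> * p - - \<delta> * q)) +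
       1 * (q powr \<epsilon> * (\<delta> * q + - \<alpha> * p) - \<epsilon> / 2 * Q - 3 * (\<delta> * q - - \<alpha> * p))"
      unfolding pp[symmetric] by (simp add: algebra_simps)
    finally show ?thesis unfolding coercive_def P_def Q_def .
  qed
  then show ?thesis using e m N by (intro exI[of _ \<epsilon>] exI[of _ "\<epsilon> / 4"] exI[of _ "m * (1 + 2 * N)"]) auto
qed

context bessel_driver
begin

definition H where "H \<epsilon> a t \<omega> = integral {0..t} (\<lambda>s. P a s \<omega> powr (1 + \<epsilon>) + Q a s \<omega> powr (1 + \<epsilon>))"

lemma PQ_powr_continuous:
  assumes "0 < a" "\<omega> \<in> space M" "S \<subseteq> {0..}"
  shows "continuous_on S (\<lambda>s. P a s \<omega> powr r)" "continuous_on S (\<lambda>s. Q a s \<omega> powr r)"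
  using PQ_continuous[OF assms] phi_pos[OF assms(1)] by (auto intro!: continuous_intros simp: less_imp_neq[symmetric])

lemma H_integrable:
  assumes "0 < a" "\<omega> \<in> space M"
  shows "(\<lambda>s. P a s \<omega> powr (1 + \<epsilon>) + Q a s \<omega> powr (1 + \<epsilon>)) integrable_on {0..t}"
  by (intro integrable_continuous_interval continuous_intros PQ_powr_continuous assms) auto

lemma H_mono:
  assumes "0 < a" "\<omega> \<in> space M" "0 \<le> t" "t \<le> T"
  shows "0 \<le> H \<epsilon> a t \<omega>" "H \<epsilon> a t \<omega> \<le> H \<epsilon> a T \<omega>"
  unfolding H_def using assms(3,4)
  by (auto intro!: integral_nonneg integral_subset_le H_integrable assms(1,2))

text \<open>The two component inequalities are added with weights, and coercivity is used at each
  time. The bound is free of \<open>a\<close>, which the summation over \<open>a = (1/2) ^ k\<close>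
  relies on.\<close>

lemma moment_bound:
  assumes a: "0 < a" and \<epsilon>: "0 < \<epsilon>" "\<epsilon> \<le> 1 / 2" and T: "0 < T" and A: "A \<in> sets (F 0)"
    and v: "0 \<le> v1" "0 \<le> v2" and \<kappa>: "0 < \<kappa>" and k: "0 \<le> k"
    and key: "\<And>\<omega> s. \<omega> \<in> A \<Longrightarrow> 0 \<le> s \<Longrightarrow> coercive \<alpha> \<beta> \<gamma> \<delta> v1 v2 \<epsilon> \<kappa> k (P a s \<omega>) (Q a s \<omega>)"
  shows "integrable M (\<lambda>\<omega>. indicator A \<omega> * H \<epsilon> a T \<omega>)"
    and "(\<integral>\<omega>. indicator A \<omega> * H \<epsilon> a T \<omega> \<partial>M) \<le> (k * T + (v1 + v2) * (2 + 3 * (sqrt (2 / pi) * sqrt T))) / \<kappa>"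
proof -
  have AM[measurable]: "A \<in> events" using A sets_F by auto
  note [measurable] = borel_measurable_phi[OF a]
  have BCF: "0 \<le> t \<Longrightarrow> B t \<in> borel_measurable (F t)" "0 \<le> t \<Longrightarrow> C t \<in> borel_measurable (F t)" for t
    using BC_G[of t] measurable_G_F[of t] by auto
  have PQm: "P a s \<in> borel_measurable M" "Q a s \<in> borel_measurable M" if "0 \<le> s" for s
    using XY_measurable(5,6)[OF a that] by measurable
  have PQc: "continuous_on {0..} (\<lambda>s. P a s \<omega>)" "continuous_on {0..} (\<lambda>s. Q a s \<omega>)" if "\<omega> \<in> space M" for \<omega>
    using PQ_continuous[OF a that] by auto
  have b: "0 \<le> phi a x" "phi a x \<le> 1 / a" for x using phi_pos[OF a, of x] phi_le[OF a, of x] by auto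
  have ini: "0 \<le> X a 0 \<omega>" "0 \<le> Y a 0 \<omega>" if "\<omega> \<in> space M" for \<omega>
    using init_nonneg[OF that] XY_0[OF a that] by auto
  have eq: "X a t \<omega> = X a 0 \<omega> + B t \<omega> + integral {0..t} (\<lambda>s. \<alpha> * phi a (X a s \<omega>) + \<beta> * Q a s \<omega>)"
    "Y a t \<omega> = Y a 0 \<omega> + C t \<omega> + integral {0..t} (\<lambda>s. \<delta> * phi a (Y a s \<omega>) + \<gamma> * P a s \<omega>)"
    if "\<omega> \<in> space M" "0 \<le> t" for \<omega> t
    using XY_eq[OF a that] XY_0[OF a that(1)] by (auto simp: add.commute[of "\<gamma> * _"])
  let ?JX = "\<lambda>s \<omega>. P a s \<omega> powr \<epsilon> * (\<alpha> * P a s \<omega> + \<beta> * Q a s \<omega>) - \<epsilon> / 2 * P a s \<omega> powr (1 + \<epsilon>) - 3 * (\<alpha> * P a s \<omega> - \<beta> * Q a s \<omega>)"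
  let ?JY = "\<lambda>s \<omega>. Q a s \<omega> powr \<epsilon> * (\<delta> * Q a s \<omega> + \<gamma> * P a s \<omega>) - \<epsilon> / 2 * Q a s \<omega> powr (1 + \<epsilon>) - 3 * (\<delta> * Q a s \<omega> - \<gamma> * P a s \<omega>)"
  let ?E = "2 + 3 * (sqrt (2 / pi) * sqrt T)"
  note cX = component_moment_inequality[where W = B and Z = "X a" and q = "Q a",
        OF a \<epsilon> T A less_imp_le[OF signs(1)] signs(3) BCF(1) BC_gauss(1) BC_0(1) XY_measurable(3)[OF a] ini(1)
          XY_continuous(1)[OF a] PQm(2) PQc(2) b eq(1)]
  have X1: "integrable M (\<lambda>\<omega>. indicator A \<omega> * integral {0..T} (\<lambda>s. ?JX s \<omega>))"
    by (rule cX(1))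
  have X2: "(\<integral>\<omega>. indicator A \<omega> * integral {0..T} (\<lambda>s. ?JX s \<omega>) \<partial>M) \<le> ?E"
    by (rule cX(2))
  note cY = component_moment_inequality[where W = C and Z = "Y a" and q = "P a",
        OF a \<epsilon> T A less_imp_le[OF signs(2)] signs(4) BCF(2) BC_gauss(2) BC_0(2) XY_measurable(4)[OF a] ini(2)
          XY_continuous(2)[OF a] PQm(1) PQc(1) b eq(2)]
  have Y1: "integrable M (\<lambda>\<omega>. indicator A \<omega> * integral {0..T} (\<lambda>s. ?JY s \<omega>))"
    by (rule cY(1))
  have Y2: "(\<integral>\<omega>. indicator A \<omega> * integral {0..T} (\<lambda>s. ?JY s \<omega>) \<partial>M) \<le> ?E"
    by (rule cY(2))
  have pb: "\<bar>phi a x powr (1 + \<epsilon>)\<bar> \<le> (1/a) powr (1 + \<epsilon>)" for x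
    using b[of x] \<epsilon> by (auto intro!: powr_mono2)
  show iH: "integrable M (\<lambda>\<omega>. indicator A \<omega> * H \<epsilon> a T \<omega>)"
    unfolding H_def
  proof (rule integrable_path_integral[OF AM])
    show "(\<lambda>\<omega>. P a s \<omega> powr (1 + \<epsilon>) + Q a s \<omega> powr (1 + \<epsilon>)) \<in> borel_measurable M" if "0 \<le> s" for s
      using PQm[OF that] by measurable
    show "\<bar>P a s \<omega> powr (1 + \<epsilon>) + Q a s \<omega> powr (1 + \<epsilon>)\<bar> \<le> (1/a) powr (1 + \<epsilon>) + (1/a) powr (1 + \<epsilon>)" for s \<omega>
      by (rule order_trans[OF abs_triangle_ineq add_mono[OF pb pb]])
  qed (use T in \<open>auto intro!: continuous_intros PQ_powr_continuous a\<close>)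
  have path: "\<kappa> * (indicator A \<omega> * H \<epsilon> a T \<omega>) \<le> v1 * (indicator A \<omega> * integral {0..T} (\<lambda>s. ?JX s \<omega>))
      + v2 * (indicator A \<omega> * integral {0..T} (\<lambda>s. ?JY s \<omega>)) + k * T" if \<omega>: "\<omega> \<in> space M" for \<omega>
  proof (cases "\<omega> \<in> A")
    case True
    have sub: "{0..T} \<subseteq> {0..}" by auto
    have JXi: "(\<lambda>s. ?JX s \<omega>) integrable_on {0..T}" "(\<lambda>s. ?JY s \<omega>) integrable_on {0..T}"
      by (intro integrable_continuous_interval continuous_intros PQ_powr_continuous[OF a \<omega>] PQ_continuous[OF a \<omega>] sub)+
    have Hi: "(\<lambda>s. P a s \<omega> powr (1 + \<epsilon>) + Q a s \<omega> powr (1 + \<epsilon>)) integrable_on {0..T}" by (rule H_integrable[OF a \<omega>])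
    have "\<kappa> * H \<epsilon> a T \<omega> - k * T = integral {0..T} (\<lambda>s. \<kappa> * (P a s \<omega> powr (1 + \<epsilon>) + Q a s \<omega> powr (1 + \<epsilon>)) - k)"
      unfolding H_def using T Hi by (subst integral_diff) (auto intro!: integrable_on_mult_right integrable_const_ivl simp del: integral_mult_right, simp)
    also have "\<dots> \<le> integral {0..T} (\<lambda>s. v1 * ?JX s \<omega> + v2 * ?JY s \<omega>)"
      using key[OF True, unfolded coercive_def]
      by (intro integral_le integrable_diff integrable_add integrable_on_mult_right integrable_const_ivl Hi JXi) auto
    also have "\<dots> = v1 * integral {0..T} (\<lambda>s. ?JX s \<omega>) + v2 * integral {0..T} (\<lambda>s. ?JY s \<omega>)"
      by (simp only: integral_add[OF integrable_on_mult_right[OF JXi(1)] integrable_on_mult_right[OF JXi(2)]] integral_mult_right)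
    finally show ?thesis using True by simp
  qed (use k T in simp)
  have "\<kappa> * (\<integral>\<omega>. indicator A \<omega> * H \<epsilon> a T \<omega> \<partial>M) = (\<integral>\<omega>. \<kappa> * (indicator A \<omega> * H \<epsilon> a T \<omega>) \<partial>M)" by simp
  also have "\<dots> \<le> (\<integral>\<omega>. v1 * (indicator A \<omega> * integral {0..T} (\<lambda>s. ?JX s \<omega>))
      + v2 * (indicator A \<omega> * integral {0..T} (\<lambda>s. ?JY s \<omega>)) + k * T \<partial>M)"
    using iH X1 Y1 path
    by (intro integral_mono Bochner_Integration.integrable_add integrable_mult_right integrable_const) auto
  also have "\<dots> = v1 * (\<integral>\<omega>. indicator A \<omega> * integral {0..T} (\<lambda>s. ?JX s \<omega>) \<partial>M)
      + v2 * (\<integral>\<omega>. indicator A \<omega> * integral {0..T} (\<lambda>s. ?JY s \<omega>) \<partial>M) + k * T"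
    by (subst Bochner_Integration.integral_add[OF Bochner_Integration.integrable_add[OF integrable_mult_right[OF X1] integrable_mult_right[OF Y1]] integrable_const],
        subst Bochner_Integration.integral_add[OF integrable_mult_right[OF X1] integrable_mult_right[OF Y1]]) (simp add: prob_space)
  also have "\<dots> \<le> v1 * ?E + v2 * ?E + k * T" using mult_left_mono[OF X2 v(1)] mult_left_mono[OF Y2 v(2)] by linarith
  finally show "(\<integral>\<omega>. indicator A \<omega> * H \<epsilon> a T \<omega> \<partial>M) \<le> (k * T + (v1 + v2) * ?E) / \<kappa>"
    using \<kappa> by (simp add: field_simps)
qed

end

section \<open>Convergence of the approximations\<close>

lemma integral_lincomb4:
  fixes f g h k :: "real \<Rightarrow> real"
  assumes "f integrable_on S" "g integrable_on S" "h integrable_on S" "k integrable_on S"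
  shows "integral S (\<lambda>s. u * f s + v * g s + w * h s + z * k s) = u * integral S f + v * integral S g + w * integral S h + z * integral S k"
    and "(\<lambda>s. u * f s + v * g s + w * h s + z * k s) integrable_on S"
proof -
  have i: "(\<lambda>s. u * f s) integrable_on S" "(\<lambda>s. v * g s) integrable_on S" "(\<lambda>s. w * h s) integrable_on S" "(\<lambda>s. z * k s) integrable_on S"
    using assms by (auto intro!: integrable_on_mult_right)
  show "(\<lambda>s. u * f s + v * g s + w * h s + z * k s) integrable_on S" by (intro integrable_add i)
  show "integral S (\<lambda>s. u * f s + v * g s + w * h s + z * k s) = u * integral S f + v * integral S g + w * integral S h + z * integral S k"
    by (simp only: integral_add[OF integrable_add[OF integrable_add[OF i(1,2)] i(3)] i(4)]
      integral_add[OF integrable_add[OF i(1,2)] i(3)] integral_add[OF i(1,2)] integral_mult_right)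
qed

context bessel_driver
begin

text \<open>The effect of changing the parameter alone, measured along the finer solution; it is
  nonnegative when \<open>b \<le> a\<close>.\<close>

abbreviation "errX a b s \<omega> \<equiv> P b s \<omega> - phi a (X b s \<omega>)"
abbreviation "errY a b s \<omega> \<equiv> Q b s \<omega> - phi a (Y b s \<omega>)"

lemma approximation_error:
  assumes "0 < b" "b \<le> a" "\<omega> \<in> space M"
  shows "(\<lambda>s. errX a b s \<omega>) integrable_on {0..t}" "(\<lambda>s. errY a b s \<omega>) integrable_on {0..t}"
    "(\<lambda>s. \<bar>P a s \<omega> - P b s \<omega>\<bar>) integrable_on {0..t}" "(\<lambda>s. \<bar>Q a s \<omega> - Q b s \<omega>\<bar>) integrable_on {0..t}"
    "\<And>s. 0 \<le> errX a b s \<omega>" "\<And>s. 0 \<le> errY a b s \<omega>"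
proof -
  have a: "0 < a" using assms by simp
  have sub: "{0..t} \<subseteq> {0..}" by auto
  note c = PQ_continuous[OF a assms(3) sub] PQ_continuous[OF assms(1,3) sub]
    continuous_on_phi[OF a continuous_on_subset[OF XY_continuous(1)[OF assms(1,3)] sub]]
    continuous_on_phi[OF a continuous_on_subset[OF XY_continuous(2)[OF assms(1,3)] sub]]
  show "(\<lambda>s. errX a b s \<omega>) integrable_on {0..t}" "(\<lambda>s. errY a b s \<omega>) integrable_on {0..t}"
    "(\<lambda>s. \<bar>P a s \<omega> - P b s \<omega>\<bar>) integrable_on {0..t}" "(\<lambda>s. \<bar>Q a s \<omega> - Q b s \<omega>\<bar>) integrable_on {0..t}"
    by (intro integrable_continuous_interval continuous_intros c)+
  show "0 \<le> errX a b s \<omega>" "0 \<le> errY a b s \<omega>" for s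
    using phi_mono_param[OF assms(1,2)] by auto
qed

text \<open>Two approximations share noise and initial values, so their difference is an integral of
  drift differences. As \<open>phi\<close> has no singularity, no exceptional times are
  needed.\<close>

lemma approximation_diff:
  assumes b: "0 < b" "b \<le> a" and \<omega>: "\<omega> \<in> space M" and t: "0 \<le> t"
  shows "h integrable_on {0..t} \<Longrightarrow> (\<And>s. s \<in> {0..t} \<Longrightarrow> sgn (X a s \<omega> - X b s \<omega>) * (\<alpha> * (P a s \<omega> - P b s \<omega>) + \<beta> * (Q a s \<omega> - Q b s \<omega>)) \<le> h s)
      \<Longrightarrow> \<bar>X a t \<omega> - X b t \<omega>\<bar> \<le> integral {0..t} h"
    and "h integrable_on {0..t} \<Longrightarrow> (\<And>s. s \<in> {0..t} \<Longrightarrow> sgn (Y a s \<omega> - Y b s \<omega>) * (\<gamma> * (P a s \<omega> - P b s \<omega>) + \<delta> * (Q a s \<omega> - Q b s \<omega>)) \<le> h s)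
      \<Longrightarrow> \<bar>Y a t \<omega> - Y b t \<omega>\<bar> \<le> integral {0..t} h"
proof -
  have a: "0 < a" using b by simp
  have sub: "{0..t} \<subseteq> {0..}" by auto
  have ac: "(\<lambda>s. u * (P a s \<omega> - P b s \<omega>) + v * (Q a s \<omega> - Q b s \<omega>)) absolutely_integrable_on {0..t}" for u v
    by (intro absolutely_integrable_continuous_real continuous_intros PQ_continuous[OF a \<omega> sub] PQ_continuous[OF b(1) \<omega> sub])
  have comb: "integral {0..s} (\<lambda>s. u * P a s \<omega> + v * Q a s \<omega>) - integral {0..s} (\<lambda>s. u * P b s \<omega> + v * Q b s \<omega>)
      = integral {0..s} (\<lambda>s. u * (P a s \<omega> - P b s \<omega>) + v * (Q a s \<omega> - Q b s \<omega>))" for u v s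
    by (subst integral_diff[symmetric])
      (auto intro!: integrable_add integrable_on_mult_right PQ_integrable a b \<omega> integral_cong simp: algebra_simps)
  have D: "X a s \<omega> - X b s \<omega> = integral {0..s} (\<lambda>s. \<alpha> * (P a s \<omega> - P b s \<omega>) + \<beta> * (Q a s \<omega> - Q b s \<omega>))"
    "Y a s \<omega> - Y b s \<omega> = integral {0..s} (\<lambda>s. \<gamma> * (P a s \<omega> - P b s \<omega>) + \<delta> * (Q a s \<omega> - Q b s \<omega>))" if s: "s \<in> {0..t}" for s
    unfolding comb[symmetric] using XY_eq[OF a \<omega>, of s] XY_eq[OF b(1) \<omega>, of s] s by auto
  assume h: "h integrable_on {0..t}"
  { assume "\<And>s. s \<in> {0..t} \<Longrightarrow> sgn (X a s \<omega> - X b s \<omega>) * (\<alpha> * (P a s \<omega> - P b s \<omega>) + \<beta> * (Q a s \<omega> - Q b s \<omega>)) \<le> h s"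
    then show "\<bar>X a t \<omega> - X b t \<omega>\<bar> \<le> integral {0..t} h"
      by (intro abs_integral_le_of_sgn_le[where D = "\<lambda>s. X a s \<omega> - X b s \<omega>", OF ac t D(1) negligible_empty h]) auto }
  { assume "\<And>s. s \<in> {0..t} \<Longrightarrow> sgn (Y a s \<omega> - Y b s \<omega>) * (\<gamma> * (P a s \<omega> - P b s \<omega>) + \<delta> * (Q a s \<omega> - Q b s \<omega>)) \<le> h s"
    then show "\<bar>Y a t \<omega> - Y b t \<omega>\<bar> \<le> integral {0..t} h"
      by (intro abs_integral_le_of_sgn_le[where D = "\<lambda>s. Y a s \<omega> - Y b s \<omega>", OF ac t D(2) negligible_empty h]) auto }
qed

text \<open>The constant is uniform in \<open>a\<close>, \<open>b\<close> and \<open>t\<close>.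
  Isolating the estimate lets the two regimes supply it by different arguments, while the passage to
  the limit is made only once.\<close>

definition stable :: "'a set \<Rightarrow> real \<Rightarrow> bool" where
  "stable A c \<longleftrightarrow> (\<forall>a b t \<omega>. 0 < b \<longrightarrow> b \<le> a \<longrightarrow> 0 \<le> t \<longrightarrow> \<omega> \<in> A \<longrightarrow>
     \<bar>X a t \<omega> - X b t \<omega>\<bar> + \<bar>Y a t \<omega> - Y b t \<omega>\<bar> + integral {0..t} (\<lambda>s. \<bar>P a s \<omega> - P b s \<omega>\<bar>)
       + integral {0..t} (\<lambda>s. \<bar>Q a s \<omega> - Q b s \<omega>\<bar>)
     \<le> c * (integral {0..t} (\<lambda>s. errX a b s \<omega>) + integral {0..t} (\<lambda>s. errY a b s \<omega>)))"

text \<open>The uniqueness argument with the parameter error of \<open>sgn_phi_diff\<close> added.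
  The strictly positive determinant \<open>d\<close> leaves \<open>d\<close> times the
  \<open>L1\<close> distances of the reciprocals on the left, which is more than uniqueness
  needs.\<close>

lemma stable_M_matrix:
  assumes det: "\<beta> * \<gamma> < \<alpha> * \<delta>"
  shows "\<exists>c\<ge>0. stable (space M) c"
proof -
  define v1 v2 d where "v1 = \<delta> - \<gamma>" and "v2 = \<alpha> - \<beta>" and "d = \<alpha> * \<delta> - \<beta> * \<gamma>"
  have v: "0 < v1" "0 < v2" "0 < d" using signs det by (auto simp: v1_def v2_def d_def)
  have vd: "v1 * \<alpha> + v2 * \<gamma> = d" "v2 * \<delta> + v1 * \<beta> = d" by (auto simp: v1_def v2_def d_def algebra_simps)
  \<comment> \<open>A common lower bound for the four coefficients on the left of the weighted
    estimate.\<close>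
  define m where "m = min v1 (min v2 d)"
  have m: "0 < m" "m \<le> v1" "m \<le> v2" "m \<le> d" using v by (auto simp: m_def)
  define c where "c = (2 * v1 * \<alpha> + 2 * v2 * \<delta>) / m"
  have c0: "0 \<le> c" using v m signs by (simp add: c_def)
  have "stable (space M) c"
    unfolding stable_def
  proof (intro allI impI)
    fix a b t :: real and \<omega> assume b: "0 < b" "b \<le> a" and t: "0 \<le> t" and \<omega>: "\<omega> \<in> space M"
    let ?IX = "integral {0..t} (\<lambda>s. errX a b s \<omega>)" and ?IY = "integral {0..t} (\<lambda>s. errY a b s \<omega>)"
    let ?IP = "integral {0..t} (\<lambda>s. \<bar>P a s \<omega> - P b s \<omega>\<bar>)" and ?IQ = "integral {0..t} (\<lambda>s. \<bar>Q a s \<omega> - Q b s \<omega>\<bar>)"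
    note E = approximation_error[OF b \<omega>]
    have I0: "0 \<le> ?IX" "0 \<le> ?IY" "0 \<le> ?IP" "0 \<le> ?IQ" using E by (auto intro!: integral_nonneg)
    note lin = integral_lincomb4[OF E(3)[of t] E(1)[of t] E(4)[of t] E(2)[of t]]
    have dX: "\<bar>X a t \<omega> - X b t \<omega>\<bar> \<le> - \<alpha> * ?IP + 2 * \<alpha> * ?IX + - \<beta> * ?IQ + 0 * ?IY"
      unfolding lin(1)[symmetric]
    proof (rule approximation_diff(1)[OF b \<omega> t lin(2)])
      fix s
      have "\<alpha> * (sgn (X a s \<omega> - X b s \<omega>) * (P a s \<omega> - P b s \<omega>)) \<le> \<alpha> * (- \<bar>P a s \<omega> - P b s \<omega>\<bar> + 2 * errX a b s \<omega>)"
        using sgn_phi_diff[OF b] signs by (intro mult_left_mono) auto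
      moreover have "sgn (X a s \<omega> - X b s \<omega>) * (\<beta> * (Q a s \<omega> - Q b s \<omega>)) \<le> - \<beta> * \<bar>Q a s \<omega> - Q b s \<omega>\<bar>"
        by (rule sgn_cross[OF signs(3)])
      ultimately show "sgn (X a s \<omega> - X b s \<omega>) * (\<alpha> * (P a s \<omega> - P b s \<omega>) + \<beta> * (Q a s \<omega> - Q b s \<omega>))
        \<le> - \<alpha> * \<bar>P a s \<omega> - P b s \<omega>\<bar> + 2 * \<alpha> * errX a b s \<omega> + - \<beta> * \<bar>Q a s \<omega> - Q b s \<omega>\<bar> + 0 * errY a b s \<omega>"
        by (simp add: algebra_simps)
    qed
    have dY: "\<bar>Y a t \<omega> - Y b t \<omega>\<bar> \<le> - \<gamma> * ?IP + 0 * ?IX + - \<delta> * ?IQ + 2 * \<delta> * ?IY"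
      unfolding lin(1)[symmetric]
    proof (rule approximation_diff(2)[OF b \<omega> t lin(2)])
      fix s
      have "\<delta> * (sgn (Y a s \<omega> - Y b s \<omega>) * (Q a s \<omega> - Q b s \<omega>)) \<le> \<delta> * (- \<bar>Q a s \<omega> - Q b s \<omega>\<bar> + 2 * errY a b s \<omega>)"
        using sgn_phi_diff[OF b] signs by (intro mult_left_mono) auto
      moreover have "sgn (Y a s \<omega> - Y b s \<omega>) * (\<gamma> * (P a s \<omega> - P b s \<omega>)) \<le> - \<gamma> * \<bar>P a s \<omega> - P b s \<omega>\<bar>"
        by (rule sgn_cross[OF signs(4)])
      ultimately show "sgn (Y a s \<omega> - Y b s \<omega>) * (\<gamma> * (P a s \<omega> - P b s \<omega>) + \<delta> * (Q a s \<omega> - Q b s \<omega>))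
        \<le> - \<gamma> * \<bar>P a s \<omega> - P b s \<omega>\<bar> + 0 * errX a b s \<omega> + - \<delta> * \<bar>Q a s \<omega> - Q b s \<omega>\<bar> + 2 * \<delta> * errY a b s \<omega>"
        by (simp add: algebra_simps)
    qed
    let ?x = "\<bar>X a t \<omega> - X b t \<omega>\<bar>" and ?y = "\<bar>Y a t \<omega> - Y b t \<omega>\<bar>"
    have "v1 * ?x + v2 * ?y \<le> v1 * (- \<alpha> * ?IP + 2 * \<alpha> * ?IX + - \<beta> * ?IQ + 0 * ?IY) + v2 * (- \<gamma> * ?IP + 0 * ?IX + - \<delta> * ?IQ + 2 * \<delta> * ?IY)"
      using dX dY v by (intro add_mono mult_left_mono) auto
    also have "\<dots> = - (v1 * \<alpha> + v2 * \<gamma>) * ?IP - (v2 * \<delta> + v1 * \<beta>) * ?IQ + 2 * v1 * \<alpha> * ?IX + 2 * v2 * \<delta> * ?IY"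
      by (simp add: algebra_simps)
    finally have 1: "v1 * ?x + v2 * ?y + d * ?IP + d * ?IQ \<le> 2 * v1 * \<alpha> * ?IX + 2 * v2 * \<delta> * ?IY" unfolding vd by simp
    have "m * (?x + ?y + ?IP + ?IQ) \<le> v1 * ?x + v2 * ?y + d * ?IP + d * ?IQ"
      unfolding distrib_left using m I0 by (intro add_mono mult_right_mono) auto
    also note 1
    also have "2 * v1 * \<alpha> * ?IX + 2 * v2 * \<delta> * ?IY \<le> (2 * v1 * \<alpha> + 2 * v2 * \<delta>) * ?IX + (2 * v1 * \<alpha> + 2 * v2 * \<delta>) * ?IY"
      using v signs I0 by (intro add_mono mult_right_mono) auto
    also have "\<dots> = m * (c * (?IX + ?IY))" using m by (simp add: c_def distrib_left)
    finally show "?x + ?y + ?IP + ?IQ \<le> c * (?IX + ?IY)" using m by simp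
  qed
  then show ?thesis using c0 by blast
qed

text \<open>Both columns of the drift matrix sum to zero, so the drifts cancel for every
  \<open>a\<close>, before any limit is taken.\<close>

lemma XY_sum_constant:
  assumes "\<alpha> + \<gamma> = 0" "\<beta> + \<delta> = 0" and a: "0 < a" and \<omega>: "\<omega> \<in> space M" and t: "0 \<le> t" and BC: "B t \<omega> + C t \<omega> = 0"
  shows "X a t \<omega> + Y a t \<omega> = X0 \<omega> + Y0 \<omega>"
proof -
  have g: "\<gamma> = - \<alpha>" "\<delta> = - \<beta>" using assms by auto
  have "integral {0..t} (\<lambda>s. \<gamma> * P a s \<omega> + \<delta> * Q a s \<omega>) = integral {0..t} (\<lambda>s. - (\<alpha> * P a s \<omega> + \<beta> * Q a s \<omega>))"
    by (intro integral_cong) (simp add: g)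
  also have "\<dots> = - integral {0..t} (\<lambda>s. \<alpha> * P a s \<omega> + \<beta> * Q a s \<omega>)" by (rule integral_neg)
  finally show ?thesis using XY_eq[OF a \<omega> t] BC by simp
qed

text \<open>With determinant 0 the weighted estimate would lose the \<open>L1\<close> terms. Since
  \<open>X a + Y a\<close> is the same constant for all \<open>a\<close>, the two component
  differences are opposite, and with \<open>\<beta> = - \<delta>\<close> the cross term in the
  equation of \<open>X\<close> becomes a dissipative term for \<open>Y\<close>. One component
  estimate then controls both reciprocals.\<close>

lemma stable_antisymmetric:
  assumes h: "\<alpha> + \<gamma> = 0" "\<beta> + \<delta> = 0" and BC: "\<And>\<omega> t. \<omega> \<in> space M \<Longrightarrow> 0 \<le> t \<Longrightarrow> B t \<omega> + C t \<omega> = 0"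
  shows "\<exists>c\<ge>0. stable (space M) c"
proof -
  have flip: "\<beta> * (r * z) = \<delta> * (r' * z)" if "r = - r'" for r r' z
  proof -
    have "\<delta> = - \<beta>" using h by simp
    then show ?thesis using that by simp
  qed
  \<comment> \<open>The entry 1/2 is there because both component differences, equal in absolute
    value, are paid for by the single estimate of \<open>X\<close>.\<close>
  define m where "m = min (1/2) (min \<alpha> \<delta>)"
  have m: "0 < m" "m \<le> 1/2" "m \<le> \<alpha>" "m \<le> \<delta>" using signs by (auto simp: m_def)
  define c where "c = (2 * \<alpha> + 2 * \<delta>) / m"
  have c0: "0 \<le> c" using m signs by (simp add: c_def)
  have "stable (space M) c"
    unfolding stable_def
  proof (intro allI impI)
    fix a b t :: real and \<omega> assume b: "0 < b" "b \<le> a" and t: "0 \<le> t" and \<omega>: "\<omega> \<in> space M"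
    have a: "0 < a" using b by simp
    let ?IX = "integral {0..t} (\<lambda>s. errX a b s \<omega>)" and ?IY = "integral {0..t} (\<lambda>s. errY a b s \<omega>)"
    let ?IP = "integral {0..t} (\<lambda>s. \<bar>P a s \<omega> - P b s \<omega>\<bar>)" and ?IQ = "integral {0..t} (\<lambda>s. \<bar>Q a s \<omega> - Q b s \<omega>\<bar>)"
    note E = approximation_error[OF b \<omega>]
    have I0: "0 \<le> ?IX" "0 \<le> ?IY" "0 \<le> ?IP" "0 \<le> ?IQ" using E by (auto intro!: integral_nonneg)
    note lin = integral_lincomb4[OF E(3)[of t] E(1)[of t] E(4)[of t] E(2)[of t]]
    have opp: "X a s \<omega> - X b s \<omega> = - (Y a s \<omega> - Y b s \<omega>)" if "0 \<le> s" for s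
      using XY_sum_constant[OF h a \<omega> that BC[OF \<omega> that]] XY_sum_constant[OF h b(1) \<omega> that BC[OF \<omega> that]] by linarith
    have dX: "\<bar>X a t \<omega> - X b t \<omega>\<bar> \<le> - \<alpha> * ?IP + 2 * \<alpha> * ?IX + - \<delta> * ?IQ + 2 * \<delta> * ?IY"
      unfolding lin(1)[symmetric]
    proof (rule approximation_diff(1)[OF b \<omega> t lin(2)])
      fix s assume s: "s \<in> {0..t}"
      have 1: "\<alpha> * (sgn (X a s \<omega> - X b s \<omega>) * (P a s \<omega> - P b s \<omega>)) \<le> \<alpha> * (- \<bar>P a s \<omega> - P b s \<omega>\<bar> + 2 * errX a b s \<omega>)"
        using sgn_phi_diff[OF b] signs by (intro mult_left_mono) auto
      have 2: "\<delta> * (sgn (Y a s \<omega> - Y b s \<omega>) * (Q a s \<omega> - Q b s \<omega>)) \<le> \<delta> * (- \<bar>Q a s \<omega> - Q b s \<omega>\<bar> + 2 * errY a b s \<omega>)"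
        using sgn_phi_diff[OF b] signs by (intro mult_left_mono) auto
      have 3: "sgn (X a s \<omega> - X b s \<omega>) = - sgn (Y a s \<omega> - Y b s \<omega>)" using s by (subst opp) (auto simp only: sgn_minus atLeastAtMost_iff)
      have "sgn (X a s \<omega> - X b s \<omega>) * (\<alpha> * (P a s \<omega> - P b s \<omega>) + \<beta> * (Q a s \<omega> - Q b s \<omega>))
         = \<alpha> * (sgn (X a s \<omega> - X b s \<omega>) * (P a s \<omega> - P b s \<omega>)) + \<beta> * (sgn (X a s \<omega> - X b s \<omega>) * (Q a s \<omega> - Q b s \<omega>))" by (simp only: distrib_left mult.left_commute)
      also have "\<beta> * (sgn (X a s \<omega> - X b s \<omega>) * (Q a s \<omega> - Q b s \<omega>)) = \<delta> * (sgn (Y a s \<omega> - Y b s \<omega>) * (Q a s \<omega> - Q b s \<omega>))"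
        by (rule flip[OF 3])
      also have "\<alpha> * (sgn (X a s \<omega> - X b s \<omega>) * (P a s \<omega> - P b s \<omega>)) + \<delta> * (sgn (Y a s \<omega> - Y b s \<omega>) * (Q a s \<omega> - Q b s \<omega>))
        \<le> \<alpha> * (- \<bar>P a s \<omega> - P b s \<omega>\<bar> + 2 * errX a b s \<omega>) + \<delta> * (- \<bar>Q a s \<omega> - Q b s \<omega>\<bar> + 2 * errY a b s \<omega>)"
        by (rule add_mono[OF 1 2])
      also have "\<dots> = - \<alpha> * \<bar>P a s \<omega> - P b s \<omega>\<bar> + 2 * \<alpha> * errX a b s \<omega> + - \<delta> * \<bar>Q a s \<omega> - Q b s \<omega>\<bar> + 2 * \<delta> * errY a b s \<omega>"
        by (simp add: algebra_simps)
      finally show "sgn (X a s \<omega> - X b s \<omega>) * (\<alpha> * (P a s \<omega> - P b s \<omega>) + \<beta> * (Q a s \<omega> - Q b s \<omega>))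
        \<le> - \<alpha> * \<bar>P a s \<omega> - P b s \<omega>\<bar> + 2 * \<alpha> * errX a b s \<omega> + - \<delta> * \<bar>Q a s \<omega> - Q b s \<omega>\<bar> + 2 * \<delta> * errY a b s \<omega>" .
    qed
    let ?x = "\<bar>X a t \<omega> - X b t \<omega>\<bar>" and ?y = "\<bar>Y a t \<omega> - Y b t \<omega>\<bar>"
    have xy: "?y = ?x" unfolding opp[OF t] by (rule abs_minus_cancel[symmetric])
    have 1: "?x + \<alpha> * ?IP + \<delta> * ?IQ \<le> 2 * \<alpha> * ?IX + 2 * \<delta> * ?IY" using dX by simp
    have "m * (?x + ?y + ?IP + ?IQ) = (2 * m) * ?x + m * ?IP + m * ?IQ" unfolding xy by (simp add: algebra_simps)
    also have "\<dots> \<le> 1 * ?x + \<alpha> * ?IP + \<delta> * ?IQ"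
      using m I0 by (intro add_mono mult_right_mono) auto
    also have "\<dots> \<le> 2 * \<alpha> * ?IX + 2 * \<delta> * ?IY" using 1 by simp
    also have "2 * \<alpha> * ?IX + 2 * \<delta> * ?IY \<le> (2 * \<alpha> + 2 * \<delta>) * ?IX + (2 * \<alpha> + 2 * \<delta>) * ?IY"
      using signs I0 by (intro add_mono mult_right_mono) auto
    also have "\<dots> = m * (c * (?IX + ?IY))" using m by (simp add: c_def distrib_left)
    finally show "?x + ?y + ?IP + ?IQ \<le> c * (?IX + ?IY)" using m by simp
  qed
  then show ?thesis using c0 by blast
qed

lemma error_le_H:
  assumes b: "0 < b" "b \<le> a" and \<omega>: "\<omega> \<in> space M" and \<epsilon>: "0 < \<epsilon>" "\<epsilon> \<le> 1"
  shows "integral {0..t} (\<lambda>s. errX a b s \<omega>) + integral {0..t} (\<lambda>s. errY a b s \<omega>) \<le> 2 * a powr \<epsilon> * H \<epsilon> b t \<omega>"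
proof -
  note E = approximation_error[OF b \<omega>]
  have "integral {0..t} (\<lambda>s. errX a b s \<omega>) + integral {0..t} (\<lambda>s. errY a b s \<omega>) = integral {0..t} (\<lambda>s. errX a b s \<omega> + errY a b s \<omega>)"
    by (rule integral_add[symmetric, OF E(1,2)])
  also have "\<dots> \<le> integral {0..t} (\<lambda>s. 2 * a powr \<epsilon> * (P b s \<omega> powr (1 + \<epsilon>) + Q b s \<omega> powr (1 + \<epsilon>)))"
  proof (rule integral_le[OF integrable_add[OF E(1,2)] integrable_on_mult_right[OF H_integrable[OF b(1) \<omega>]]])
    fix s show "errX a b s \<omega> + errY a b s \<omega> \<le> 2 * a powr \<epsilon> * (P b s \<omega> powr (1 + \<epsilon>) + Q b s \<omega> powr (1 + \<epsilon>))"
      using phi_param_diff[OF b \<epsilon>, of "X b s \<omega>"] phi_param_diff[OF b \<epsilon>, of "Y b s \<omega>"] by (simp add: distrib_left)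
  qed
  finally show ?thesis unfolding H_def by simp
qed

text \<open>Halving the parameter makes \<open>a powr \<epsilon>\<close> geometric. With
  \<open>lim\<close>, the limit is \<open>G t\<close>-measurable at once, including at sample points
  where the sequence may diverge.\<close>

definition limX where "limX t \<omega> = lim (\<lambda>k. X ((1/2) ^ k) t \<omega>)"
definition limY where "limY t \<omega> = lim (\<lambda>k. Y ((1/2) ^ k) t \<omega>)"

lemma lim_measurable:
  assumes "0 \<le> t"
  shows "limX t \<in> borel_measurable (G t)" "limY t \<in> borel_measurable (G t)"
proof -
  have "(\<lambda>\<omega>. lim (\<lambda>k. X ((1/2) ^ k) t \<omega>)) \<in> borel_measurable (G t)"
    by (rule borel_measurable_lim_metric, rule XY_measurable(1)[OF _ assms]) simp
  then show "limX t \<in> borel_measurable (G t)" by (simp add: limX_def[abs_def])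
  have "(\<lambda>\<omega>. lim (\<lambda>k. Y ((1/2) ^ k) t \<omega>)) \<in> borel_measurable (G t)"
    by (rule borel_measurable_lim_metric, rule XY_measurable(2)[OF _ assms]) simp
  then show "limY t \<in> borel_measurable (G t)" by (simp add: limY_def[abs_def])
qed

text \<open>The deterministic half of the convergence: consecutive differences are at most a
  constant times \<open>a powr \<epsilon> * H\<close>, with \<open>H\<close> taken at the finer
  parameter. Integer horizons suffice because \<open>H\<close> increases in time.\<close>

lemma limit_is_path_solution:
  assumes \<omega>: "\<omega> \<in> A" and AM: "A \<subseteq> space M" and st: "stable A c" "0 \<le> c" and \<epsilon>: "0 < \<epsilon>" "\<epsilon> \<le> 1"
    and sm: "\<And>n::nat. summable (\<lambda>k. ((1/2) ^ k) powr \<epsilon> * H \<epsilon> ((1/2) ^ Suc k) (real n) \<omega>)"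
  shows "path_solution \<alpha> \<beta> \<gamma> \<delta> (\<lambda>t. B t \<omega>) (\<lambda>t. C t \<omega>) (\<lambda>t. limX t \<omega>) (\<lambda>t. limY t \<omega>)"
    and "limX 0 \<omega> = X0 \<omega>" "limY 0 \<omega> = Y0 \<omega>"
proof -
  have \<omega>M: "\<omega> \<in> space M" using \<omega> AM by auto
  let ?a = "\<lambda>k. (1/2::real) ^ k"
  have a: "0 < ?a k" for k by simp
  have alim: "?a \<longlonglongrightarrow> 0" by (rule LIMSEQ_realpow_zero) auto
  have key: "\<exists>s. summable s \<and> (\<forall>k. \<forall>t\<in>{0..T}. \<bar>X (?a (Suc k)) t \<omega> - X (?a k) t \<omega>\<bar> \<le> s k) \<and>
        (\<forall>k. integral {0..T} (\<lambda>r. \<bar>P (?a (Suc k)) r \<omega> - P (?a k) r \<omega>\<bar>) \<le> s k) \<and>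
        (\<forall>k. \<forall>t\<in>{0..T}. \<bar>Y (?a (Suc k)) t \<omega> - Y (?a k) t \<omega>\<bar> \<le> s k) \<and>
        (\<forall>k. integral {0..T} (\<lambda>r. \<bar>Q (?a (Suc k)) r \<omega> - Q (?a k) r \<omega>\<bar>) \<le> s k)" if T: "0 \<le> T" for T
  proof -
    obtain n :: nat where n: "T \<le> real n" using real_arch_simple by blast
    define s where "s k = 2 * c * (?a k powr \<epsilon> * H \<epsilon> (?a (Suc k)) (real n) \<omega>)" for k
    have "summable s" unfolding s_def by (intro summable_mult sm)
    \<comment> \<open>The four quantities in \<open>stable\<close> are nonnegative, so each is below
      their sum, and a single summable sequence serves both components.\<close>
    have all: "\<bar>X (?a (Suc k)) t \<omega> - X (?a k) t \<omega>\<bar> \<le> s k \<and> \<bar>Y (?a (Suc k)) t \<omega> - Y (?a k) t \<omega>\<bar> \<le> s k \<and>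
        integral {0..t} (\<lambda>r. \<bar>P (?a (Suc k)) r \<omega> - P (?a k) r \<omega>\<bar>) \<le> s k \<and>
        integral {0..t} (\<lambda>r. \<bar>Q (?a (Suc k)) r \<omega> - Q (?a k) r \<omega>\<bar>) \<le> s k" if t: "t \<in> {0..T}" for k t
    proof -
      have le: "?a (Suc k) \<le> ?a k" by simp
      note E = approximation_error[OF a le \<omega>M]
      have t0: "0 \<le> t" using t by simp
      let ?x = "\<bar>X (?a k) t \<omega> - X (?a (Suc k)) t \<omega>\<bar>" and ?y = "\<bar>Y (?a k) t \<omega> - Y (?a (Suc k)) t \<omega>\<bar>"
      let ?p = "integral {0..t} (\<lambda>s. \<bar>P (?a k) s \<omega> - P (?a (Suc k)) s \<omega>\<bar>)" and ?q = "integral {0..t} (\<lambda>s. \<bar>Q (?a k) s \<omega> - Q (?a (Suc k)) s \<omega>\<bar>)"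
      have "?x + ?y + ?p + ?q \<le> c * (integral {0..t} (\<lambda>s. errX (?a k) (?a (Suc k)) s \<omega>) + integral {0..t} (\<lambda>s. errY (?a k) (?a (Suc k)) s \<omega>))"
        using st(1)[unfolded stable_def, rule_format, OF a le t0 \<omega>] .
      also have "\<dots> \<le> c * (2 * ?a k powr \<epsilon> * H \<epsilon> (?a (Suc k)) t \<omega>)"
        by (rule mult_left_mono[OF error_le_H[OF a le \<omega>M \<epsilon>] st(2)])
      also have "\<dots> \<le> c * (2 * ?a k powr \<epsilon> * H \<epsilon> (?a (Suc k)) (real n) \<omega>)"
        using t n st(2) by (intro mult_left_mono H_mono(2) a \<omega>M t0) auto
      finally have sum: "?x + ?y + ?p + ?q \<le> s k" unfolding s_def by simp
      have nn: "0 \<le> ?p" "0 \<le> ?q" using E by (auto intro!: integral_nonneg)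
      show ?thesis
        using sum nn abs_ge_zero[of "X (?a k) t \<omega> - X (?a (Suc k)) t \<omega>"] abs_ge_zero[of "Y (?a k) t \<omega> - Y (?a (Suc k)) t \<omega>"]
        unfolding abs_minus_commute[of "X (?a (Suc k)) _ _"] abs_minus_commute[of "Y (?a (Suc k)) _ _"]
          abs_minus_commute[of "P (?a (Suc k)) _ _"] abs_minus_commute[of "Q (?a (Suc k)) _ _"]
        by linarith
    qed
    show ?thesis using \<open>summable s\<close> all T by (intro exI[of _ s]) auto
  qed
  have exX: "\<exists>s. summable s \<and> (\<forall>k. \<forall>t\<in>{0..T}. \<bar>X (?a (Suc k)) t \<omega> - X (?a k) t \<omega>\<bar> \<le> s k) \<and>
        (\<forall>k. integral {0..T} (\<lambda>r. \<bar>P (?a (Suc k)) r \<omega> - P (?a k) r \<omega>\<bar>) \<le> s k)" if "0 \<le> T" for T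
    using key[OF that] by blast
  have exY: "\<exists>s. summable s \<and> (\<forall>k. \<forall>t\<in>{0..T}. \<bar>Y (?a (Suc k)) t \<omega> - Y (?a k) t \<omega>\<bar> \<le> s k) \<and>
        (\<forall>k. integral {0..T} (\<lambda>r. \<bar>Q (?a (Suc k)) r \<omega> - Q (?a k) r \<omega>\<bar>) \<le> s k)" if "0 \<le> T" for T
    using key[OF that] by blast
  note LX = limit_component[of ?a "\<lambda>k t. X (?a k) t \<omega>", OF a alim XY_continuous(1)[OF a \<omega>M] exX, folded limX_def]
  note LY = limit_component[of ?a "\<lambda>k t. Y (?a k) t \<omega>", OF a alim XY_continuous(2)[OF a \<omega>M] exY, folded limY_def]
  have ini: "limX 0 \<omega> = X0 \<omega>" "limY 0 \<omega> = Y0 \<omega>"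
    unfolding limX_def limY_def using XY_0[OF a \<omega>M] by simp_all
  then show "limX 0 \<omega> = X0 \<omega>" "limY 0 \<omega> = Y0 \<omega>" by auto
  have eqk: "X (?a k) t \<omega> = X0 \<omega> + B t \<omega> + \<alpha> * integral {0..t} (\<lambda>s. P (?a k) s \<omega>) + \<beta> * integral {0..t} (\<lambda>s. Q (?a k) s \<omega>)"
    "Y (?a k) t \<omega> = Y0 \<omega> + C t \<omega> + \<gamma> * integral {0..t} (\<lambda>s. P (?a k) s \<omega>) + \<delta> * integral {0..t} (\<lambda>s. Q (?a k) s \<omega>)" if "0 \<le> t" for k t
  proof -
    have i: "integral {0..t} (\<lambda>s. u * P (?a k) s \<omega> + v * Q (?a k) s \<omega>) = u * integral {0..t} (\<lambda>s. P (?a k) s \<omega>) + v * integral {0..t} (\<lambda>s. Q (?a k) s \<omega>)" for u v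
      by (simp only: integral_add[OF integrable_on_mult_right[OF PQ_integrable(1)[OF a \<omega>M]] integrable_on_mult_right[OF PQ_integrable(2)[OF a \<omega>M]]] integral_mult_right)
    show "X (?a k) t \<omega> = X0 \<omega> + B t \<omega> + \<alpha> * integral {0..t} (\<lambda>s. P (?a k) s \<omega>) + \<beta> * integral {0..t} (\<lambda>s. Q (?a k) s \<omega>)"
      "Y (?a k) t \<omega> = Y0 \<omega> + C t \<omega> + \<gamma> * integral {0..t} (\<lambda>s. P (?a k) s \<omega>) + \<delta> * integral {0..t} (\<lambda>s. Q (?a k) s \<omega>)"
      using XY_eq[OF a \<omega>M that, of k] unfolding i by linarith+
  qed
  have tX: "limX t \<omega> = limX 0 \<omega> + B t \<omega> + \<alpha> * integral {0..t} (\<lambda>s. 1 / limX s \<omega>) + \<beta> * integral {0..t} (\<lambda>s. 1 / limY s \<omega>)" if "0 \<le> t" for t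
  proof (rule LIMSEQ_unique)
    show "(\<lambda>k. X (?a k) t \<omega>) \<longlonglongrightarrow> limX t \<omega>" by (rule LX(2)) (use that in auto)
    show "(\<lambda>k. X (?a k) t \<omega>) \<longlonglongrightarrow> limX 0 \<omega> + B t \<omega> + \<alpha> * integral {0..t} (\<lambda>s. 1 / limX s \<omega>) + \<beta> * integral {0..t} (\<lambda>s. 1 / limY s \<omega>)"
      unfolding eqk(1)[OF that] ini by (intro tendsto_intros LX(6) LY(6)) (use that in auto)
  qed
  have tY: "limY t \<omega> = limY 0 \<omega> + C t \<omega> + \<gamma> * integral {0..t} (\<lambda>s. 1 / limX s \<omega>) + \<delta> * integral {0..t} (\<lambda>s. 1 / limY s \<omega>)" if "0 \<le> t" for t
  proof (rule LIMSEQ_unique)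
    show "(\<lambda>k. Y (?a k) t \<omega>) \<longlonglongrightarrow> limY t \<omega>" by (rule LY(2)) (use that in auto)
    show "(\<lambda>k. Y (?a k) t \<omega>) \<longlonglongrightarrow> limY 0 \<omega> + C t \<omega> + \<gamma> * integral {0..t} (\<lambda>s. 1 / limX s \<omega>) + \<delta> * integral {0..t} (\<lambda>s. 1 / limY s \<omega>)"
      unfolding eqk(2)[OF that] ini by (intro tendsto_intros LX(6) LY(6)) (use that in auto)
  qed
  show "path_solution \<alpha> \<beta> \<gamma> \<delta> (\<lambda>t. B t \<omega>) (\<lambda>t. C t \<omega>) (\<lambda>t. limX t \<omega>) (\<lambda>t. limY t \<omega>)"
    unfolding path_solution_def
  proof (intro conjI allI impI)
    show "continuous_on {0..} (\<lambda>t. limX t \<omega>)" by (rule LX(1))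
    show "continuous_on {0..} (\<lambda>t. limY t \<omega>)" by (rule LY(1))
    fix t :: real assume t: "0 \<le> t"
    show "0 \<le> limX t \<omega>" by (rule LX(3)) (use t in auto)
    show "0 \<le> limY t \<omega>" by (rule LY(3)) (use t in auto)
    show "negligible {s \<in> {0..t}. limX s \<omega> = 0}" by (rule LX(4)) (use t in auto)
    show "negligible {s \<in> {0..t}. limY s \<omega> = 0}" by (rule LY(4)) (use t in auto)
    show "(\<lambda>s. 1 / limX s \<omega>) integrable_on {0..t}" by (rule LX(5)) (use t in auto)
    show "(\<lambda>s. 1 / limY s \<omega>) integrable_on {0..t}" by (rule LY(5)) (use t in auto)
  qed (rule tX tY, assumption)+
qed

text \<open>By the moment bound the expected series is dominated by a geometric one, so it is finite
  almost surely on \<open>A\<close>. Only countably many horizons are involved, which keeps the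
  exceptional set null.\<close>

lemma AE_limit_path_solution:
  assumes A: "A \<in> sets (F 0)" and st: "stable A c" "0 \<le> c"
    and \<epsilon>: "0 < \<epsilon>" "\<epsilon> \<le> 1 / 2" and v: "0 \<le> v1" "0 \<le> v2" and \<kappa>: "0 < \<kappa>" and k: "0 \<le> k"
    and key: "\<And>a \<omega> s. 0 < a \<Longrightarrow> \<omega> \<in> A \<Longrightarrow> 0 \<le> s \<Longrightarrow> coercive \<alpha> \<beta> \<gamma> \<delta> v1 v2 \<epsilon> \<kappa> k (P a s \<omega>) (Q a s \<omega>)"
  shows "AE \<omega> in M. \<omega> \<in> A \<longrightarrow>
     path_solution \<alpha> \<beta> \<gamma> \<delta> (\<lambda>t. B t \<omega>) (\<lambda>t. C t \<omega>) (\<lambda>t. limX t \<omega>) (\<lambda>t. limY t \<omega>) \<and>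
     limX 0 \<omega> = X0 \<omega> \<and> limY 0 \<omega> = Y0 \<omega>"
proof -
  let ?a = "\<lambda>k. (1/2::real) ^ k"
  have a: "0 < ?a k" for k by simp
  have AM: "A \<in> events" using A sets_F by auto
  have Asub: "A \<subseteq> space M" using AM sets.sets_into_space by auto
  have "AE \<omega> in M. \<omega> \<in> A \<longrightarrow> summable (\<lambda>j. ?a j powr \<epsilon> * H \<epsilon> (?a (Suc j)) (real n) \<omega>)" for n :: nat
  \<comment> \<open>\<open>moment_bound\<close> asks for a positive horizon; for horizon 0 the
    integral \<open>H\<close> is 0.\<close>
  proof (cases "n = 0")
    case True
    then show ?thesis by (simp add: H_def)
  next
    case False
    then have n: "0 < real n" by simp
    define D where "D = (k * real n + (v1 + v2) * (2 + 3 * (sqrt (2 / pi) * sqrt (real n)))) / \<kappa>"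
    note mb = moment_bound[OF a \<epsilon> n A v \<kappa> k key[OF a], folded D_def]
    define f where "f j \<omega> = ?a j powr \<epsilon> * (indicator A \<omega> * H \<epsilon> (?a (Suc j)) (real n) \<omega>)" for j \<omega>
    have f0: "0 \<le> f j \<omega>" if "\<omega> \<in> space M" for j \<omega>
      unfolding f_def by (intro mult_nonneg_nonneg H_mono(1)[OF a that, of "real n" "real n"]) auto
    have fi: "integrable M (f j)" for j unfolding f_def by (intro integrable_mult_right mb(1)) auto
    have fE: "(\<integral>\<^sup>+\<omega>. ennreal (f j \<omega>) \<partial>M) \<le> ennreal (?a j powr \<epsilon> * D)" for j
    proof -
      have "(\<integral>\<^sup>+\<omega>. ennreal (f j \<omega>) \<partial>M) = ennreal (\<integral>\<omega>. f j \<omega> \<partial>M)"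
        by (rule nn_integral_eq_integral[OF fi]) (use f0 in auto)
      also have "\<dots> \<le> ennreal (?a j powr \<epsilon> * D)"
        unfolding f_def integral_mult_right_zero by (intro ennreal_leI mult_left_mono mb(2)) auto
      finally show ?thesis .
    qed
    have pw: "?a j powr \<epsilon> = ((1/2) powr \<epsilon>) ^ j" for j
      by (simp add: powr_realpow[symmetric] powr_powr mult.commute)
    have lt1: "(1/2::real) powr \<epsilon> < 1" using powr_less_mono2[OF \<epsilon>(1), of "1/2" 1] by simp
    have D0: "0 \<le> D" unfolding D_def using k v \<kappa> by (intro divide_nonneg_pos add_nonneg_nonneg mult_nonneg_nonneg) auto
    have sD: "summable (\<lambda>j. ?a j powr \<epsilon> * D)" unfolding pw using lt1 by (intro summable_mult2 summable_geometric) auto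
    have "(\<integral>\<^sup>+\<omega>. (\<Sum>j. ennreal (f j \<omega>)) \<partial>M) = (\<Sum>j. \<integral>\<^sup>+\<omega>. ennreal (f j \<omega>) \<partial>M)"
      by (rule nn_integral_suminf) (use fi in \<open>auto intro: borel_measurable_integrable\<close>)
    also have "\<dots> \<le> (\<Sum>j. ennreal (?a j powr \<epsilon> * D))" by (intro suminf_le fE) auto
    also have "\<dots> = ennreal (\<Sum>j. ?a j powr \<epsilon> * D)" using sD D0 by (intro suminf_ennreal2) auto
    also have "\<dots> < \<infinity>" by simp
    finally have "(\<integral>\<^sup>+\<omega>. (\<Sum>j. ennreal (f j \<omega>)) \<partial>M) \<noteq> \<infinity>" by simp
    then have "AE \<omega> in M. (\<Sum>j. ennreal (f j \<omega>)) \<noteq> \<infinity>"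
      by (intro nn_integral_noteq_infinite) (use fi in \<open>auto intro!: borel_measurable_suminf borel_measurable_integrable\<close>)
    then show ?thesis
    proof (rule AE_mp, intro AE_I2 impI)
      fix \<omega> assume \<omega>: "\<omega> \<in> space M" and ne: "(\<Sum>j. ennreal (f j \<omega>)) \<noteq> \<infinity>" and "\<omega> \<in> A"
      have "summable (\<lambda>j. f j \<omega>)" by (rule summable_suminf_not_top) (use f0[OF \<omega>] ne in auto)
      then show "summable (\<lambda>j. ?a j powr \<epsilon> * H \<epsilon> (?a (Suc j)) (real n) \<omega>)" using \<open>\<omega> \<in> A\<close> by (simp add: f_def)
    qed
  qed
  then have "AE \<omega> in M. \<forall>n::nat. \<omega> \<in> A \<longrightarrow> summable (\<lambda>j. ?a j powr \<epsilon> * H \<epsilon> (?a (Suc j)) (real n) \<omega>)"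
    by (intro AE_all_countable[THEN iffD2] allI)
  then show ?thesis
  proof (rule AE_mp, intro AE_I2 impI)
    fix \<omega> assume sm: "\<forall>n::nat. \<omega> \<in> A \<longrightarrow> summable (\<lambda>j. ?a j powr \<epsilon> * H \<epsilon> (?a (Suc j)) (real n) \<omega>)" and "\<omega> \<in> A"
    then have "\<And>n::nat. summable (\<lambda>j. ?a j powr \<epsilon> * H \<epsilon> (?a (Suc j)) (real n) \<omega>)" by simp
    from limit_is_path_solution[OF \<open>\<omega> \<in> A\<close> Asub st \<epsilon>(1) _ this] \<epsilon>(2)
    show "path_solution \<alpha> \<beta> \<gamma> \<delta> (\<lambda>t. B t \<omega>) (\<lambda>t. C t \<omega>) (\<lambda>t. limX t \<omega>) (\<lambda>t. limY t \<omega>) \<and>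
     limX 0 \<omega> = X0 \<omega> \<and> limY 0 \<omega> = Y0 \<omega>" by simp
  qed
qed

end

section \<open>Existence and nonexistence\<close>

text \<open>The constant 1 is the characteristic function of the point mass at 0. This treats a
  combination of the noises with variance 0, to which the normalisation by \<open>sqrt h\<close>
  cannot be applied.\<close>

lemma (in prob_space) AE_eq_0_if_char_1:
  fixes V :: "'a \<Rightarrow> real"
  assumes V[measurable]: "V \<in> borel_measurable M"
    and char: "\<And>u. (\<integral>\<omega>. exp (\<i> * complex_of_real (u * V \<omega>)) \<partial>M) = 1"
  shows "AE \<omega> in M. V \<omega> = 0"
proof -
  interpret R: prob_space "return borel (0::real)" by (rule prob_space_return) simp
  have rd: "real_distribution (return borel (0::real))" by unfold_locales auto
  have "distr M borel V = return borel 0"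
  proof (rule Levy_uniqueness[OF real_distribution_distr[OF V] rd])
    show "char (distr M borel V) = char (return borel 0)"
    proof
      fix u
      have "char (distr M borel V) u = (\<integral>\<omega>. exp (\<i> * complex_of_real (u * V \<omega>)) \<partial>M)"
        unfolding char_def by (subst integral_distr) auto
      also have "\<dots> = char (return borel 0) u" unfolding char char_def by (subst integral_return) auto
      finally show "char (distr M borel V) u = char (return borel 0) u" .
    qed
  qed
  moreover have "AE x in return borel 0. x = (0::real)" by (subst AE_return) auto
  ultimately have "AE x in distr M borel V. x = 0" by (simp only:)
  then show ?thesis by (subst (asm) AE_distr_iff) auto
qed

text \<open>Lets countably many almost sure identities imply one for all times; rounding
  \<open>t * (n + 1)\<close> down gives grid points within \<open>1 / (n + 1)\<close> of
  \<open>t\<close>.\<close>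

lemma continuous_zero_on_fractions:
  fixes f :: "real \<Rightarrow> real"
  assumes c: "continuous_on {0..} f" and z: "\<And>m n::nat. f (real m / real (Suc n)) = 0" and t: "0 \<le> t"
  shows "f t = 0"
proof -
  define s where "s n = real (nat \<lfloor>t * real (Suc n)\<rfloor>) / real (Suc n)" for n
  have lim: "s \<longlonglongrightarrow> t"
  proof (rule LIM_zero_cancel, rule Lim_null_comparison[OF _ LIMSEQ_inverse_real_of_nat], rule always_eventually, rule allI)
    fix n
    have "\<bar>real (nat \<lfloor>t * real (Suc n)\<rfloor>) - t * real (Suc n)\<bar> \<le> 1"
      using t of_int_floor_le[of "t * real (Suc n)"] real_of_int_floor_gt_diff_one[of "t * real (Suc n)"] by (simp del: of_nat_Suc) linarith
    moreover have "s n - t = (real (nat \<lfloor>t * real (Suc n)\<rfloor>) - t * real (Suc n)) / real (Suc n)"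
      by (simp add: s_def diff_divide_distrib del: of_nat_Suc)
    ultimately show "norm (s n - t) \<le> inverse (real (Suc n))"
      by (simp add: abs_divide inverse_eq_divide divide_right_mono del: of_nat_Suc)
  qed
  have "(\<lambda>n. f (s n)) \<longlonglongrightarrow> f t"
    by (rule continuous_on_tendsto_compose[OF c lim]) (use t in \<open>auto simp: s_def\<close>)
  moreover have "f (s n) = 0" for n unfolding s_def by (rule z)
  ultimately show ?thesis using LIMSEQ_unique[of "\<lambda>n. 0" "f t" 0] by simp
qed

lemma std_normal_lower_tail_pos: "0 < measure std_normal_distribution {..<-1}"
proof -
  interpret N: real_distribution std_normal_distribution by (rule real_dist_normal_dist)
  have "measure std_normal_distribution {..<-1} \<noteq> 0"
  proof
    assume "measure std_normal_distribution {..<-1} = 0"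
    then have "{..<-1} \<in> null_sets std_normal_distribution"
      by (auto simp: N.emeasure_eq_measure)
    then have "AE x::real in lborel. x \<in> {..<-1} \<longrightarrow> ennreal (std_normal_density x) = 0"
      by (subst (asm) null_sets_density_iff) auto
    then have "AE x::real in lborel. x \<notin> {..<-1}"
    proof eventually_elim
      fix x :: real assume "x \<in> {..<-1} \<longrightarrow> ennreal (std_normal_density x) = 0"
      then show "x \<notin> {..<-1}" using normal_density_pos[of 1 0 x] by (auto simp: ennreal_eq_0_iff)
    qed
    then have "{..<-1::real} \<in> null_sets lborel" by (subst AE_iff_null_sets) auto
    then have "{-3..<-2::real} \<in> null_sets lborel" by (rule null_sets_subset) auto
    then show False by (auto simp: null_sets_def)
  qed
  then show ?thesis by (simp add: zero_less_measure_iff)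
qed

section \<open>Consequences of the Brownian hypotheses\<close>

lemma usual_conditions_filtered:
  assumes "usual_conditions M F"
  shows "filtered_prob_space M F"
proof -
  note u = assms[unfolded usual_conditions_def]
  have "prob_space M" using u by (elim conjE)
  moreover have "\<forall>t. space (F t) = space M \<and> sets (F t) \<subseteq> sets M" using u by (elim conjE)
  moreover have "\<forall>s t. 0 \<le> s \<and> s \<le> t \<longrightarrow> sets (F s) \<subseteq> sets (F t)" using u by (elim conjE)
  ultimately show ?thesis by (intro filtered_prob_space.intro filtered_prob_space_axioms.intro) blast+
qed

text \<open>Insert \<open>u * v1\<close> and \<open>u * v2\<close> into the planar characteristic
  function. Unit weights give the single noises, weights (1, 1) their sum, and general weights serve
  nonexistence.\<close>

lemma planar_BM_conditionally_gaussian: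
  assumes "planar_BM M F \<rho> B C" "0 \<le> s" "s \<le> t"
  shows "conditionally_gaussian M (F s) ((v1\<^sup>2 + 2 * \<rho> * v1 * v2 + v2\<^sup>2) * (t - s))
    (\<lambda>\<omega>. v1 * (B t \<omega> - B s \<omega>) + v2 * (C t \<omega> - C s \<omega>))"
  unfolding conditionally_gaussian_def
proof (intro allI ballI)
  fix u A assume A: "A \<in> sets (F s)"
  have eq: "u * (v1 * (B t \<omega> - B s \<omega>) + v2 * (C t \<omega> - C s \<omega>)) = (u * v1) * (B t \<omega> - B s \<omega>) + (u * v2) * (C t \<omega> - C s \<omega>)" for \<omega>
    by (simp add: algebra_simps)
  have eq2: "- ((v1\<^sup>2 + 2 * \<rho> * v1 * v2 + v2\<^sup>2) * (t - s)) * u\<^sup>2 / 2 = - (t - s) * ((u * v1)\<^sup>2 + 2 * \<rho> * (u * v1) * (u * v2) + (u * v2)\<^sup>2) / 2"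
    by (simp add: algebra_simps power2_eq_square)
  show "(\<integral>\<omega>. indicator A \<omega> * exp (\<i> * complex_of_real (u * (v1 * (B t \<omega> - B s \<omega>) + v2 * (C t \<omega> - C s \<omega>)))) \<partial>M)
        = complex_of_real (measure M A * exp (- ((v1\<^sup>2 + 2 * \<rho> * v1 * v2 + v2\<^sup>2) * (t - s)) * u\<^sup>2 / 2))"
    unfolding eq eq2 using assms A unfolding planar_BM_def by blast
qed

text \<open>For \<open>\<rho> = -1\<close> the weights (1, 1) have variance
  \<open>1 + 2 * \<rho> + 1 = 0\<close>. Each fixed time gives an almost sure identity, and
  continuity extends it to all times at once.\<close>

lemma planar_BM_sum_zero:
  assumes uc: "usual_conditions M F" and bm: "planar_BM M F \<rho> B C" and \<rho>: "1 + \<rho> = 0"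
  shows "AE \<omega> in M. \<forall>t\<ge>0. B t \<omega> + C t \<omega> = 0"
proof -
  interpret filtered_prob_space M F by (rule usual_conditions_filtered[OF uc])
  have BCM: "B t \<in> borel_measurable M" "C t \<in> borel_measurable M" if "0 \<le> t" for t
    using bm that measurable_F_M unfolding planar_BM_def by blast+
  have start: "AE \<omega> in M. B 0 \<omega> = 0 \<and> C 0 \<omega> = 0 \<and> continuous_on {0..} (\<lambda>t. B t \<omega>) \<and> continuous_on {0..} (\<lambda>t. C t \<omega>)"
    using bm unfolding planar_BM_def by blast
  have pt: "AE \<omega> in M. 1 * (B t \<omega> - B 0 \<omega>) + 1 * (C t \<omega> - C 0 \<omega>) = 0" if t: "0 \<le> t" for t
  proof (rule AE_eq_0_if_char_1)
    show "(\<lambda>\<omega>. 1 * (B t \<omega> - B 0 \<omega>) + 1 * (C t \<omega> - C 0 \<omega>)) \<in> borel_measurable M"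
      using BCM[OF t] BCM[of 0] by measurable
    fix u
    have sp: "space M \<in> sets (F 0)" using space_F[of 0] sets.top[of "F 0"] by simp
    have "(1::real)\<^sup>2 + 2 * \<rho> * 1 * 1 + 1\<^sup>2 = 0" using \<rho> by simp
    then have "conditionally_gaussian M (F 0) 0 (\<lambda>\<omega>. 1 * (B t \<omega> - B 0 \<omega>) + 1 * (C t \<omega> - C 0 \<omega>))"
      using planar_BM_conditionally_gaussian[OF bm order_refl t, of 1 1] by (simp only: mult_zero_left)
    from conditionally_gaussianD[OF this sp, of u]
    have "(\<integral>\<omega>. indicator (space M) \<omega> * exp (\<i> * complex_of_real (u * (1 * (B t \<omega> - B 0 \<omega>) + 1 * (C t \<omega> - C 0 \<omega>)))) \<partial>M) = 1"
      by (simp add: prob_space)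
    moreover have "(\<integral>\<omega>. exp (\<i> * complex_of_real (u * (1 * (B t \<omega> - B 0 \<omega>) + 1 * (C t \<omega> - C 0 \<omega>)))) \<partial>M)
       = (\<integral>\<omega>. indicator (space M) \<omega> * exp (\<i> * complex_of_real (u * (1 * (B t \<omega> - B 0 \<omega>) + 1 * (C t \<omega> - C 0 \<omega>)))) \<partial>M)"
      by (rule Bochner_Integration.integral_cong) auto
    ultimately show "(\<integral>\<omega>. exp (\<i> * complex_of_real (u * (1 * (B t \<omega> - B 0 \<omega>) + 1 * (C t \<omega> - C 0 \<omega>)))) \<partial>M) = 1" by simp
  qed
  have "AE \<omega> in M. \<forall>m n::nat. 1 * (B (real m / real (Suc n)) \<omega> - B 0 \<omega>) + 1 * (C (real m / real (Suc n)) \<omega> - C 0 \<omega>) = 0"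
    by (intro AE_all_countable[THEN iffD2] allI pt) auto
  with start show ?thesis
  proof (eventually_elim, intro allI impI)
    fix \<omega> and t :: real
    assume s: "B 0 \<omega> = 0 \<and> C 0 \<omega> = 0 \<and> continuous_on {0..} (\<lambda>t. B t \<omega>) \<and> continuous_on {0..} (\<lambda>t. C t \<omega>)"
      and z: "\<forall>m n::nat. 1 * (B (real m / real (Suc n)) \<omega> - B 0 \<omega>) + 1 * (C (real m / real (Suc n)) \<omega> - C 0 \<omega>) = 0" and t: "0 \<le> t"
    show "B t \<omega> + C t \<omega> = 0"
    proof (rule continuous_zero_on_fractions[OF _ _ t])
      show "continuous_on {0..} (\<lambda>t. B t \<omega> + C t \<omega>)" using s by (auto intro: continuous_on_add)
      show "B (real m / real (Suc n)) \<omega> + C (real m / real (Suc n)) \<omega> = 0" for m n using z[rule_format, of m n] s by simp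
    qed
  qed
qed

text \<open>Both reciprocal integrals enter the weighted sum with nonpositive coefficients, so
  \<open>U + V t\<close> stays nonnegative. At a time where \<open>V t\<close> has standard
  deviation \<open>n\<close>, the event \<open>V t < - n\<close> has a positive probability that
  does not depend on \<open>n\<close> and forces \<open>U > n\<close>; no finite random variable
  \<open>U\<close> can satisfy this for all \<open>n\<close>.\<close>

lemma no_O2BP:
  assumes uc: "usual_conditions M F" and bm: "planar_BM M F \<rho> B C"
    and v: "0 \<le> v1" "0 \<le> v2" "v1 * \<alpha> + v2 * \<gamma> \<le> 0" "v1 * \<beta> + v2 * \<delta> \<le> 0"
    and var: "0 < v1\<^sup>2 + 2 * \<rho> * v1 * v2 + v2\<^sup>2"
  shows "\<not> O2BP M F \<alpha> \<beta> \<gamma> \<delta> B C X Y"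
proof
  assume o: "O2BP M F \<alpha> \<beta> \<gamma> \<delta> B C X Y"
  interpret filtered_prob_space M F by (rule usual_conditions_filtered[OF uc])
  define \<sigma> where "\<sigma> = v1\<^sup>2 + 2 * \<rho> * v1 * v2 + v2\<^sup>2"
  have BCM: "B t \<in> borel_measurable M" "C t \<in> borel_measurable M" if "0 \<le> t" for t
    using bm that measurable_F_M unfolding planar_BM_def by blast+
  have XYM: "X 0 \<in> borel_measurable M" "Y 0 \<in> borel_measurable M"
    using o measurable_F_M unfolding O2BP_def by blast+
  define U where "U \<omega> = v1 * X 0 \<omega> + v2 * Y 0 \<omega>" for \<omega>
  have UM[measurable]: "U \<in> borel_measurable M" unfolding U_def using XYM by measurable
  define V where "V t \<omega> = v1 * (B t \<omega> - B 0 \<omega>) + v2 * (C t \<omega> - C 0 \<omega>)" for t \<omega>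
  have sol: "AE \<omega> in M. path_solution \<alpha> \<beta> \<gamma> \<delta> (\<lambda>t. B t \<omega>) (\<lambda>t. C t \<omega>) (\<lambda>t. X t \<omega>) (\<lambda>t. Y t \<omega>)"
    using o unfolding O2BP_iff_path_solution by blast
  have start: "AE \<omega> in M. B 0 \<omega> = 0 \<and> C 0 \<omega> = 0"
    using bm unfolding planar_BM_def by (auto elim: AE_mp)
  have low: "AE \<omega> in M. \<forall>t\<ge>0. - U \<omega> \<le> V t \<omega>"
    using sol start
  proof (eventually_elim, intro allI impI)
    fix \<omega> and t :: real
    assume ps: "path_solution \<alpha> \<beta> \<gamma> \<delta> (\<lambda>t. B t \<omega>) (\<lambda>t. C t \<omega>) (\<lambda>t. X t \<omega>) (\<lambda>t. Y t \<omega>)" and s: "B 0 \<omega> = 0 \<and> C 0 \<omega> = 0" and t: "0 \<le> t"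
    note D = path_solutionD[OF ps]
    let ?I = "integral {0..t} (\<lambda>s. 1 / X s \<omega>)" and ?J = "integral {0..t} (\<lambda>s. 1 / Y s \<omega>)"
    have IJ: "0 \<le> ?I" "0 \<le> ?J" using D(3,4,7,8) t by (auto intro!: integral_nonneg)
    have "0 \<le> v1 * X t \<omega> + v2 * Y t \<omega>" using D(3,4)[OF t] v by simp
    also have "\<dots> = U \<omega> + V t \<omega> + (v1 * \<alpha> + v2 * \<gamma>) * ?I + (v1 * \<beta> + v2 * \<delta>) * ?J"
      unfolding U_def V_def by (subst D(9)[OF t], subst D(10)[OF t]) (use s in \<open>simp add: algebra_simps\<close>)
    also have "\<dots> \<le> U \<omega> + V t \<omega>" using mult_nonpos_nonneg[OF v(3) IJ(1)] mult_nonpos_nonneg[OF v(4) IJ(2)] by linarith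
    finally show "- U \<omega> \<le> V t \<omega>" by simp
  qed
  let ?p = "measure std_normal_distribution {..<-1}"
  have big: "?p \<le> prob {\<omega>\<in>space M. real n < U \<omega>}" if n: "0 < n" for n :: nat
  proof -
    \<comment> \<open>Chosen so that the variance of \<open>V t\<close>, which is
      \<open>\<sigma> * t\<close>, equals the square of \<open>n\<close>.\<close>
    define t where "t = (real n)\<^sup>2 / \<sigma>"
    have \<sigma>0: "0 < \<sigma>" using var by (simp add: \<sigma>_def)
    have t: "0 < t" using n \<sigma>0 by (simp add: t_def)
    have \<sigma>t: "\<sigma> * t = (real n)\<^sup>2" using \<sigma>0 by (simp add: t_def)
    have VM[measurable]: "V t \<in> borel_measurable M" unfolding V_def using BCM[OF less_imp_le[OF t]] BCM[OF order_refl] by measurable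
    have "conditionally_gaussian M (F 0) ((real n)\<^sup>2) (V t)"
      using planar_BM_conditionally_gaussian[OF bm order_refl less_imp_le[OF t], of v1 v2]
      unfolding V_def[abs_def] \<sigma>_def[symmetric] diff_0_right \<sigma>t .
    from gaussian_moments(1)[OF VM _ space_F sets_F this] n
    have d: "distr M borel (\<lambda>\<omega>. V t \<omega> / real n) = std_normal_distribution" by simp
    have "?p = prob ((\<lambda>\<omega>. V t \<omega> / real n) -` {..<-1} \<inter> space M)"
      unfolding d[symmetric] by (rule measure_distr) auto
    also have "\<dots> \<le> prob {\<omega>\<in>space M. real n < U \<omega>}"
    proof (rule finite_measure_mono_AE)
      show "AE \<omega> in M. \<omega> \<in> (\<lambda>\<omega>. V t \<omega> / real n) -` {..<-1} \<inter> space M \<longrightarrow> \<omega> \<in> {\<omega>\<in>space M. real n < U \<omega>}"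
        using low
      proof eventually_elim
        fix \<omega> assume "\<forall>t\<ge>0. - U \<omega> \<le> V t \<omega>"
        then have "- U \<omega> \<le> V t \<omega>" using t by simp
        then show "\<omega> \<in> (\<lambda>\<omega>. V t \<omega> / real n) -` {..<-1} \<inter> space M \<longrightarrow> \<omega> \<in> {\<omega>\<in>space M. real n < U \<omega>}"
          using n by (auto simp: divide_less_eq)
      qed
    qed measurable
    finally show ?thesis .
  qed
  have "(\<lambda>n. prob {\<omega>\<in>space M. real n < U \<omega>}) \<longlonglongrightarrow> prob (\<Inter>n. {\<omega>\<in>space M. real n < U \<omega>})"
    by (rule finite_Lim_measure_decseq) (auto simp: decseq_def)
  moreover have "(\<Inter>n. {\<omega>\<in>space M. real n < U \<omega>}) = {}"
    using reals_Archimedean2 by (auto, meson less_asym)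
  ultimately have "(\<lambda>n. prob {\<omega>\<in>space M. real n < U \<omega>}) \<longlonglongrightarrow> 0" by simp
  then have "?p \<le> 0" by (rule LIMSEQ_le_const) (use big in \<open>auto intro!: exI[of _ 1]\<close>)
  then show False using std_normal_lower_tail_pos by simp
qed

lemma O2BP_pathwise_unique:
  assumes s: "0 < \<alpha>" "0 < \<delta>" "\<beta> \<le> 0" "\<gamma> \<le> 0" and det: "\<beta> * \<gamma> \<le> \<alpha> * \<delta>"
  shows "pathwise_unique_O2BP M F \<alpha> \<beta> \<gamma> \<delta> B C X0 Y0"
  unfolding pathwise_unique_O2BP_def O2BP_iff_path_solution
proof (intro allI impI, elim conjE)
  fix X Y X' Y'
  assume "AE \<omega> in M. path_solution \<alpha> \<beta> \<gamma> \<delta> (\<lambda>t. B t \<omega>) (\<lambda>t. C t \<omega>) (\<lambda>t. X t \<omega>) (\<lambda>t. Y t \<omega>)"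
    "AE \<omega> in M. path_solution \<alpha> \<beta> \<gamma> \<delta> (\<lambda>t. B t \<omega>) (\<lambda>t. C t \<omega>) (\<lambda>t. X' t \<omega>) (\<lambda>t. Y' t \<omega>)"
    "AE \<omega> in M. X 0 \<omega> = X0 \<omega> \<and> Y 0 \<omega> = Y0 \<omega>" "AE \<omega> in M. X' 0 \<omega> = X0 \<omega> \<and> Y' 0 \<omega> = Y0 \<omega>"
  then show "AE \<omega> in M. \<forall>t\<ge>0. X t \<omega> = X' t \<omega> \<and> Y t \<omega> = Y' t \<omega>"
  proof (eventually_elim, intro allI impI)
    fix \<omega> and t :: real
    assume "path_solution \<alpha> \<beta> \<gamma> \<delta> (\<lambda>t. B t \<omega>) (\<lambda>t. C t \<omega>) (\<lambda>t. X t \<omega>) (\<lambda>t. Y t \<omega>)"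
      "path_solution \<alpha> \<beta> \<gamma> \<delta> (\<lambda>t. B t \<omega>) (\<lambda>t. C t \<omega>) (\<lambda>t. X' t \<omega>) (\<lambda>t. Y' t \<omega>)"
      "X 0 \<omega> = X0 \<omega> \<and> Y 0 \<omega> = Y0 \<omega>" "X' 0 \<omega> = X0 \<omega> \<and> Y' 0 \<omega> = Y0 \<omega>" "0 \<le> t"
    then show "X t \<omega> = X' t \<omega> \<and> Y t \<omega> = Y' t \<omega>"
      \<comment> \<open>With the weights \<open>\<delta> - \<gamma>\<close> and
        \<open>\<alpha> - \<beta>\<close> both required combinations equal
        \<open>\<alpha> * \<delta> - \<beta> * \<gamma>\<close>.\<close>
      by (intro path_solution_unique[of \<alpha> \<beta> \<gamma> \<delta> "\<lambda>t. B t \<omega>" "\<lambda>t. C t \<omega>" "\<lambda>t. X t \<omega>" "\<lambda>t. Y t \<omega>" "\<lambda>t. X' t \<omega>" "\<lambda>t. Y' t \<omega>" "\<delta> - \<gamma>" "\<alpha> - \<beta>"])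
        (use s det in \<open>auto simp: algebra_simps\<close>)
  qed
qed

text \<open>The hypotheses give path properties almost surely, the construction wants them
  everywhere. Noise and initial values are set to 0 on a null set, which belongs to every
  \<open>G t\<close> because the natural filtration is augmented, so adaptedness survives.
  \<open>R\<close> carries one more almost sure property; the last clause is stated pointwise so
  that \<open>B' + C' = 0\<close> can be derived at every sample point.\<close>

lemma bessel_driver_exists:
  assumes uc: "usual_conditions M F" and bm: "planar_BM M F \<rho> B C" and ini: "init_ok M F X0 Y0"
    and s: "0 < \<alpha>" "0 < \<delta>" "\<beta> \<le> 0" "\<gamma> \<le> 0" and R: "AE \<omega> in M. R \<omega>"
  obtains B' C' X0' Y0' G where "bessel_driver M F \<alpha> \<beta> \<gamma> \<delta> B' C' X0' Y0' G"
    and "\<forall>t. sets (G t) = aug_nat_sets M X0 Y0 B C t"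
    and "AE \<omega> in M. (\<forall>t. B' t \<omega> = B t \<omega> \<and> C' t \<omega> = C t \<omega>) \<and> X0' \<omega> = X0 \<omega> \<and> Y0' \<omega> = Y0 \<omega>"
    and "\<forall>\<omega>\<in>space M. (\<forall>t. B' t \<omega> = 0 \<and> C' t \<omega> = 0) \<or> (\<forall>t. B' t \<omega> = B t \<omega> \<and> C' t \<omega> = C t \<omega>) \<and> R \<omega>"
proof -
  interpret filtered_prob_space M F by (rule usual_conditions_filtered[OF uc])
  have start: "AE \<omega> in M. B 0 \<omega> = 0 \<and> C 0 \<omega> = 0 \<and> continuous_on {0..} (\<lambda>t. B t \<omega>) \<and> continuous_on {0..} (\<lambda>t. C t \<omega>)"
    using bm unfolding planar_BM_def by blast
  have nonneg: "AE \<omega> in M. 0 \<le> X0 \<omega> \<and> 0 \<le> Y0 \<omega>" using ini unfolding init_ok_def by blast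
  define ok where "ok \<omega> \<longleftrightarrow> (B 0 \<omega> = 0 \<and> C 0 \<omega> = 0 \<and> continuous_on {0..} (\<lambda>t. B t \<omega>) \<and> continuous_on {0..} (\<lambda>t. C t \<omega>)) \<and> (0 \<le> X0 \<omega> \<and> 0 \<le> Y0 \<omega>) \<and> R \<omega>" for \<omega>
  have "AE \<omega> in M. ok \<omega>" unfolding ok_def using start nonneg R by eventually_elim simp
  then have "\<exists>N. N \<in> null_sets M \<and> (\<forall>\<omega>\<in>space M - N. ok \<omega>)" by (rule AE_E3) blast
  then obtain N where N: "N \<in> null_sets M" and okN: "\<forall>\<omega>\<in>space M - N. ok \<omega>" by blast
  have good: "(B 0 \<omega> = 0 \<and> C 0 \<omega> = 0 \<and> continuous_on {0..} (\<lambda>t. B t \<omega>) \<and> continuous_on {0..} (\<lambda>t. C t \<omega>)) \<and> (0 \<le> X0 \<omega> \<and> 0 \<le> Y0 \<omega>) \<and> R \<omega>"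
    if "\<omega> \<in> space M - N" for \<omega> using okN that unfolding ok_def by blast
  define B' C' X0' Y0' where "B' t \<omega> = (if \<omega> \<in> N then 0 else B t \<omega>)" and "C' t \<omega> = (if \<omega> \<in> N then 0 else C t \<omega>)"
    and "X0' \<omega> = (if \<omega> \<in> N then 0 else X0 \<omega>)" and "Y0' \<omega> = (if \<omega> \<in> N then 0 else Y0 \<omega>)" for t \<omega>
  \<comment> \<open>Generated by the original noise and initial values, not by the altered ones,
    since strong solutions are defined relative to the original ones.\<close>
  define gen where "gen t = {f -` D \<inter> space M | f D. f \<in> {X0, Y0} \<union> {B s | s. s \<in> {0..t}} \<union> {C s | s. s \<in> {0..t}}
                                  \<and> D \<in> sets borel} \<union> null_sets M" for t
  define G where "G t = sigma (space M) (gen t)" for t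
  have genP: "gen t \<subseteq> Pow (space M)" for t
    unfolding gen_def by (auto dest!: null_setsD2 sets.sets_into_space)
  have spG: "space (G t) = space M" for t unfolding G_def using genP by simp
  have setsG: "sets (G t) = sigma_sets (space M) (gen t)" for t unfolding G_def using genP by simp
  have setsG': "sets (G t) = aug_nat_sets M X0 Y0 B C t" for t unfolding setsG aug_nat_sets_def gen_def ..
  have NG: "null_sets M \<subseteq> sets (G t)" for t unfolding setsG gen_def by (auto intro: sigma_sets.Basic)
  have nullF: "null_sets M \<subseteq> sets (F t)" if "0 \<le> t" for t
  proof -
    have "null_sets M \<subseteq> sets (F 0)" using uc unfolding usual_conditions_def by (elim conjE)
    then show ?thesis using mono_F[OF order_refl that] by (rule order_trans)
  qed
  have iniF: "X0 \<in> borel_measurable (F 0)" "Y0 \<in> borel_measurable (F 0)" using ini unfolding init_ok_def by auto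
  have BCF: "B t \<in> borel_measurable (F t)" "C t \<in> borel_measurable (F t)" if "0 \<le> t" for t
    using bm that unfolding planar_BM_def by auto
  have GF: "sets (G t) \<subseteq> sets (F t)" if t: "0 \<le> t" for t
  proof -
    have "gen t \<subseteq> sets (F t)"
    proof
      fix S assume "S \<in> gen t"
      then consider "S \<in> null_sets M" | f D where "S = f -` D \<inter> space M" "D \<in> sets borel" "f \<in> {X0, Y0} \<union> {B s | s. s \<in> {0..t}} \<union> {C s | s. s \<in> {0..t}}"
        unfolding gen_def by blast
      then show "S \<in> sets (F t)"
      proof cases
        case 1 then show ?thesis using nullF[OF t] by blast
      next
        case (2 f D)
        have "f \<in> borel_measurable (F t)"
          using 2(3) measurable_F_mono[OF _ _ iniF(1), of t] measurable_F_mono[OF _ _ iniF(2), of t] t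
            measurable_F_mono[OF _ _ BCF(1), of _ t] measurable_F_mono[OF _ _ BCF(2), of _ t] by auto
        from measurable_sets[OF this 2(2)] show ?thesis using 2(1) space_F[of t] by simp
      qed
    qed
    then show ?thesis unfolding setsG using sets.sigma_sets_subset[of "gen t" "F t"] space_F[of t] by simp
  qed
  have Gm: "f \<in> borel_measurable (G t)" if "f \<in> {X0, Y0} \<union> {B s | s. s \<in> {0..t}} \<union> {C s | s. s \<in> {0..t}}" for f t
  proof (rule measurableI)
    fix D :: "real set" assume "D \<in> sets borel"
    then show "f -` D \<inter> space (G t) \<in> sets (G t)" unfolding setsG spG gen_def using that by (intro sigma_sets.Basic) blast
  qed simp
  have G_mono: "sets (G s) \<subseteq> sets (G t)" if "s \<le> t" for s t
    unfolding setsG using that by (intro sigma_sets_mono') (auto simp: gen_def, (metis order_trans)+)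
  have NGt: "N \<in> sets (G t)" for t using N NG by blast
  have mod: "(\<lambda>\<omega>. if \<omega> \<in> N then 0 else f \<omega>) \<in> borel_measurable (G t)" if "f \<in> borel_measurable (G t)" for f :: "'a \<Rightarrow> real" and t
    using that NGt[of t] by (intro measurable_If_set) (auto simp: sets.Int_space_eq2)
  have NAE: "AE \<omega> in M. \<omega> \<notin> N" using N by (rule AE_not_in)
  have BCM: "B t \<in> borel_measurable M" "C t \<in> borel_measurable M" if "0 \<le> t" for t
    using BCF[OF that] measurable_F_M by auto
  \<comment> \<open>A change on a null set does not affect the integrals that characterise the
    conditional law.\<close>
  have cg: "conditionally_gaussian M (F s) (t - s) (\<lambda>\<omega>. W' t \<omega> - W' s \<omega>)"
    if g: "conditionally_gaussian M (F s) (t - s) (\<lambda>\<omega>. W t \<omega> - W s \<omega>)" and W: "W t \<in> borel_measurable M" "W s \<in> borel_measurable M"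
      and W': "\<And>r \<omega>. W' r \<omega> = (if \<omega> \<in> N then 0 else W r \<omega>)" for W W' :: "real \<Rightarrow> 'a \<Rightarrow> real" and s t
    unfolding conditionally_gaussian_def
  proof (intro allI ballI)
    fix u A assume A: "A \<in> sets (F s)"
    have [measurable]: "N \<in> sets M" "A \<in> sets M" using N A sets_F by auto
    have [measurable]: "W' t \<in> borel_measurable M" "W' s \<in> borel_measurable M" unfolding W'[abs_def] using W by measurable
    have "(\<integral>\<omega>. indicator A \<omega> * exp (\<i> * complex_of_real (u * (W' t \<omega> - W' s \<omega>))) \<partial>M)
        = (\<integral>\<omega>. indicator A \<omega> * exp (\<i> * complex_of_real (u * (W t \<omega> - W s \<omega>))) \<partial>M)"
    proof (rule integral_cong_AE)
      show "AE \<omega> in M. indicator A \<omega> * exp (\<i> * complex_of_real (u * (W' t \<omega> - W' s \<omega>))) = indicator A \<omega> * exp (\<i> * complex_of_real (u * (W t \<omega> - W s \<omega>)))"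
        using NAE by eventually_elim (simp add: W')
    qed (use W in measurable)
    then show "(\<integral>\<omega>. indicator A \<omega> * exp (\<i> * complex_of_real (u * (W' t \<omega> - W' s \<omega>))) \<partial>M)
        = complex_of_real (prob A * exp (- (t - s) * u\<^sup>2 / 2))"
      using conditionally_gaussianD[OF g A, of u] by simp
  qed
  have cgB: "conditionally_gaussian M (F s) (t - s) (\<lambda>\<omega>. B t \<omega> - B s \<omega>)"
    and cgC: "conditionally_gaussian M (F s) (t - s) (\<lambda>\<omega>. C t \<omega> - C s \<omega>)" if "0 \<le> s" "s < t" for s t
    using planar_BM_conditionally_gaussian[OF bm that(1) less_imp_le[OF that(2)], of 1 0]
      planar_BM_conditionally_gaussian[OF bm that(1) less_imp_le[OF that(2)], of 0 1] by auto
  have driver: "bessel_driver M F \<alpha> \<beta> \<gamma> \<delta> B' C' X0' Y0' G"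
  proof unfold_locales
    fix \<omega> assume \<omega>: "\<omega> \<in> space M"
    show "continuous_on {0..} (\<lambda>t. B' t \<omega>)" "continuous_on {0..} (\<lambda>t. C' t \<omega>)" "B' 0 \<omega> = 0" "C' 0 \<omega> = 0" "0 \<le> X0' \<omega>" "0 \<le> Y0' \<omega>"
      using good[of \<omega>] \<omega> by (cases "\<omega> \<in> N"; simp add: B'_def C'_def X0'_def Y0'_def)+
  next
    fix s t :: real assume st: "0 \<le> s" "s < t"
    show "conditionally_gaussian M (F s) (t - s) (\<lambda>\<omega>. B' t \<omega> - B' s \<omega>)"
      by (rule cg[OF cgB[OF st]]) (use BCM st in \<open>auto simp: B'_def\<close>)
    show "conditionally_gaussian M (F s) (t - s) (\<lambda>\<omega>. C' t \<omega> - C' s \<omega>)"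
      by (rule cg[OF cgC[OF st]]) (use BCM st in \<open>auto simp: C'_def\<close>)
  next
    fix t :: real assume t: "0 \<le> t"
    show "B' t \<in> borel_measurable (G t)" "C' t \<in> borel_measurable (G t)"
      unfolding B'_def[abs_def] C'_def[abs_def] using t by (intro mod Gm, auto)+
    show "sets (G t) \<subseteq> sets (F t)" by (rule GF[OF t])
  next
    show "X0' \<in> borel_measurable (G 0)" "Y0' \<in> borel_measurable (G 0)"
      unfolding X0'_def[abs_def] Y0'_def[abs_def] by (intro mod Gm, auto)+
    show "space (G t) = space M" for t by (rule spG)
    show "sets (G s) \<subseteq> sets (G t)" if "0 \<le> s" "s \<le> t" for s t using G_mono that by simp
  qed (use s in auto)
  show ?thesis
  proof (rule that[OF driver])
    show "\<forall>t. sets (G t) = aug_nat_sets M X0 Y0 B C t" using setsG' by blast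
    show "AE \<omega> in M. (\<forall>t. B' t \<omega> = B t \<omega> \<and> C' t \<omega> = C t \<omega>) \<and> X0' \<omega> = X0 \<omega> \<and> Y0' \<omega> = Y0 \<omega>"
      using NAE by eventually_elim (simp add: B'_def C'_def X0'_def Y0'_def)
    show "\<forall>\<omega>\<in>space M. (\<forall>t. B' t \<omega> = 0 \<and> C' t \<omega> = 0) \<or> (\<forall>t. B' t \<omega> = B t \<omega> \<and> C' t \<omega> = C t \<omega>) \<and> R \<omega>"
    proof
      fix \<omega> assume "\<omega> \<in> space M"
      then show "(\<forall>t. B' t \<omega> = 0 \<and> C' t \<omega> = 0) \<or> (\<forall>t. B' t \<omega> = B t \<omega> \<and> C' t \<omega> = C t \<omega>) \<and> R \<omega>"
        using good[of \<omega>] by (cases "\<omega> \<in> N") (simp_all add: B'_def C'_def)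
    qed
  qed
qed

section \<open>Strong solutions in the two regimes\<close>

lemma (in bessel_driver) strong_O2BP_limit:
  assumes sol: "AE \<omega> in M. path_solution \<alpha> \<beta> \<gamma> \<delta> (\<lambda>t. B t \<omega>) (\<lambda>t. C t \<omega>) (\<lambda>t. limX t \<omega>) (\<lambda>t. limY t \<omega>) \<and>
     limX 0 \<omega> = X0 \<omega> \<and> limY 0 \<omega> = Y0 \<omega>"
    and G: "\<forall>t. sets (G t) = aug_nat_sets M X0' Y0' B' C' t"
    and eq: "AE \<omega> in M. (\<forall>t. B t \<omega> = B' t \<omega> \<and> C t \<omega> = C' t \<omega>) \<and> X0 \<omega> = X0' \<omega> \<and> Y0 \<omega> = Y0' \<omega>"
  shows "strong_O2BP M F \<alpha> \<beta> \<gamma> \<delta> B' C' X0' Y0' limX limY"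
  unfolding strong_O2BP_def O2BP_iff_path_solution
proof (intro conjI allI impI ballI)
  fix t :: real assume t: "0 \<le> t"
  show "limX t \<in> borel_measurable (F t)" "limY t \<in> borel_measurable (F t)"
    using lim_measurable[OF t] measurable_G_F[OF t] by auto
  fix D :: "real set" assume "D \<in> sets borel"
  then show "limX t -` D \<inter> space M \<in> aug_nat_sets M X0' Y0' B' C' t" "limY t -` D \<inter> space M \<in> aug_nat_sets M X0' Y0' B' C' t"
    using measurable_sets[OF lim_measurable(1)[OF t]] measurable_sets[OF lim_measurable(2)[OF t]] by (simp_all add: G[rule_format] space_G)
next
  show "AE \<omega> in M. path_solution \<alpha> \<beta> \<gamma> \<delta> (\<lambda>t. B' t \<omega>) (\<lambda>t. C' t \<omega>) (\<lambda>t. limX t \<omega>) (\<lambda>t. limY t \<omega>)"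
    using sol eq by eventually_elim simp
  show "AE \<omega> in M. limX 0 \<omega> = X0' \<omega> \<and> limY 0 \<omega> = Y0' \<omega>" using sol eq by eventually_elim simp
qed

lemma (in bessel_driver) AE_solution_M_matrix:
  assumes det: "\<beta> * \<gamma> < \<alpha> * \<delta>"
  shows "AE \<omega> in M. path_solution \<alpha> \<beta> \<gamma> \<delta> (\<lambda>t. B t \<omega>) (\<lambda>t. C t \<omega>) (\<lambda>t. limX t \<omega>) (\<lambda>t. limY t \<omega>) \<and>
     limX 0 \<omega> = X0 \<omega> \<and> limY 0 \<omega> = Y0 \<omega>"
proof -
  obtain \<epsilon> \<kappa> k where c: "0 < \<epsilon>" "\<epsilon> \<le> 1 / 2" "0 < \<kappa>" "0 \<le> k" "\<And>p q. 0 < p \<Longrightarrow> 0 < q \<Longrightarrow> coercive \<alpha> \<beta> \<gamma> \<delta> (\<delta> - \<gamma>) (\<alpha> - \<beta>) \<epsilon> \<kappa> k p q"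
    using coercive_M_matrix[OF signs det] by blast
  obtain d where d: "0 \<le> d" "stable (space M) d" using stable_M_matrix[OF det] by blast
  have sp: "space M \<in> sets (F 0)" using space_F[of 0] sets.top[of "F 0"] by simp
  have "AE \<omega> in M. \<omega> \<in> space M \<longrightarrow>
     path_solution \<alpha> \<beta> \<gamma> \<delta> (\<lambda>t. B t \<omega>) (\<lambda>t. C t \<omega>) (\<lambda>t. limX t \<omega>) (\<lambda>t. limY t \<omega>) \<and> limX 0 \<omega> = X0 \<omega> \<and> limY 0 \<omega> = Y0 \<omega>"
    by (rule AE_limit_path_solution[where ?v1.0 = "\<delta> - \<gamma>" and ?v2.0 = "\<alpha> - \<beta>", OF sp d(2,1) c(1,2) _ _ c(3,4)]) (use signs in \<open>auto intro!: c(5) phi_pos\<close>)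
  then show ?thesis using AE_space by eventually_elim simp
qed

lemma (in bessel_driver) AE_solution_antisymmetric:
  assumes h: "\<alpha> + \<gamma> = 0" "\<beta> + \<delta> = 0" and BC: "\<And>\<omega> t. \<omega> \<in> space M \<Longrightarrow> 0 \<le> t \<Longrightarrow> B t \<omega> + C t \<omega> = 0"
    and ne: "AE \<omega> in M. (X0 \<omega>, Y0 \<omega>) \<noteq> (0, 0)"
  shows "AE \<omega> in M. path_solution \<alpha> \<beta> \<gamma> \<delta> (\<lambda>t. B t \<omega>) (\<lambda>t. C t \<omega>) (\<lambda>t. limX t \<omega>) (\<lambda>t. limY t \<omega>) \<and>
     limX 0 \<omega> = X0 \<omega> \<and> limY 0 \<omega> = Y0 \<omega>"
proof -
  have eqs: "- \<delta> = \<beta>" "- \<alpha> = \<gamma>" using h by auto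
  obtain d where d: "0 \<le> d" "stable (space M) d" using stable_antisymmetric[OF h BC] by blast
  define A where "A n = {\<omega>\<in>space M. 1 / real (Suc n) \<le> X0 \<omega> + Y0 \<omega>}" for n
  have AF: "A n \<in> sets (F 0)" for n
  proof -
    have [measurable]: "X0 \<in> borel_measurable (F 0)" "Y0 \<in> borel_measurable (F 0)" using init_G measurable_G_F[of 0] by auto
    have "{\<omega>\<in>space (F 0). 1 / real (Suc n) \<le> X0 \<omega> + Y0 \<omega>} \<in> sets (F 0)" by measurable
    then show ?thesis by (simp add: A_def space_F)
  qed
  have sA: "stable (A n) d" for n using d(2) unfolding stable_def A_def by blast
  have "AE \<omega> in M. \<omega> \<in> A n \<longrightarrow>
     path_solution \<alpha> \<beta> \<gamma> \<delta> (\<lambda>t. B t \<omega>) (\<lambda>t. C t \<omega>) (\<lambda>t. limX t \<omega>) (\<lambda>t. limY t \<omega>) \<and> limX 0 \<omega> = X0 \<omega> \<and> limY 0 \<omega> = Y0 \<omega>" for n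
  proof -
    \<comment> \<open>On \<open>A n\<close> the larger of \<open>X\<close> and \<open>Y\<close> is
      at least half of \<open>1 / Suc n\<close>, so its regularised reciprocal is at most
      \<open>r\<close>.\<close>
    define r where "r = 2 * real (Suc n)"
    have r: "1 \<le> r" by (simp add: r_def)
    obtain \<epsilon> \<kappa> k where c: "0 < \<epsilon>" "\<epsilon> \<le> 1 / 2" "0 < \<kappa>" "0 \<le> k"
      "\<And>p q. 0 < p \<Longrightarrow> 0 < q \<Longrightarrow> p \<le> r \<or> q \<le> r \<Longrightarrow> coercive \<alpha> \<beta> \<gamma> \<delta> 1 1 \<epsilon> \<kappa> k p q"
      using coercive_antisymmetric[OF signs(1,2) r] unfolding eqs by blast
    show ?thesis
    proof (rule AE_limit_path_solution[where ?v1.0 = 1 and ?v2.0 = 1, OF AF sA d(1) c(1,2) _ _ c(3,4)])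
      fix a s :: real and \<omega> assume a: "0 < a" and \<omega>: "\<omega> \<in> A n" and s: "0 \<le> s"
      have \<omega>M: "\<omega> \<in> space M" using \<omega> by (simp add: A_def)
      have sum: "1 / real (Suc n) \<le> X a s \<omega> + Y a s \<omega>"
        using XY_sum_constant[OF h a \<omega>M s BC[OF \<omega>M s]] \<omega> by (simp add: A_def)
      have le: "phi a z \<le> r" if "1 / r \<le> z" for z
      proof -
        have "0 < 1 / r" using r by simp
        then have z: "0 < z" using that by linarith
        then have "phi a z \<le> 1 / z" by (rule phi_le_inverse[OF a])
        also have "\<dots> \<le> r" using that z r by (simp add: field_simps)
        finally show ?thesis .
      qed
      have "1 / r + 1 / r = 1 / real (Suc n)" by (simp add: r_def field_simps)
      then have "1 / r \<le> X a s \<omega> \<or> 1 / r \<le> Y a s \<omega>" using sum by linarith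
      then show "coercive \<alpha> \<beta> \<gamma> \<delta> 1 1 \<epsilon> \<kappa> k (P a s \<omega>) (Q a s \<omega>)"
        using le by (intro c(5) phi_pos a) blast
    qed auto
  qed
  then have "AE \<omega> in M. \<forall>n. \<omega> \<in> A n \<longrightarrow>
     path_solution \<alpha> \<beta> \<gamma> \<delta> (\<lambda>t. B t \<omega>) (\<lambda>t. C t \<omega>) (\<lambda>t. limX t \<omega>) (\<lambda>t. limY t \<omega>) \<and> limX 0 \<omega> = X0 \<omega> \<and> limY 0 \<omega> = Y0 \<omega>"
    by (intro AE_all_countable[THEN iffD2] allI)
  then show ?thesis using ne AE_space
  proof eventually_elim
    fix \<omega> assume all: "\<forall>n. \<omega> \<in> A n \<longrightarrow>
     path_solution \<alpha> \<beta> \<gamma> \<delta> (\<lambda>t. B t \<omega>) (\<lambda>t. C t \<omega>) (\<lambda>t. limX t \<omega>) (\<lambda>t. limY t \<omega>) \<and> limX 0 \<omega> = X0 \<omega> \<and> limY 0 \<omega> = Y0 \<omega>"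
      and ne: "(X0 \<omega>, Y0 \<omega>) \<noteq> (0, 0)" and \<omega>: "\<omega> \<in> space M"
    have "0 < X0 \<omega> + Y0 \<omega>" using ne init_nonneg[OF \<omega>] by auto
    then obtain n where "inverse (real (Suc n)) < X0 \<omega> + Y0 \<omega>" using reals_Archimedean by blast
    then have "\<omega> \<in> A n" using \<omega> by (simp add: A_def inverse_eq_divide)
    then show "path_solution \<alpha> \<beta> \<gamma> \<delta> (\<lambda>t. B t \<omega>) (\<lambda>t. C t \<omega>) (\<lambda>t. limX t \<omega>) (\<lambda>t. limY t \<omega>) \<and> limX 0 \<omega> = X0 \<omega> \<and> limY 0 \<omega> = Y0 \<omega>"
      using all by blast
  qed
qed

theorem mainTheorem10:
  fixes M :: "'a measure" and F :: "real \<Rightarrow> 'a measure"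
    and B C :: "real \<Rightarrow> 'a \<Rightarrow> real"
    and \<alpha> \<beta> \<gamma> \<delta> \<rho> :: real
  assumes "usual_conditions M F"
    and "planar_BM M F \<rho> B C"
    and "-1 \<le> \<rho>" and "\<rho> \<le> 1"
    and "\<alpha> > 0" and "\<delta> > 0"
    and "\<beta> \<le> 0" and "\<gamma> \<le> 0"
  shows
   "(\<alpha> * \<delta> > \<beta> * \<gamma> \<longrightarrow>
      (\<forall>X0 Y0. init_ok M F X0 Y0 \<longrightarrow>
         (\<exists>X Y. strong_O2BP M F \<alpha> \<beta> \<gamma> \<delta> B C X0 Y0 X Y) \<and>
         pathwise_unique_O2BP M F \<alpha> \<beta> \<gamma> \<delta> B C X0 Y0)) \<and>
    (\<alpha> * \<delta> \<le> \<beta> * \<gamma> \<and> 1 + \<rho> + \<bar>\<alpha> + \<gamma>\<bar> + \<bar>\<beta> + \<delta>\<bar> > 0 \<longrightarrow>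
      \<not> (\<exists>X Y. O2BP M F \<alpha> \<beta> \<gamma> \<delta> B C X Y)) \<and>
    (1 + \<rho> = 0 \<and> \<alpha> + \<gamma> = 0 \<and> \<beta> + \<delta> = 0 \<longrightarrow>
      (\<forall>X0 Y0. init_ok M F X0 Y0 \<and> (AE \<omega> in M. (X0 \<omega>, Y0 \<omega>) \<noteq> (0, 0)) \<longrightarrow>
         (\<exists>X Y. strong_O2BP M F \<alpha> \<beta> \<gamma> \<delta> B C X0 Y0 X Y) \<and>
         pathwise_unique_O2BP M F \<alpha> \<beta> \<gamma> \<delta> B C X0 Y0)) \<and>
    (1 + \<rho> = 0 \<and> \<alpha> + \<gamma> = 0 \<and> \<beta> + \<delta> = 0 \<longrightarrow>
      \<not> (\<exists>X Y. O2BP M F \<alpha> \<beta> \<gamma> \<delta> B C X Y \<and> (AE \<omega> in M. X 0 \<omega> = 0 \<and> Y 0 \<omega> = 0)))"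
proof (intro conjI impI allI)
  note uc = assms(1) and bm = assms(2) and signs = assms(5-8)
  {
    fix X0 Y0 :: "'a \<Rightarrow> real" assume det: "\<beta> * \<gamma> < \<alpha> * \<delta>" and ini: "init_ok M F X0 Y0"
    show "pathwise_unique_O2BP M F \<alpha> \<beta> \<gamma> \<delta> B C X0 Y0" by (rule O2BP_pathwise_unique) (use signs det in auto)
    obtain B' C' X0' Y0' G where d: "bessel_driver M F \<alpha> \<beta> \<gamma> \<delta> B' C' X0' Y0' G"
      and G: "\<forall>t. sets (G t) = aug_nat_sets M X0 Y0 B C t"
      and eq: "AE \<omega> in M. (\<forall>t. B' t \<omega> = B t \<omega> \<and> C' t \<omega> = C t \<omega>) \<and> X0' \<omega> = X0 \<omega> \<and> Y0' \<omega> = Y0 \<omega>"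
      by (rule bessel_driver_exists[OF uc bm ini signs AE_I2[of M "\<lambda>_. True", OF TrueI]]) (rule that; assumption)
    interpret bessel_driver M F \<alpha> \<beta> \<gamma> \<delta> B' C' X0' Y0' G by (rule d)
    show "\<exists>X Y. strong_O2BP M F \<alpha> \<beta> \<gamma> \<delta> B C X0 Y0 X Y"
      using strong_O2BP_limit[OF AE_solution_M_matrix[OF det] G eq] by blast
  next
    fix X0 Y0 :: "'a \<Rightarrow> real" assume h: "1 + \<rho> = 0 \<and> \<alpha> + \<gamma> = 0 \<and> \<beta> + \<delta> = 0"
      and ini: "init_ok M F X0 Y0 \<and> (AE \<omega> in M. (X0 \<omega>, Y0 \<omega>) \<noteq> (0, 0))"
    have "\<beta> = - \<delta>" "\<gamma> = - \<alpha>" using h by auto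
    then show "pathwise_unique_O2BP M F \<alpha> \<beta> \<gamma> \<delta> B C X0 Y0" by (intro O2BP_pathwise_unique) (use signs in auto)
    obtain B' C' X0' Y0' G where d: "bessel_driver M F \<alpha> \<beta> \<gamma> \<delta> B' C' X0' Y0' G"
      and G: "\<forall>t. sets (G t) = aug_nat_sets M X0 Y0 B C t"
      and eq: "AE \<omega> in M. (\<forall>t. B' t \<omega> = B t \<omega> \<and> C' t \<omega> = C t \<omega>) \<and> X0' \<omega> = X0 \<omega> \<and> Y0' \<omega> = Y0 \<omega>"
      and alt: "\<forall>\<omega>\<in>space M. (\<forall>t. B' t \<omega> = 0 \<and> C' t \<omega> = 0) \<or> (\<forall>t. B' t \<omega> = B t \<omega> \<and> C' t \<omega> = C t \<omega>) \<and> (\<forall>t\<ge>0. B t \<omega> + C t \<omega> = 0)"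
      by (rule bessel_driver_exists[OF uc bm conjunct1[OF ini] signs planar_BM_sum_zero[OF uc bm conjunct1[OF h]]]) (rule that; assumption)
    interpret bessel_driver M F \<alpha> \<beta> \<gamma> \<delta> B' C' X0' Y0' G by (rule d)
    \<comment> \<open>At altered sample points both noises vanish; elsewhere the almost sure
      property carried along applies.\<close>
    have BC: "B' t \<omega> + C' t \<omega> = 0" if "\<omega> \<in> space M" "0 \<le> t" for \<omega> t using bspec[OF alt that(1)] that(2) by auto
    have ne: "AE \<omega> in M. (X0' \<omega>, Y0' \<omega>) \<noteq> (0, 0)" using conjunct2[OF ini] eq by eventually_elim simp
    show "\<exists>X Y. strong_O2BP M F \<alpha> \<beta> \<gamma> \<delta> B C X0 Y0 X Y"
      using strong_O2BP_limit[OF AE_solution_antisymmetric[OF _ _ BC ne] G eq] h by blast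
  next
    assume h: "\<alpha> * \<delta> \<le> \<beta> * \<gamma> \<and> 1 + \<rho> + \<bar>\<alpha> + \<gamma>\<bar> + \<bar>\<beta> + \<delta>\<bar> > 0"
    \<comment> \<open>Since \<open>\<beta> * \<gamma>\<close> is at least the positive
      \<open>\<alpha> * \<delta>\<close>, neither \<beta> nor \<gamma> is 0, and all weights used
      below are positive.\<close>
    have "0 < \<alpha> * \<delta>" using signs by simp
    then have "0 < \<beta> * \<gamma>" using h by linarith
    then have neg: "\<beta> < 0" "\<gamma> < 0" using signs by (auto simp: zero_less_mult_iff)
    \<comment> \<open>Shows that for positive weights the variance vanishes only if
      \<open>\<rho> = -1\<close> and the weights coincide.\<close>
    have var: "p\<^sup>2 + 2 * \<rho> * p * q + q\<^sup>2 = (p - q)\<^sup>2 + 2 * (1 + \<rho>) * (p * q)" for p q by (simp add: algebra_simps power2_eq_square)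
    \<comment> \<open>Candidate weights are \<open>(- \<gamma>, \<alpha>)\<close> and
      \<open>(\<delta>, - \<beta>)\<close>. They annihilate the coefficient of the
      \<open>1 / X\<close> integral and of the \<open>1 / Y\<close> integral respectively, and the
      sign of the determinant makes the other coefficient nonpositive. Each case selects a pair with
      positive variance.\<close>
    consider "0 < 1 + \<rho> \<or> \<alpha> + \<gamma> \<noteq> 0" | "\<beta> + \<delta> \<noteq> 0" using h assms(3) by fastforce
    then show "\<not> (\<exists>X Y. O2BP M F \<alpha> \<beta> \<gamma> \<delta> B C X Y)"
    proof cases
      case 1
      have pq: "0 < - \<gamma> * \<alpha>" using neg signs by (simp add: mult_neg_pos)
      have "0 < (- \<gamma> - \<alpha>)\<^sup>2 + 2 * (1 + \<rho>) * (- \<gamma> * \<alpha>)"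
      proof (cases "0 < 1 + \<rho>")
        case True
        then have "0 < 2 * (1 + \<rho>) * (- \<gamma> * \<alpha>)" by (intro mult_pos_pos[OF _ pq]) simp
        then show ?thesis using zero_le_power2[of "- \<gamma> - \<alpha>"] by linarith
      next
        case False
        then have "- \<gamma> - \<alpha> \<noteq> 0" "1 + \<rho> = 0" using 1 assms(3) by auto
        then show ?thesis by simp
      qed
      then have va: "0 < (- \<gamma>)\<^sup>2 + 2 * \<rho> * - \<gamma> * \<alpha> + \<alpha>\<^sup>2" unfolding var .
      have "\<not> O2BP M F \<alpha> \<beta> \<gamma> \<delta> B C X Y" for X Y
        by (rule no_O2BP[OF uc bm _ _ _ _ va]) (use neg signs h in \<open>simp_all add: mult.commute\<close>)
      then show ?thesis by blast
    next
      case 2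
      have pq: "0 \<le> 2 * (1 + \<rho>) * (\<delta> * - \<beta>)" using neg signs assms(3) by (intro mult_nonneg_nonneg) auto
      have "0 < (\<delta> - - \<beta>)\<^sup>2" using 2 by (simp add: add.commute)
      then have va: "0 < \<delta>\<^sup>2 + 2 * \<rho> * \<delta> * - \<beta> + (- \<beta>)\<^sup>2" unfolding var using pq by linarith
      have "\<not> O2BP M F \<alpha> \<beta> \<gamma> \<delta> B C X Y" for X Y
        by (rule no_O2BP[OF uc bm _ _ _ _ va]) (use neg signs h in \<open>simp_all add: mult.commute\<close>)
      then show ?thesis by blast
    qed
  next
    assume h: "1 + \<rho> = 0 \<and> \<alpha> + \<gamma> = 0 \<and> \<beta> + \<delta> = 0"
    show "\<not> (\<exists>X Y. O2BP M F \<alpha> \<beta> \<gamma> \<delta> B C X Y \<and> (AE \<omega> in M. X 0 \<omega> = 0 \<and> Y 0 \<omega> = 0))"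
    proof (intro notI, elim exE conjE)
      fix X Y assume o: "O2BP M F \<alpha> \<beta> \<gamma> \<delta> B C X Y" and z: "AE \<omega> in M. X 0 \<omega> = 0 \<and> Y 0 \<omega> = 0"
      interpret filtered_prob_space M F by (rule usual_conditions_filtered[OF uc])
      have sol: "AE \<omega> in M. path_solution \<alpha> \<beta> \<gamma> \<delta> (\<lambda>t. B t \<omega>) (\<lambda>t. C t \<omega>) (\<lambda>t. X t \<omega>) (\<lambda>t. Y t \<omega>)"
        using o unfolding O2BP_iff_path_solution by blast
      have "AE \<omega> in M. False"
        using sol z planar_BM_sum_zero[OF uc bm conjunct1[OF h]]
      proof eventually_elim
        fix \<omega>
        assume ps: "path_solution \<alpha> \<beta> \<gamma> \<delta> (\<lambda>t. B t \<omega>) (\<lambda>t. C t \<omega>) (\<lambda>t. X t \<omega>) (\<lambda>t. Y t \<omega>)"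
          and i: "X 0 \<omega> = 0 \<and> Y 0 \<omega> = 0" and bc: "\<forall>t\<ge>0. B t \<omega> + C t \<omega> = 0"
        note D = path_solutionD[OF ps]
        \<comment> \<open>Noise and drift cancel in \<open>X + Y\<close>, so two nonnegative paths
          have sum 0; \<open>X\<close> then vanishes throughout, against the negligibility of its
          zero set.\<close>
        have "X t \<omega> = 0" if t: "0 \<le> t" for t
        proof -
          let ?I = "integral {0..t} (\<lambda>s. 1 / X s \<omega>)" and ?J = "integral {0..t} (\<lambda>s. 1 / Y s \<omega>)"
          have "X t \<omega> + Y t \<omega> = (X 0 \<omega> + Y 0 \<omega>) + (B t \<omega> + C t \<omega>) + (\<alpha> + \<gamma>) * ?I + (\<beta> + \<delta>) * ?J"
            by (subst D(9)[OF t], subst D(10)[OF t]) (simp add: algebra_simps)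
          also have "\<dots> = 0" using i bc t h by simp
          finally show ?thesis using D(3,4)[OF t] by simp
        qed
        then have "{s\<in>{0..1}. X s \<omega> = 0} = {0..1}" by auto
        then have "negligible {0..1::real}" using D(5)[of 1] by simp
        then show False using negligible_interval(1)[of 0 "1::real"] by (simp add: box_real cbox_interval)
      qed
      then show False by (simp add: AE_False)
    qed
  }
qed

end
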